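(* Let $S\in\mathcal{F}^+_\hbar(U,R)$ be invertible and consider the conformal metric $h(\Phi,\Phi)=h(\bar\Phi,\bar\Phi)=S$, $h(\Phi,\bar\Phi)=0$ on $\mathcal{X}(\widehat{\mathcal{C}}_\hbar)$. Let $K=-\frac14\partial_u\big(S^{-1}\partial_uS\big)S^{-1}$ be its Gaussian curvature, and let $s=\phi(S)$. Then, whenever the integral exists, $$\tau_h(K)=-\pi\int_{-\infty}^\infty\partial_u\big(s^{-1}\partial_us\big)\,du=-\pi\big[s^{-1}\partial_us\big]_{-\infty}^{\infty}.$$ In particular, for $S=\frac14(R+R^{-1})^2$ one has $s=\cosh^2(u)$ and $\tau_h(K)=-4\pi$.
   Context: Let $\hbar\in\mathbb{R}$. $\mathcal{C}_\hbar$ is the unital associative $\mathbb{C}$-algebra with generators $U,R,R^{-1},W,W^{-1}$ and relations $WW^{-1}=W^{-1}W=1$, $RR^{-1}=R^{-1}R=1$, $RU=UR$, $R^{-1}U=UR^{-1}$, $WR=e^{\hbar}RW$, $WR^{-1}=e^{-\hbar}R^{-1}W$, $W^{-1}R=e^{-\hbar}RW^{-1}$, $W^{-1}R^{-1}=e^{\hbar}R^{-1}W^{-1}$, $WU=UW+\hbar W$, $W^{-1}U=UW^{-1}-\hbar W^{-1}$. It is a $*$-algebra via $U^*=U$, $R^*=R$, $W^*=W^{-1}$. Localization: let $Z_\hbar(U,R)$ be the commutative subalgebra generated by $1,U,R,R^{-1}$, let $\phi:Z_\hbar(U,R)\to C^\infty(\mathbb{R})$ be the algebra homomorphism $\phi(U)=u$,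 $\phi(R)=e^u$, $\phi(R^{-1})=e^{-u}$, and let $Z^+_\hbar(U,R)=\{p\in Z_\hbar(U,R):|\phi(p)(u)|>0\ \forall u\in\mathbb{R}\}$. $\widehat{\mathcal{C}}_\hbar$ is the universal localization of $\mathcal{C}_\hbar$ at $Z^+_\hbar(U,R)$ (the universal algebra receiving a homomorphism from $\mathcal{C}_\hbar$ under which all elements of $Z_\hbar^+(U,R)$ become invertible); $\mathcal{C}_\hbar$ embeds in it. $\mathcal{F}^+_\hbar(U,R)$ is the commutative subalgebra of $\widehat{\mathcal{C}}_\hbar$ generated by $Z_\hbar(U,R)$ and the inverses of elements of $Z^+_\hbar(U,R)$; $\phi$ is extended to $\mathcal{F}^+_\hbar(U,R)$ by $\phi(p^{-1})=1/\phi(p)$. Every $a\in\widehat{\mathcal{C}}_\hbar$ can be written as a finite sum $a=\sum_{k\in\mathbb{Z}}a_kW^k$ with $a_k\in\mathcal{F}^+_\hbar(U,R)$. The involution and derivations of $\mathcal{C}_\hbar$ are extended to $\widehat{\mathcal{C}}_\hbar$. Derivations: $\partial_u,\partial_v$ are the commuting hermitian derivations with $\partial_uU=1$, $\partial_uR=R$, $\partial_uW=0$, $\partial_vU=0$, $\partial_vR=0$, $\partial_vW=iW$. On smooth functions of $u\in\mathbb{R}$, $\partial_u$ denotes $d/du$. Let $\partial=\frac12(\partial_u-i\partial_v)$, $\bar\partial=\frac12(\partial_u+i\partial_v)$. Module: $e_1,e_2,e_3$ is the canonical basis of the free right module $(\widehat{\mathcal{C}}_\hbar)^3$; $\Phi^1=\frac12e^{\hbar/2}(RW-R^{-1}W^{-1})$,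 $\Phi^2=-\frac i2e^{\hbar/2}(RW+R^{-1}W^{-1})$, $\Phi^3=1$; $\Phi=\sum_ie_i\Phi^i$, $\bar\Phi=\sum_ie_i(\Phi^i)^*$; $\mathcal{X}(\widehat{\mathcal{C}}_\hbar)$ is the right submodule generated by $\Phi,\bar\Phi$, free with basis $\{\Phi,\bar\Phi\}$. A metric $h$ is a hermitian form: additive in the second argument, $h(X,Y)^*=h(Y,X)$, $h(X,Ya)=h(X,Y)a$. Gaussian curvature: $K$ is half of the scalar curvature $-\partial(T^{-1}\bar\partial T)S^{-1}-\bar\partial(S^{-1}\partial S)T^{-1}$ of the diagonal metric $h(\Phi,\Phi)=S$, $h(\bar\Phi,\bar\Phi)=T$; for $T=S\in\mathcal{F}^+_\hbar(U,R)$ this equals the expression in the claim. Integral: for $a=\sum_ka_kW^k$, $\tau_h(a)=4\pi\int_{-\infty}^\infty\phi(a_0)\phi(S)\,du$ whenever the integral exists. *)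

theory Defs
  imports "HOL-Analysis.Analysis" "HOL-Algebra.Generated_Rings" "HOL-Algebra.Module"
begin

section \<open>Complex algebras given by generators and relations\<close>

text \<open>The distribution has no noncommutative algebras over a field. A unital associative
  complex algebra is represented by a \<open>module\<close> record with scalars \<open>complex\<close>,
  using both the ring operations and \<open>smult\<close>.\<close>

type_synonym 'a calg = "(complex, 'a) module"

datatype 'g aterm = Gen 'g | Scal complex | Add "'g aterm" "'g aterm" | Mul "'g aterm" "'g aterm"

definition terms_over :: "'g set \<Rightarrow> 'g aterm set" where
  "terms_over G = {t. set_aterm t \<subseteq> G}"

text \<open>The least congruence on the terms over \<open>G\<close> that contains \<open>Q\<close> and makes the
  quotient a unital associative complex algebra (with \<open>c\<close> acting as \<open>Scal c\<close>).\<close>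

inductive_set pres_cong :: "'g set \<Rightarrow> ('g aterm \<times> 'g aterm) set \<Rightarrow> ('g aterm \<times> 'g aterm) set"
  for G :: "'g set" and Q :: "('g aterm \<times> 'g aterm) set" where
  relation: "(a, b) \<in> Q \<Longrightarrow> a \<in> terms_over G \<Longrightarrow> b \<in> terms_over G \<Longrightarrow> (a, b) \<in> pres_cong G Q"
| reflexive: "a \<in> terms_over G \<Longrightarrow> (a, a) \<in> pres_cong G Q"
| symmetric: "(a, b) \<in> pres_cong G Q \<Longrightarrow> (b, a) \<in> pres_cong G Q"
| transitive: "(a, b) \<in> pres_cong G Q \<Longrightarrow> (b, c) \<in> pres_cong G Q \<Longrightarrow> (a, c) \<in> pres_cong G Q"
| cong_add: "(a, a') \<in> pres_cong G Q \<Longrightarrow> (b, b') \<in> pres_cong G Q \<Longrightarrow>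
    (Add a b, Add a' b') \<in> pres_cong G Q"
| cong_mul: "(a, a') \<in> pres_cong G Q \<Longrightarrow> (b, b') \<in> pres_cong G Q \<Longrightarrow>
    (Mul a b, Mul a' b') \<in> pres_cong G Q"
| add_assoc: "a \<in> terms_over G \<Longrightarrow> b \<in> terms_over G \<Longrightarrow> c \<in> terms_over G \<Longrightarrow>
    (Add (Add a b) c, Add a (Add b c)) \<in> pres_cong G Q"
| add_comm: "a \<in> terms_over G \<Longrightarrow> b \<in> terms_over G \<Longrightarrow> (Add a b, Add b a) \<in> pres_cong G Q"
| add_zero: "a \<in> terms_over G \<Longrightarrow> (Add (Scal 0) a, a) \<in> pres_cong G Q"
| add_neg: "a \<in> terms_over G \<Longrightarrow> (Add (Mul (Scal (- 1)) a) a, Scal 0) \<in> pres_cong G Q"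
| mul_assoc: "a \<in> terms_over G \<Longrightarrow> b \<in> terms_over G \<Longrightarrow> c \<in> terms_over G \<Longrightarrow>
    (Mul (Mul a b) c, Mul a (Mul b c)) \<in> pres_cong G Q"
| one_left: "a \<in> terms_over G \<Longrightarrow> (Mul (Scal 1) a, a) \<in> pres_cong G Q"
| one_right: "a \<in> terms_over G \<Longrightarrow> (Mul a (Scal 1), a) \<in> pres_cong G Q"
| distrib_left: "a \<in> terms_over G \<Longrightarrow> b \<in> terms_over G \<Longrightarrow> c \<in> terms_over G \<Longrightarrow>
    (Mul a (Add b c), Add (Mul a b) (Mul a c)) \<in> pres_cong G Q"
| distrib_right: "a \<in> terms_over G \<Longrightarrow> b \<in> terms_over G \<Longrightarrow> c \<in> terms_over G \<Longrightarrow>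
    (Mul (Add a b) c, Add (Mul a c) (Mul b c)) \<in> pres_cong G Q"
| scal_add: "(Scal (x + y), Add (Scal x) (Scal y)) \<in> pres_cong G Q"
| scal_mul: "(Scal (x * y), Mul (Scal x) (Scal y)) \<in> pres_cong G Q"
| scal_central: "a \<in> terms_over G \<Longrightarrow> (Mul (Scal x) a, Mul a (Scal x)) \<in> pres_cong G Q"

definition pres_class :: "'g set \<Rightarrow> ('g aterm \<times> 'g aterm) set \<Rightarrow> 'g aterm \<Rightarrow> 'g aterm set" where
  "pres_class G Q t = pres_cong G Q `` {t}"

definition pres_alg :: "'g set \<Rightarrow> ('g aterm \<times> 'g aterm) set \<Rightarrow> 'g aterm set calg" where
  "pres_alg G Q =
    \<lparr> carrier = terms_over G // pres_cong G Q,
      mult = (\<lambda>x y. \<Union>a\<in>x. \<Union>b\<in>y. pres_class G Q (Mul a b)),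
      one = pres_class G Q (Scal 1),
      zero = pres_class G Q (Scal 0),
      add = (\<lambda>x y. \<Union>a\<in>x. \<Union>b\<in>y. pres_class G Q (Add a b)),
      smult = (\<lambda>c x. \<Union>a\<in>x. pres_class G Q (Mul (Scal c) a)) \<rparr>"

definition gen_subalg :: "'a calg \<Rightarrow> 'a set \<Rightarrow> 'a set" where
  "gen_subalg A H = generate_ring A (H \<union> {c \<odot>\<^bsub>A\<^esub> \<one>\<^bsub>A\<^esub> | c. True})"

section \<open>Universal localization\<close>

datatype 'a loc_gen = Emb 'a | Inv 'a

definition loc_gens :: "'a calg \<Rightarrow> 'a set \<Rightarrow> 'a loc_gen set" where
  "loc_gens A M = Emb ` carrier A \<union> Inv ` M"

definition loc_rels :: "'a calg \<Rightarrow> 'a set \<Rightarrow> ('a loc_gen aterm \<times> 'a loc_gen aterm) set" where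
  "loc_rels A M =
     {(Gen (Emb (a \<oplus>\<^bsub>A\<^esub> b)), Add (Gen (Emb a)) (Gen (Emb b))) | a b. a \<in> carrier A \<and> b \<in> carrier A}
   \<union> {(Gen (Emb (a \<otimes>\<^bsub>A\<^esub> b)), Mul (Gen (Emb a)) (Gen (Emb b))) | a b. a \<in> carrier A \<and> b \<in> carrier A}
   \<union> {(Gen (Emb (c \<odot>\<^bsub>A\<^esub> \<one>\<^bsub>A\<^esub>)), Scal c) | c. True}
   \<union> {(Mul (Gen (Emb p)) (Gen (Inv p)), Scal 1) | p. p \<in> M}
   \<union> {(Mul (Gen (Inv p)) (Gen (Emb p)), Scal 1) | p. p \<in> M}"

definition loc_alg :: "'a calg \<Rightarrow> 'a set \<Rightarrow> 'a loc_gen aterm set calg" where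
  "loc_alg A M = pres_alg (loc_gens A M) (loc_rels A M)"

definition loc_emb :: "'a calg \<Rightarrow> 'a set \<Rightarrow> 'a \<Rightarrow> 'a loc_gen aterm set" where
  "loc_emb A M a = pres_class (loc_gens A M) (loc_rels A M) (Gen (Emb a))"

section \<open>The algebra of the catenoid and its localization\<close>

datatype cgen = gU | gR | gRi | gW | gWi

inductive_set C_rels :: "real \<Rightarrow> (cgen aterm \<times> cgen aterm) set" for hbar :: real where
  "(Mul (Gen gW) (Gen gWi), Scal 1) \<in> C_rels hbar"
| "(Mul (Gen gWi) (Gen gW), Scal 1) \<in> C_rels hbar"
| "(Mul (Gen gR) (Gen gRi), Scal 1) \<in> C_rels hbar"
| "(Mul (Gen gRi) (Gen gR), Scal 1) \<in> C_rels hbar"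
| "(Mul (Gen gR) (Gen gU), Mul (Gen gU) (Gen gR)) \<in> C_rels hbar"
| "(Mul (Gen gRi) (Gen gU), Mul (Gen gU) (Gen gRi)) \<in> C_rels hbar"
| "(Mul (Gen gW) (Gen gR),
    Mul (Scal (of_real (exp hbar))) (Mul (Gen gR) (Gen gW))) \<in> C_rels hbar"
| "(Mul (Gen gW) (Gen gRi),
    Mul (Scal (of_real (exp (- hbar)))) (Mul (Gen gRi) (Gen gW))) \<in> C_rels hbar"
| "(Mul (Gen gWi) (Gen gR),
    Mul (Scal (of_real (exp (- hbar)))) (Mul (Gen gR) (Gen gWi))) \<in> C_rels hbar"
| "(Mul (Gen gWi) (Gen gRi),
    Mul (Scal (of_real (exp hbar))) (Mul (Gen gRi) (Gen gWi))) \<in> C_rels hbar"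
| "(Mul (Gen gW) (Gen gU),
    Add (Mul (Gen gU) (Gen gW)) (Mul (Scal (of_real hbar)) (Gen gW))) \<in> C_rels hbar"
| "(Mul (Gen gWi) (Gen gU),
    Add (Mul (Gen gU) (Gen gWi)) (Mul (Scal (- of_real hbar)) (Gen gWi))) \<in> C_rels hbar"

type_synonym celt = "cgen aterm set"

definition C_alg :: "real \<Rightarrow> celt calg" where
  "C_alg hbar = pres_alg UNIV (C_rels hbar)"

definition C_gen :: "real \<Rightarrow> cgen \<Rightarrow> celt" where
  "C_gen hbar g = pres_class UNIV (C_rels hbar) (Gen g)"

definition Z_alg :: "real \<Rightarrow> celt set" where
  "Z_alg hbar = gen_subalg (C_alg hbar) {C_gen hbar gU, C_gen hbar gR, C_gen hbar gRi}"

text \<open>Algebra homomorphisms from a subalgebra \<open>B\<close> of \<open>A\<close> to complex functions of a real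
  variable with pointwise operations. The homomorphisms used below take the stated values on
  generators, which forces their values on \<open>B\<close> to be smooth functions.\<close>

definition fun_hom :: "'a calg \<Rightarrow> 'a set \<Rightarrow> ('a \<Rightarrow> real \<Rightarrow> complex) \<Rightarrow> bool" where
  "fun_hom A B f \<longleftrightarrow>
     f \<one>\<^bsub>A\<^esub> = (\<lambda>u. 1) \<and>
     (\<forall>a\<in>B. \<forall>b\<in>B. f (a \<oplus>\<^bsub>A\<^esub> b) = (\<lambda>u. f a u + f b u)) \<and>
     (\<forall>a\<in>B. \<forall>b\<in>B. f (a \<otimes>\<^bsub>A\<^esub> b) = (\<lambda>u. f a u * f b u)) \<and>
     (\<forall>c. \<forall>a\<in>B. f (c \<odot>\<^bsub>A\<^esub> a) = (\<lambda>u. c * f a u))"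

text \<open>Each choice operator below selects an object that is unique on the relevant (sub)algebra.\<close>

definition phi_Z :: "real \<Rightarrow> celt \<Rightarrow> real \<Rightarrow> complex" where
  "phi_Z hbar = (SOME f. fun_hom (C_alg hbar) (Z_alg hbar) f \<and>
     f (C_gen hbar gU) = (\<lambda>u. of_real u) \<and>
     f (C_gen hbar gR) = (\<lambda>u. of_real (exp u)) \<and>
     f (C_gen hbar gRi) = (\<lambda>u. of_real (exp (- u))))"

definition Z_plus :: "real \<Rightarrow> celt set" where
  "Z_plus hbar = {p \<in> Z_alg hbar. \<forall>u. cmod (phi_Z hbar p u) > 0}"

type_synonym lelt = "celt loc_gen aterm set"

definition L_alg :: "real \<Rightarrow> lelt calg" where
  "L_alg hbar = loc_alg (C_alg hbar) (Z_plus hbar)"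

definition L_emb :: "real \<Rightarrow> celt \<Rightarrow> lelt" where
  "L_emb hbar = loc_emb (C_alg hbar) (Z_plus hbar)"

definition "L_U hbar = L_emb hbar (C_gen hbar gU)"
definition "L_R hbar = L_emb hbar (C_gen hbar gR)"
definition "L_Ri hbar = L_emb hbar (C_gen hbar gRi)"
definition "L_W hbar = L_emb hbar (C_gen hbar gW)"
definition "L_Wi hbar = L_emb hbar (C_gen hbar gWi)"

definition F_plus :: "real \<Rightarrow> lelt set" where
  "F_plus hbar = gen_subalg (L_alg hbar)
     (L_emb hbar ` Z_alg hbar \<union> {inv\<^bsub>L_alg hbar\<^esub> (L_emb hbar p) | p. p \<in> Z_plus hbar})"

definition phi :: "real \<Rightarrow> lelt \<Rightarrow> real \<Rightarrow> complex" where
  "phi hbar = (SOME f. fun_hom (L_alg hbar) (F_plus hbar) f \<and>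
     (\<forall>p\<in>Z_alg hbar. f (L_emb hbar p) = phi_Z hbar p) \<and>
     (\<forall>p\<in>Z_plus hbar. f (inv\<^bsub>L_alg hbar\<^esub> (L_emb hbar p)) = (\<lambda>u. 1 / phi_Z hbar p u)))"

section \<open>Involution and derivations\<close>

definition involution :: "'a calg \<Rightarrow> ('a \<Rightarrow> 'a) \<Rightarrow> bool" where
  "involution A st \<longleftrightarrow>
     (\<forall>a\<in>carrier A. st a \<in> carrier A \<and> st (st a) = a) \<and>
     (\<forall>a\<in>carrier A. \<forall>b\<in>carrier A. st (a \<oplus>\<^bsub>A\<^esub> b) = st a \<oplus>\<^bsub>A\<^esub> st b \<and>
        st (a \<otimes>\<^bsub>A\<^esub> b) = st b \<otimes>\<^bsub>A\<^esub> st a) \<and>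
     (\<forall>c. \<forall>a\<in>carrier A. st (c \<odot>\<^bsub>A\<^esub> a) = cnj c \<odot>\<^bsub>A\<^esub> st a)"

definition star :: "real \<Rightarrow> lelt \<Rightarrow> lelt" where
  "star hbar = (SOME st. involution (L_alg hbar) st \<and>
     st (L_U hbar) = L_U hbar \<and> st (L_R hbar) = L_R hbar \<and> st (L_W hbar) = L_Wi hbar)"

definition derivation :: "'a calg \<Rightarrow> ('a \<Rightarrow> 'a) \<Rightarrow> bool" where
  "derivation A D \<longleftrightarrow>
     (\<forall>a\<in>carrier A. D a \<in> carrier A) \<and>
     (\<forall>a\<in>carrier A. \<forall>b\<in>carrier A. D (a \<oplus>\<^bsub>A\<^esub> b) = D a \<oplus>\<^bsub>A\<^esub> D b \<and>
        D (a \<otimes>\<^bsub>A\<^esub> b) = (D a \<otimes>\<^bsub>A\<^esub> b) \<oplus>\<^bsub>A\<^esub> (a \<otimes>\<^bsub>A\<^esub> D b)) \<and>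
     (\<forall>c. \<forall>a\<in>carrier A. D (c \<odot>\<^bsub>A\<^esub> a) = c \<odot>\<^bsub>A\<^esub> D a)"

definition hermitian_derivation :: "real \<Rightarrow> (lelt \<Rightarrow> lelt) \<Rightarrow> bool" where
  "hermitian_derivation hbar D \<longleftrightarrow> derivation (L_alg hbar) D \<and>
     (\<forall>a\<in>carrier (L_alg hbar). D (star hbar a) = star hbar (D a))"

text \<open>The prescribed values determine both derivations and imply that they commute.\<close>

definition du :: "real \<Rightarrow> lelt \<Rightarrow> lelt" where
  "du hbar = (SOME D. hermitian_derivation hbar D \<and>
     D (L_U hbar) = \<one>\<^bsub>L_alg hbar\<^esub> \<and> D (L_R hbar) = L_R hbar \<and> D (L_W hbar) = \<zero>\<^bsub>L_alg hbar\<^esub>)"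

definition dv :: "real \<Rightarrow> lelt \<Rightarrow> lelt" where
  "dv hbar = (SOME D. hermitian_derivation hbar D \<and>
     D (L_U hbar) = \<zero>\<^bsub>L_alg hbar\<^esub> \<and> D (L_R hbar) = \<zero>\<^bsub>L_alg hbar\<^esub> \<and>
     D (L_W hbar) = \<i> \<odot>\<^bsub>L_alg hbar\<^esub> L_W hbar)"

definition del :: "real \<Rightarrow> lelt \<Rightarrow> lelt" where
  "del hbar a = (1/2) \<odot>\<^bsub>L_alg hbar\<^esub> (du hbar a \<ominus>\<^bsub>L_alg hbar\<^esub> (\<i> \<odot>\<^bsub>L_alg hbar\<^esub> dv hbar a))"

definition delbar :: "real \<Rightarrow> lelt \<Rightarrow> lelt" where
  "delbar hbar a = (1/2) \<odot>\<^bsub>L_alg hbar\<^esub> (du hbar a \<oplus>\<^bsub>L_alg hbar\<^esub> (\<i> \<odot>\<^bsub>L_alg hbar\<^esub> dv hbar a))"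

section \<open>The module of vector fields and its metrics\<close>

text \<open>Elements of the free right module of rank 3 are triples of coordinates with respect to the
  canonical basis.\<close>

type_synonym lvec = "lelt \<times> lelt \<times> lelt"

fun vadd :: "real \<Rightarrow> lvec \<Rightarrow> lvec \<Rightarrow> lvec" where
  "vadd hbar (x1, x2, x3) (y1, y2, y3) =
     (x1 \<oplus>\<^bsub>L_alg hbar\<^esub> y1, x2 \<oplus>\<^bsub>L_alg hbar\<^esub> y2, x3 \<oplus>\<^bsub>L_alg hbar\<^esub> y3)"

fun vmul :: "real \<Rightarrow> lvec \<Rightarrow> lelt \<Rightarrow> lvec" where
  "vmul hbar (x1, x2, x3) a =
     (x1 \<otimes>\<^bsub>L_alg hbar\<^esub> a, x2 \<otimes>\<^bsub>L_alg hbar\<^esub> a, x3 \<otimes>\<^bsub>L_alg hbar\<^esub> a)"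

definition Phi1 :: "real \<Rightarrow> lelt" where
  "Phi1 hbar = (1/2 * of_real (exp (hbar/2))) \<odot>\<^bsub>L_alg hbar\<^esub>
     ((L_R hbar \<otimes>\<^bsub>L_alg hbar\<^esub> L_W hbar) \<ominus>\<^bsub>L_alg hbar\<^esub> (L_Ri hbar \<otimes>\<^bsub>L_alg hbar\<^esub> L_Wi hbar))"

definition Phi2 :: "real \<Rightarrow> lelt" where
  "Phi2 hbar = (- (\<i>/2) * of_real (exp (hbar/2))) \<odot>\<^bsub>L_alg hbar\<^esub>
     ((L_R hbar \<otimes>\<^bsub>L_alg hbar\<^esub> L_W hbar) \<oplus>\<^bsub>L_alg hbar\<^esub> (L_Ri hbar \<otimes>\<^bsub>L_alg hbar\<^esub> L_Wi hbar))"

definition Phi3 :: "real \<Rightarrow> lelt" where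
  "Phi3 hbar = \<one>\<^bsub>L_alg hbar\<^esub>"

definition Phi :: "real \<Rightarrow> lvec" where
  "Phi hbar = (Phi1 hbar, Phi2 hbar, Phi3 hbar)"

definition Phi_bar :: "real \<Rightarrow> lvec" where
  "Phi_bar hbar = (star hbar (Phi1 hbar), star hbar (Phi2 hbar), star hbar (Phi3 hbar))"

definition vector_fields :: "real \<Rightarrow> lvec set" where
  "vector_fields hbar = {vadd hbar (vmul hbar (Phi hbar) a) (vmul hbar (Phi_bar hbar) b) | a b.
     a \<in> carrier (L_alg hbar) \<and> b \<in> carrier (L_alg hbar)}"

definition metric :: "real \<Rightarrow> (lvec \<Rightarrow> lvec \<Rightarrow> lelt) \<Rightarrow> bool" where
  "metric hbar h \<longleftrightarrow>
     (\<forall>X\<in>vector_fields hbar. \<forall>Y\<in>vector_fields hbar.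
        h X Y \<in> carrier (L_alg hbar) \<and>
        star hbar (h X Y) = h Y X \<and>
        (\<forall>Z\<in>vector_fields hbar. h X (vadd hbar Y Z) = h X Y \<oplus>\<^bsub>L_alg hbar\<^esub> h X Z) \<and>
        (\<forall>a\<in>carrier (L_alg hbar). h X (vmul hbar Y a) = h X Y \<otimes>\<^bsub>L_alg hbar\<^esub> a))"

definition conformal_metric :: "real \<Rightarrow> lelt \<Rightarrow> (lvec \<Rightarrow> lvec \<Rightarrow> lelt) \<Rightarrow> bool" where
  "conformal_metric hbar S h \<longleftrightarrow> metric hbar h \<and>
     h (Phi hbar) (Phi hbar) = S \<and> h (Phi_bar hbar) (Phi_bar hbar) = S \<and>
     h (Phi hbar) (Phi_bar hbar) = \<zero>\<^bsub>L_alg hbar\<^esub>"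

text \<open>Only meaningful for diagonal metrics, i.e. when \<open>\<Phi>\<close> and its conjugate are orthogonal and
  their squared lengths are invertible.\<close>

definition scalar_curvature :: "real \<Rightarrow> (lvec \<Rightarrow> lvec \<Rightarrow> lelt) \<Rightarrow> lelt" where
  "scalar_curvature hbar h =
    (let A = L_alg hbar; S = h (Phi hbar) (Phi hbar); T = h (Phi_bar hbar) (Phi_bar hbar) in
      (\<ominus>\<^bsub>A\<^esub> (del hbar (inv\<^bsub>A\<^esub> T \<otimes>\<^bsub>A\<^esub> delbar hbar T) \<otimes>\<^bsub>A\<^esub> inv\<^bsub>A\<^esub> S))
      \<ominus>\<^bsub>A\<^esub> (delbar hbar (inv\<^bsub>A\<^esub> S \<otimes>\<^bsub>A\<^esub> del hbar S) \<otimes>\<^bsub>A\<^esub> inv\<^bsub>A\<^esub> T))"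

definition gauss_curvature :: "real \<Rightarrow> (lvec \<Rightarrow> lvec \<Rightarrow> lelt) \<Rightarrow> lelt" where
  "gauss_curvature hbar h = (1/2) \<odot>\<^bsub>L_alg hbar\<^esub> scalar_curvature hbar h"

section \<open>The integral\<close>

definition W_expansion :: "real \<Rightarrow> lelt \<Rightarrow> (int \<Rightarrow> lelt) \<Rightarrow> bool" where
  "W_expansion hbar a c \<longleftrightarrow>
     (\<forall>k. c k \<in> F_plus hbar) \<and> finite {k. c k \<noteq> \<zero>\<^bsub>L_alg hbar\<^esub>} \<and>
     a = finsum (L_alg hbar) (\<lambda>k. c k \<otimes>\<^bsub>L_alg hbar\<^esub> (L_W hbar [^]\<^bsub>L_alg hbar\<^esub> k))
           {k. c k \<noteq> \<zero>\<^bsub>L_alg hbar\<^esub>}"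

definition W_coeff :: "real \<Rightarrow> lelt \<Rightarrow> int \<Rightarrow> lelt" where
  "W_coeff hbar a = (SOME c. W_expansion hbar a c)"

text \<open>On \<open>UNIV\<close> the Henstock-Kurzweil integral is the limit of the integrals over \<open>{a..b}\<close> as
  \<open>a\<close> and \<open>b\<close> tend to minus and plus infinity independently; it covers both the improper Riemann
  and the Lebesgue reading.\<close>

definition tau_integrand :: "real \<Rightarrow> (lvec \<Rightarrow> lvec \<Rightarrow> lelt) \<Rightarrow> lelt \<Rightarrow> real \<Rightarrow> complex" where
  "tau_integrand hbar h a =
     (\<lambda>u. phi hbar (W_coeff hbar a 0) u * phi hbar (h (Phi hbar) (Phi hbar)) u)"

definition tau_exists :: "real \<Rightarrow> (lvec \<Rightarrow> lvec \<Rightarrow> lelt) \<Rightarrow> lelt \<Rightarrow> bool" where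
  "tau_exists hbar h a \<longleftrightarrow> tau_integrand hbar h a integrable_on UNIV"

definition tau :: "real \<Rightarrow> (lvec \<Rightarrow> lvec \<Rightarrow> lelt) \<Rightarrow> lelt \<Rightarrow> complex" where
  "tau hbar h a = 4 * of_real pi * integral UNIV (tau_integrand hbar h a)"

definition ddu :: "(real \<Rightarrow> complex) \<Rightarrow> real \<Rightarrow> complex" where
  "ddu f = (\<lambda>u. vector_derivative f (at u))"

definition cosh_factor :: "real \<Rightarrow> lelt" where
  "cosh_factor hbar = (1/4) \<odot>\<^bsub>L_alg hbar\<^esub>
     ((L_R hbar \<oplus>\<^bsub>L_alg hbar\<^esub> L_Ri hbar) [^]\<^bsub>L_alg hbar\<^esub> (2::nat))"

end

theory Submission
  imports Defs
begin

text \<open>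
  The localized algebra acts on functions of \<open>(u, n) \<in> \<real> \<times> \<int>\<close>: elements of \<open>\<F>\<^sup>+\<close> act by multiplication
  with their symbol \<open>\<phi>\<close>, and \<open>W\<close> acts as the shift \<open>(u, n) \<mapsto> (u + \<hbar>, n + 1)\<close>. Applying an expansion
  \<open>\<Sum>\<^sub>k a\<^sub>k W\<^sup>k\<close> to the indicator function of \<open>n = 0\<close> isolates \<open>\<phi>(a\<^sub>0)\<close>, so \<open>\<tau>\<^sub>h\<close> does not
  depend on the chosen expansion. The involution and the derivations come from the universal property,
  as homomorphisms into the conjugate opposite algebra and into the dual numbers. On \<open>\<F>\<^sup>+\<close> the
  derivation \<open>\<partial>\<^sub>v\<close> vanishes and \<open>\<partial>\<^sub>u\<close> corresponds to \<open>d/du\<close> under \<open>\<phi>\<close>; hence the integrand of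
  \<open>\<tau>\<^sub>h(K)\<close> is \<open>- (s'/s)' / 4\<close>, because the factor \<open>s\<close> of the volume cancels the \<open>S\<^sup>-\<^sup>1\<close> in \<open>K\<close>,
  and the fundamental theorem of calculus applies.
\<close>

section \<open>Unital complex algebras\<close>

locale calgebra = ring A for A :: "'a calg" (structure) +
  assumes smult_closed [simp, intro]: "a \<in> carrier A \<Longrightarrow> c \<odot> a \<in> carrier A"
    and smult_l_distr: "a \<in> carrier A \<Longrightarrow> (c + d) \<odot> a = c \<odot> a \<oplus> d \<odot> a"
    and smult_r_distr: "a \<in> carrier A \<Longrightarrow> b \<in> carrier A \<Longrightarrow> c \<odot> (a \<oplus> b) = c \<odot> a \<oplus> c \<odot> b"
    and smult_smult: "a \<in> carrier A \<Longrightarrow> c \<odot> (d \<odot> a) = (c * d) \<odot> a"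
    and smult_1 [simp]: "a \<in> carrier A \<Longrightarrow> 1 \<odot> a = a"
    and smult_mult_l: "a \<in> carrier A \<Longrightarrow> b \<in> carrier A \<Longrightarrow> (c \<odot> a) \<otimes> b = c \<odot> (a \<otimes> b)"
    and smult_mult_r: "a \<in> carrier A \<Longrightarrow> b \<in> carrier A \<Longrightarrow> a \<otimes> (c \<odot> b) = c \<odot> (a \<otimes> b)"
begin

lemma smult_0_left [simp]: "a \<in> carrier A \<Longrightarrow> 0 \<odot> a = \<zero>"
  using smult_l_distr[of a 0 0] add.l_cancel_one by (metis add_0 smult_closed)

lemma smult_0_right [simp]: "c \<odot> \<zero> = \<zero>"
  using smult_r_distr[of \<zero> \<zero> c] add.l_cancel_one by (metis l_zero smult_closed zero_closed)

lemma smult_minus_1: "a \<in> carrier A \<Longrightarrow> (- 1) \<odot> a = \<ominus> a"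
  using smult_l_distr[of a "- 1" 1] minus_equality[of "(- 1) \<odot> a" a] by simp

lemma smult_uminus: "a \<in> carrier A \<Longrightarrow> (- c) \<odot> a = \<ominus> (c \<odot> a)"
  using smult_smult[of a "- 1" c] smult_minus_1[of "c \<odot> a"] by simp

lemma smult_one_mult: "a \<in> carrier A \<Longrightarrow> (c \<odot> \<one>) \<otimes> a = c \<odot> a"
  by (simp add: smult_mult_l)

lemma mult_smult_one: "a \<in> carrier A \<Longrightarrow> a \<otimes> (c \<odot> \<one>) = c \<odot> a"
  by (simp add: smult_mult_r)

end

definition calg_hom :: "'a calg \<Rightarrow> 'b calg \<Rightarrow> ('a \<Rightarrow> 'b) \<Rightarrow> bool" where
  "calg_hom A B f \<longleftrightarrow>
     (\<forall>a\<in>carrier A. f a \<in> carrier B) \<and> f \<one>\<^bsub>A\<^esub> = \<one>\<^bsub>B\<^esub> \<and>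
     (\<forall>a\<in>carrier A. \<forall>b\<in>carrier A.
        f (a \<oplus>\<^bsub>A\<^esub> b) = f a \<oplus>\<^bsub>B\<^esub> f b \<and> f (a \<otimes>\<^bsub>A\<^esub> b) = f a \<otimes>\<^bsub>B\<^esub> f b) \<and>
     (\<forall>c. \<forall>a\<in>carrier A. f (c \<odot>\<^bsub>A\<^esub> a) = c \<odot>\<^bsub>B\<^esub> f a)"

lemma calg_homD:
  assumes "calg_hom A B f"
  shows calg_hom_closed: "a \<in> carrier A \<Longrightarrow> f a \<in> carrier B"
    and calg_hom_one: "f \<one>\<^bsub>A\<^esub> = \<one>\<^bsub>B\<^esub>"
    and calg_hom_add: "a \<in> carrier A \<Longrightarrow> b \<in> carrier A \<Longrightarrow> f (a \<oplus>\<^bsub>A\<^esub> b) = f a \<oplus>\<^bsub>B\<^esub> f b"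
    and calg_hom_mult: "a \<in> carrier A \<Longrightarrow> b \<in> carrier A \<Longrightarrow> f (a \<otimes>\<^bsub>A\<^esub> b) = f a \<otimes>\<^bsub>B\<^esub> f b"
    and calg_hom_smult: "a \<in> carrier A \<Longrightarrow> f (c \<odot>\<^bsub>A\<^esub> a) = c \<odot>\<^bsub>B\<^esub> f a"
  using assms unfolding calg_hom_def by simp_all

lemma calg_hom_zero:
  assumes "calgebra A" "calgebra B" "calg_hom A B f"
  shows "f \<zero>\<^bsub>A\<^esub> = \<zero>\<^bsub>B\<^esub>"
proof -
  interpret A: calgebra A by fact
  interpret B: calgebra B by fact
  have "f (0 \<odot>\<^bsub>A\<^esub> \<one>\<^bsub>A\<^esub>) = 0 \<odot>\<^bsub>B\<^esub> f \<one>\<^bsub>A\<^esub>" by (rule calg_hom_smult[OF assms(3) A.one_closed])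
  then show ?thesis using calg_hom_closed[OF assms(3), of "\<one>\<^bsub>A\<^esub>"] by simp
qed

lemma calg_hom_Units:
  assumes "calgebra A" "calgebra B" "calg_hom A B f" "a \<in> Units A"
  shows "f a \<in> Units B" and "f (inv\<^bsub>A\<^esub> a) = inv\<^bsub>B\<^esub> (f a)"
proof -
  interpret A: calgebra A by fact
  interpret B: calgebra B by fact
  have a: "a \<in> carrier A" "inv\<^bsub>A\<^esub> a \<in> carrier A"
    using assms(4) by (simp_all add: A.Units_closed)
  note cl = calg_hom_closed[OF assms(3) a(1)] calg_hom_closed[OF assms(3) a(2)]
  have e1: "f a \<otimes>\<^bsub>B\<^esub> f (inv\<^bsub>A\<^esub> a) = \<one>\<^bsub>B\<^esub>"
    using calg_hom_mult[OF assms(3) a(1,2)] assms(4) by (simp add: calg_hom_one[OF assms(3)])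
  have e2: "f (inv\<^bsub>A\<^esub> a) \<otimes>\<^bsub>B\<^esub> f a = \<one>\<^bsub>B\<^esub>"
    using calg_hom_mult[OF assms(3) a(2,1)] assms(4) by (simp add: calg_hom_one[OF assms(3)])
  show "f a \<in> Units B" unfolding Units_def
    by (intro CollectI conjI bexI[of _ "f (inv\<^bsub>A\<^esub> a)"] e1 e2 cl)
  show "f (inv\<^bsub>A\<^esub> a) = inv\<^bsub>B\<^esub> (f a)"
    by (rule B.inv_char[OF cl e1 e2, symmetric])
qed

lemma calg_hom_comp:
  assumes "calg_hom A B f" "calg_hom B C g"
  shows "calg_hom A C (\<lambda>x. g (f x))"
  using assms unfolding calg_hom_def by simp

section \<open>Algebras given by generators and relations\<close>

primrec tev :: "'b calg \<Rightarrow> ('g \<Rightarrow> 'b) \<Rightarrow> 'g aterm \<Rightarrow> 'b" where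
  "tev B f (Gen g) = f g"
| "tev B f (Scal c) = c \<odot>\<^bsub>B\<^esub> \<one>\<^bsub>B\<^esub>"
| "tev B f (Add s t) = tev B f s \<oplus>\<^bsub>B\<^esub> tev B f t"
| "tev B f (Mul s t) = tev B f s \<otimes>\<^bsub>B\<^esub> tev B f t"

lemma terms_over_simps [simp]:
  "Gen g \<in> terms_over G \<longleftrightarrow> g \<in> G"
  "Scal c \<in> terms_over G"
  "Add s t \<in> terms_over G \<longleftrightarrow> s \<in> terms_over G \<and> t \<in> terms_over G"
  "Mul s t \<in> terms_over G \<longleftrightarrow> s \<in> terms_over G \<and> t \<in> terms_over G"
  by (auto simp: terms_over_def)

lemma tev_closed:
  assumes "calgebra B" "\<And>g. g \<in> G \<Longrightarrow> f g \<in> carrier B" "t \<in> terms_over G"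
  shows "tev B f t \<in> carrier B"
proof -
  interpret calgebra B by fact
  show ?thesis using assms(2,3) by (induction t) auto
qed

lemma pres_cong_terms:
  assumes "(s, t) \<in> pres_cong G Q"
  shows "s \<in> terms_over G" "t \<in> terms_over G"
  using assms by (induction rule: pres_cong.induct) auto

lemma tev_cong:
  assumes B: "calgebra B" and f: "\<And>g. g \<in> G \<Longrightarrow> f g \<in> carrier B"
    and Q: "\<And>s t. (s, t) \<in> Q \<Longrightarrow> s \<in> terms_over G \<Longrightarrow> t \<in> terms_over G \<Longrightarrow> tev B f s = tev B f t"
    and st: "(s, t) \<in> pres_cong G Q"
  shows "tev B f s = tev B f t"
proof -
  interpret calgebra B by fact
  have cl: "tev B f t \<in> carrier B" if "t \<in> terms_over G" for t
    by (rule tev_closed[OF B f that])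
  show ?thesis
    using st
  proof (induction rule: pres_cong.induct)
    case (add_neg a)
    then have "tev B f a \<in> carrier B" by (rule cl)
    then show ?case
      by (simp only: tev.simps smult_one_mult smult_minus_1[of "tev B f a"] l_neg smult_0_left one_closed)
  qed (use Q in \<open>simp_all add: cl a_ac m_assoc mult.commute l_distr r_distr smult_l_distr
      smult_one_mult mult_smult_one smult_smult\<close>)
qed

lemma equiv_pres_cong: "equiv (terms_over G) (pres_cong G Q)"
proof (rule equivI)
  show "pres_cong G Q \<subseteq> terms_over G \<times> terms_over G" using pres_cong_terms by fast
  show "refl_on (terms_over G) (pres_cong G Q)"
    by (auto intro!: refl_onI pres_cong.reflexive)
  show "sym (pres_cong G Q)" by (auto intro!: symI pres_cong.symmetric)
  show "trans (pres_cong G Q)" by (auto intro!: transI intro: pres_cong.transitive)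
qed

lemma pres_class_eq_iff:
  assumes "s \<in> terms_over G" "t \<in> terms_over G"
  shows "pres_class G Q s = pres_class G Q t \<longleftrightarrow> (s, t) \<in> pres_cong G Q"
  unfolding pres_class_def using equiv_pres_cong eq_equiv_class_iff assms by metis

lemma mem_pres_class: "x \<in> pres_class G Q s \<longleftrightarrow> (s, x) \<in> pres_cong G Q"
  by (simp add: pres_class_def)

lemma self_mem_pres_class: "s \<in> terms_over G \<Longrightarrow> s \<in> pres_class G Q s"
  by (simp add: mem_pres_class pres_cong.reflexive)

lemma pres_carrier: "carrier (pres_alg G Q) = pres_class G Q ` terms_over G"
  by (auto simp: pres_alg_def quotient_def pres_class_def)

lemma pres_class_closed [simp]: "s \<in> terms_over G \<Longrightarrow> pres_class G Q s \<in> carrier (pres_alg G Q)"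
  by (simp add: pres_carrier)

lemma
  assumes s: "s \<in> terms_over G"
  shows pres_add: "t \<in> terms_over G \<Longrightarrow>
      pres_class G Q s \<oplus>\<^bsub>pres_alg G Q\<^esub> pres_class G Q t = pres_class G Q (Add s t)"
    and pres_mult: "t \<in> terms_over G \<Longrightarrow>
      pres_class G Q s \<otimes>\<^bsub>pres_alg G Q\<^esub> pres_class G Q t = pres_class G Q (Mul s t)"
    and pres_smult: "c \<odot>\<^bsub>pres_alg G Q\<^esub> pres_class G Q s = pres_class G Q (Mul (Scal c) s)"
proof -
  have c: "pres_class G Q a = pres_class G Q b" if "(a, b) \<in> pres_cong G Q" for a b
    using that pres_cong_terms[OF that] by (simp add: pres_class_eq_iff)
  have m: "(a, s) \<in> pres_cong G Q" if "a \<in> pres_class G Q s" for a s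
    using that by (auto simp: mem_pres_class intro: pres_cong.symmetric)
  have s': "s \<in> pres_class G Q s" by (simp add: s self_mem_pres_class)
  have "(\<Union>a\<in>pres_class G Q s. pres_class G Q (Mul (Scal c) a)) =
      (\<Union>a\<in>pres_class G Q s. pres_class G Q (Mul (Scal c) s))"
    by (intro SUP_cong refl c pres_cong.cong_mul m pres_cong.reflexive) simp_all
  also have "\<dots> = pres_class G Q (Mul (Scal c) s)" using s' by blast
  finally show "c \<odot>\<^bsub>pres_alg G Q\<^esub> pres_class G Q s = pres_class G Q (Mul (Scal c) s)"
    by (simp add: pres_alg_def)
  assume "t \<in> terms_over G"
  then have t': "t \<in> pres_class G Q t" by (simp add: self_mem_pres_class)
  have "(\<Union>a\<in>pres_class G Q s. \<Union>b\<in>pres_class G Q t. pres_class G Q (Add a b)) =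
      (\<Union>a\<in>pres_class G Q s. \<Union>b\<in>pres_class G Q t. pres_class G Q (Add s t))"
    by (intro SUP_cong refl c pres_cong.cong_add m)
  also have "\<dots> = pres_class G Q (Add s t)" using s' t' by blast
  finally show "pres_class G Q s \<oplus>\<^bsub>pres_alg G Q\<^esub> pres_class G Q t = pres_class G Q (Add s t)"
    by (simp add: pres_alg_def)
  have "(\<Union>a\<in>pres_class G Q s. \<Union>b\<in>pres_class G Q t. pres_class G Q (Mul a b)) =
      (\<Union>a\<in>pres_class G Q s. \<Union>b\<in>pres_class G Q t. pres_class G Q (Mul s t))"
    by (intro SUP_cong refl c pres_cong.cong_mul m)
  also have "\<dots> = pres_class G Q (Mul s t)" using s' t' by blast
  finally show "pres_class G Q s \<otimes>\<^bsub>pres_alg G Q\<^esub> pres_class G Q t = pres_class G Q (Mul s t)"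
    by (simp add: pres_alg_def)
qed

lemmas pres_ops = pres_add pres_mult pres_smult

lemma pres_one: "\<one>\<^bsub>pres_alg G Q\<^esub> = pres_class G Q (Scal 1)"
  and pres_zero: "\<zero>\<^bsub>pres_alg G Q\<^esub> = pres_class G Q (Scal 0)"
  by (simp_all add: pres_alg_def)

lemma pres_class_Scal: "pres_class G Q (Scal c) = c \<odot>\<^bsub>pres_alg G Q\<^esub> \<one>\<^bsub>pres_alg G Q\<^esub>"
  by (simp add: pres_one pres_ops pres_class_eq_iff pres_cong.symmetric pres_cong.one_right)

lemma calgebra_pres_alg: "calgebra (pres_alg G Q)"
proof -
  let ?A = "pres_alg G Q"
  note ops = pres_ops pres_one pres_zero pres_class_eq_iff
  have carrE: P if "x \<in> carrier ?A" "\<And>s. x = pres_class G Q s \<Longrightarrow> s \<in> terms_over G \<Longrightarrow> P" for x P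
    using that by (auto simp: pres_carrier)
  have neg: "\<exists>y\<in>carrier ?A. y \<oplus>\<^bsub>?A\<^esub> x = \<zero>\<^bsub>?A\<^esub>" if "x \<in> carrier ?A" for x
    using that
    by (elim carrE, intro bexI[of _ "(- 1) \<odot>\<^bsub>?A\<^esub> x"]) (simp_all add: ops pres_cong.add_neg)
  have cl: "\<zero>\<^bsub>?A\<^esub> \<in> carrier ?A" "\<one>\<^bsub>?A\<^esub> \<in> carrier ?A"
    by (simp_all add: pres_one pres_zero)
  have add: "abelian_group ?A"
    by (rule abelian_groupI; (rule neg cl, assumption?)?; (elim carrE)?)
      (simp_all add: ops pres_cong.add_assoc pres_cong.add_comm pres_cong.add_zero)
  have mult: "monoid ?A"
    by (rule monoidI; (rule cl)?; (elim carrE)?)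
      (simp_all add: ops pres_cong.mul_assoc pres_cong.one_left pres_cong.one_right)
  have ring: "ring ?A"
    by (rule ringI[OF add mult]; elim carrE)
      (simp_all add: ops pres_cong.distrib_left pres_cong.distrib_right)
  interpret ring ?A by fact
  have sm: "c \<odot>\<^bsub>?A\<^esub> a = pres_class G Q (Scal c) \<otimes>\<^bsub>?A\<^esub> a" if "a \<in> carrier ?A" for a c
    by (rule carrE[OF that]) (simp add: ops pres_cong.reflexive)
  have sc: "pres_class G Q (Scal c) \<in> carrier ?A" for c by simp
  have cen: "a \<otimes>\<^bsub>?A\<^esub> pres_class G Q (Scal c) = pres_class G Q (Scal c) \<otimes>\<^bsub>?A\<^esub> a"
    if "a \<in> carrier ?A" for a c
    by (rule carrE[OF that]) (simp add: ops pres_cong.symmetric[OF pres_cong.scal_central])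
  have sa: "pres_class G Q (Scal (c + d)) = pres_class G Q (Scal c) \<oplus>\<^bsub>?A\<^esub> pres_class G Q (Scal d)"
    and ss: "pres_class G Q (Scal (c * d)) = pres_class G Q (Scal c) \<otimes>\<^bsub>?A\<^esub> pres_class G Q (Scal d)" for c d
    by (simp_all add: ops pres_cong.scal_add pres_cong.scal_mul)
  have one: "pres_class G Q (Scal 1) = \<one>\<^bsub>?A\<^esub>" by (simp only: pres_one)
  show ?thesis
  proof unfold_locales
    fix a b c d assume ab: "a \<in> carrier ?A" "b \<in> carrier ?A"
    show "c \<odot>\<^bsub>?A\<^esub> a \<in> carrier ?A" using ab by (simp add: sm sc)
    show "(c + d) \<odot>\<^bsub>?A\<^esub> a = c \<odot>\<^bsub>?A\<^esub> a \<oplus>\<^bsub>?A\<^esub> d \<odot>\<^bsub>?A\<^esub> a"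
      using ab by (simp only: sm sa l_distr sc)
    show "c \<odot>\<^bsub>?A\<^esub> (a \<oplus>\<^bsub>?A\<^esub> b) = c \<odot>\<^bsub>?A\<^esub> a \<oplus>\<^bsub>?A\<^esub> c \<odot>\<^bsub>?A\<^esub> b"
      using ab by (simp only: sm r_distr sc a_closed)
    show "c \<odot>\<^bsub>?A\<^esub> (d \<odot>\<^bsub>?A\<^esub> a) = (c * d) \<odot>\<^bsub>?A\<^esub> a"
      using ab by (simp only: sm ss m_assoc sc m_closed)
    show "1 \<odot>\<^bsub>?A\<^esub> a = a" using ab by (simp only: sm one l_one)
    show "(c \<odot>\<^bsub>?A\<^esub> a) \<otimes>\<^bsub>?A\<^esub> b = c \<odot>\<^bsub>?A\<^esub> (a \<otimes>\<^bsub>?A\<^esub> b)"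
      using ab by (simp only: sm m_assoc sc m_closed)
    show "a \<otimes>\<^bsub>?A\<^esub> (c \<odot>\<^bsub>?A\<^esub> b) = c \<odot>\<^bsub>?A\<^esub> (a \<otimes>\<^bsub>?A\<^esub> b)"
      using ab by (simp only: sm m_assoc[symmetric] sc m_closed cen)
  qed
qed

lemma pres_universal:
  assumes B: "calgebra B" and f: "\<And>g. g \<in> G \<Longrightarrow> f g \<in> carrier B"
    and Q: "\<And>s t. (s, t) \<in> Q \<Longrightarrow> s \<in> terms_over G \<Longrightarrow> t \<in> terms_over G \<Longrightarrow> tev B f s = tev B f t"
  obtains F where "calg_hom (pres_alg G Q) B F" "\<And>g. g \<in> G \<Longrightarrow> F (pres_class G Q (Gen g)) = f g"
proof -
  interpret B: calgebra B by fact
  define F where "F x = tev B f (SOME t. t \<in> x)" for x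
  have F: "F (pres_class G Q s) = tev B f s" if "s \<in> terms_over G" for s
  proof -
    have "(SOME t. t \<in> pres_class G Q s) \<in> pres_class G Q s"
      using self_mem_pres_class[OF that] by (rule someI)
    then have "(s, SOME t. t \<in> pres_class G Q s) \<in> pres_cong G Q" by (simp add: mem_pres_class)
    then show ?thesis unfolding F_def by (intro tev_cong[OF B f Q, symmetric]) assumption+
  qed
  have cl: "tev B f t \<in> carrier B" if "t \<in> terms_over G" for t
    by (rule tev_closed[OF B f that])
  have "calg_hom (pres_alg G Q) B F"
    unfolding calg_hom_def
    by (auto simp: pres_carrier F pres_ops pres_one cl B.smult_one_mult)
  then show ?thesis by (rule that) (simp add: F)
qed

lemma pres_induct [consumes 1, case_names gen scal add mult]:
  assumes x: "x \<in> carrier (pres_alg G Q)"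
    and "\<And>g. g \<in> G \<Longrightarrow> P (pres_class G Q (Gen g))"
    and "\<And>c. P (c \<odot>\<^bsub>pres_alg G Q\<^esub> \<one>\<^bsub>pres_alg G Q\<^esub>)"
    and "\<And>a b. a \<in> carrier (pres_alg G Q) \<Longrightarrow> b \<in> carrier (pres_alg G Q) \<Longrightarrow> P a \<Longrightarrow> P b \<Longrightarrow>
      P (a \<oplus>\<^bsub>pres_alg G Q\<^esub> b)"
    and "\<And>a b. a \<in> carrier (pres_alg G Q) \<Longrightarrow> b \<in> carrier (pres_alg G Q) \<Longrightarrow> P a \<Longrightarrow> P b \<Longrightarrow>
      P (a \<otimes>\<^bsub>pres_alg G Q\<^esub> b)"
  shows "P x"
proof -
  have P: "t \<in> terms_over G \<Longrightarrow> P (pres_class G Q t)" for t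
  proof (induction t)
    case (Gen g)
    then have "g \<in> G" by (simp only: terms_over_simps)
    then show ?case by (rule assms(2))
  next
    case (Scal c)
    show ?case unfolding pres_class_Scal by (rule assms(3))
  next
    case (Add s t)
    then have st: "s \<in> terms_over G" "t \<in> terms_over G" by (simp_all only: terms_over_simps)
    have "P (pres_class G Q s \<oplus>\<^bsub>pres_alg G Q\<^esub> pres_class G Q t)"
      by (rule assms(4)[OF pres_class_closed[OF st(1)] pres_class_closed[OF st(2)]
            Add.IH(1)[OF st(1)] Add.IH(2)[OF st(2)]])
    then show ?case by (simp only: pres_add[OF st])
  next
    case (Mul s t)
    then have st: "s \<in> terms_over G" "t \<in> terms_over G" by (simp_all only: terms_over_simps)
    have "P (pres_class G Q s \<otimes>\<^bsub>pres_alg G Q\<^esub> pres_class G Q t)"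
      by (rule assms(5)[OF pres_class_closed[OF st(1)] pres_class_closed[OF st(2)]
            Mul.IH(1)[OF st(1)] Mul.IH(2)[OF st(2)]])
    then show ?case by (simp only: pres_mult[OF st])
  qed
  from x obtain t where "t \<in> terms_over G" "x = pres_class G Q t"
    unfolding pres_carrier by (elim imageE)
  then show ?thesis using P by (simp only:)
qed

section \<open>Universal localization\<close>

lemma calgebra_loc_alg: "calgebra (loc_alg A M)"
  unfolding loc_alg_def by (rule calgebra_pres_alg)

lemma loc_rel_eq:
  assumes "(s, t) \<in> loc_rels A M" "s \<in> terms_over (loc_gens A M)" "t \<in> terms_over (loc_gens A M)"
  shows "pres_class (loc_gens A M) (loc_rels A M) s = pres_class (loc_gens A M) (loc_rels A M) t"
  using assms by (simp add: pres_class_eq_iff pres_cong.relation)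

lemma Emb_mem_loc_gens [simp]: "Emb a \<in> loc_gens A M \<longleftrightarrow> a \<in> carrier A"
  and Inv_mem_loc_gens [simp]: "Inv a \<in> loc_gens A M \<longleftrightarrow> a \<in> M"
  by (auto simp: loc_gens_def)

lemma calg_hom_loc_emb:
  assumes "calgebra A"
  shows "calg_hom A (loc_alg A M) (loc_emb A M)"
proof -
  interpret A: calgebra A by fact
  interpret L: calgebra "loc_alg A M" by (rule calgebra_loc_alg)
  let ?G = "loc_gens A M" and ?Q = "loc_rels A M"
  have cl: "loc_emb A M a \<in> carrier (loc_alg A M)" if "a \<in> carrier A" for a
    using that by (simp add: loc_emb_def loc_alg_def)
  have add: "loc_emb A M (a \<oplus>\<^bsub>A\<^esub> b) = loc_emb A M a \<oplus>\<^bsub>loc_alg A M\<^esub> loc_emb A M b"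
    and mult: "loc_emb A M (a \<otimes>\<^bsub>A\<^esub> b) = loc_emb A M a \<otimes>\<^bsub>loc_alg A M\<^esub> loc_emb A M b"
    if ab: "a \<in> carrier A" "b \<in> carrier A" for a b
  proof -
    have "(Gen (Emb (a \<oplus>\<^bsub>A\<^esub> b)), Add (Gen (Emb a)) (Gen (Emb b))) \<in> ?Q"
      "(Gen (Emb (a \<otimes>\<^bsub>A\<^esub> b)), Mul (Gen (Emb a)) (Gen (Emb b))) \<in> ?Q"
      using ab unfolding loc_rels_def by blast+
    from this[THEN loc_rel_eq] show
      "loc_emb A M (a \<oplus>\<^bsub>A\<^esub> b) = loc_emb A M a \<oplus>\<^bsub>loc_alg A M\<^esub> loc_emb A M b"
      "loc_emb A M (a \<otimes>\<^bsub>A\<^esub> b) = loc_emb A M a \<otimes>\<^bsub>loc_alg A M\<^esub> loc_emb A M b"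
      using ab by (simp_all add: loc_emb_def loc_alg_def pres_ops)
  qed
  have sc: "loc_emb A M (c \<odot>\<^bsub>A\<^esub> \<one>\<^bsub>A\<^esub>) = c \<odot>\<^bsub>loc_alg A M\<^esub> \<one>\<^bsub>loc_alg A M\<^esub>" for c
  proof -
    have "(Gen (Emb (c \<odot>\<^bsub>A\<^esub> \<one>\<^bsub>A\<^esub>)), Scal c) \<in> ?Q" unfolding loc_rels_def by blast
    from this[THEN loc_rel_eq] show ?thesis by (simp add: loc_emb_def loc_alg_def pres_class_Scal)
  qed
  have "\<And>c a. a \<in> carrier A \<Longrightarrow> loc_emb A M (c \<odot>\<^bsub>A\<^esub> a) = c \<odot>\<^bsub>loc_alg A M\<^esub> loc_emb A M a"
    subgoal for c a using mult[of "c \<odot>\<^bsub>A\<^esub> \<one>\<^bsub>A\<^esub>" a] by (simp add: A.smult_one_mult sc L.smult_one_mult cl)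
    done
  moreover have "loc_emb A M \<one>\<^bsub>A\<^esub> = \<one>\<^bsub>loc_alg A M\<^esub>" using sc[of 1] by simp
  ultimately show ?thesis unfolding calg_hom_def using cl add mult by simp
qed

lemma
  assumes "M \<subseteq> carrier A" "p \<in> M"
  shows loc_emb_Units: "loc_emb A M p \<in> Units (loc_alg A M)"
    and loc_inv_eq: "pres_class (loc_gens A M) (loc_rels A M) (Gen (Inv p)) =
          inv\<^bsub>loc_alg A M\<^esub> (loc_emb A M p)"
proof -
  let ?G = "loc_gens A M" and ?Q = "loc_rels A M"
  interpret L: calgebra "loc_alg A M" by (rule calgebra_loc_alg)
  have p: "p \<in> carrier A" using assms by auto
  let ?i = "pres_class ?G ?Q (Gen (Inv p))"
  have "(Mul (Gen (Emb p)) (Gen (Inv p)), Scal 1) \<in> ?Q" "(Mul (Gen (Inv p)) (Gen (Emb p)), Scal 1) \<in> ?Q"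
    using assms unfolding loc_rels_def by blast+
  from this[THEN loc_rel_eq] have
    e: "loc_emb A M p \<otimes>\<^bsub>loc_alg A M\<^esub> ?i = \<one>\<^bsub>loc_alg A M\<^esub>"
       "?i \<otimes>\<^bsub>loc_alg A M\<^esub> loc_emb A M p = \<one>\<^bsub>loc_alg A M\<^esub>"
    using p assms(2) by (simp_all add: loc_emb_def loc_alg_def pres_ops pres_one)
  have cl: "loc_emb A M p \<in> carrier (loc_alg A M)" "?i \<in> carrier (loc_alg A M)"
    using p assms(2) by (simp_all add: loc_emb_def loc_alg_def)
  show "loc_emb A M p \<in> Units (loc_alg A M)" using e cl unfolding Units_def by blast
  show "?i = inv\<^bsub>loc_alg A M\<^esub> (loc_emb A M p)" using L.inv_char[OF cl e] by simp
qed

lemma loc_universal: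
  assumes A: "calgebra A" and B: "calgebra B" and f: "calg_hom A B f"
    and M: "M \<subseteq> carrier A" and U: "\<And>p. p \<in> M \<Longrightarrow> f p \<in> Units B"
  obtains F where "calg_hom (loc_alg A M) B F" "\<And>a. a \<in> carrier A \<Longrightarrow> F (loc_emb A M a) = f a"
proof -
  interpret A: calgebra A by fact
  interpret B: calgebra B by fact
  let ?G = "loc_gens A M" and ?Q = "loc_rels A M"
  define k where "k g = (case g of Emb a \<Rightarrow> f a | Inv p \<Rightarrow> inv\<^bsub>B\<^esub> (f p))" for g
  have k: "k g \<in> carrier B" if "g \<in> ?G" for g
    using that U calg_hom_closed[OF f] by (auto simp: k_def loc_gens_def)
  have rel: "tev B k s = tev B k t" if "(s, t) \<in> ?Q" for s t
    using that unfolding loc_rels_def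
    by (auto simp: k_def calg_homD[OF f] U)
  obtain F where F: "calg_hom (pres_alg ?G ?Q) B F"
    "\<And>g. g \<in> ?G \<Longrightarrow> F (pres_class ?G ?Q (Gen g)) = k g"
    by (rule pres_universal[where B = B and f = k and G = ?G and Q = ?Q]) (simp_all only: B k rel)
  show ?thesis
  proof (rule that)
    show "calg_hom (loc_alg A M) B F" using F by (simp add: loc_alg_def)
    show "F (loc_emb A M a) = f a" if "a \<in> carrier A" for a
      using F(2)[of "Emb a"] that by (simp add: loc_emb_def k_def)
  qed
qed

lemma loc_induct [consumes 2, case_names emb inv add mult]:
  assumes x: "x \<in> carrier (loc_alg A M)" and M: "M \<subseteq> carrier A" and A: "calgebra A"
    and emb: "\<And>a. a \<in> carrier A \<Longrightarrow> P (loc_emb A M a)"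
    and inv: "\<And>p. p \<in> M \<Longrightarrow> P (inv\<^bsub>loc_alg A M\<^esub> (loc_emb A M p))"
    and add: "\<And>a b. a \<in> carrier (loc_alg A M) \<Longrightarrow> b \<in> carrier (loc_alg A M) \<Longrightarrow> P a \<Longrightarrow> P b \<Longrightarrow>
      P (a \<oplus>\<^bsub>loc_alg A M\<^esub> b)"
    and mult: "\<And>a b. a \<in> carrier (loc_alg A M) \<Longrightarrow> b \<in> carrier (loc_alg A M) \<Longrightarrow> P a \<Longrightarrow> P b \<Longrightarrow>
      P (a \<otimes>\<^bsub>loc_alg A M\<^esub> b)"
  shows "P x"
  using x unfolding loc_alg_def
proof (induction rule: pres_induct)
  case (gen g)
  then show ?case
  proof (cases g)
    case (Emb a)
    then show ?thesis using gen emb[of a] by (simp add: loc_emb_def)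
  next
    case (Inv p)
    then show ?thesis using gen inv[of p] loc_inv_eq[OF M] by simp
  qed
next
  case (scal c)
  interpret A: calgebra A by fact
  have "P (loc_emb A M (c \<odot>\<^bsub>A\<^esub> \<one>\<^bsub>A\<^esub>))" by (rule emb) simp
  then show ?case using calg_homD[OF calg_hom_loc_emb[OF A, of M]] by (simp flip: loc_alg_def)
next
  case (add a b)
  then show ?case using assms(6)[of a b] by (simp add: loc_alg_def)
next
  case (mult a b)
  then show ?case using assms(7)[of a b] by (simp add: loc_alg_def)
qed

section \<open>Auxiliary algebras\<close>

definition cop_alg :: "'a calg \<Rightarrow> 'a calg" where
  "cop_alg A = \<lparr> carrier = carrier A, mult = (\<lambda>x y. y \<otimes>\<^bsub>A\<^esub> x), one = \<one>\<^bsub>A\<^esub>, zero = \<zero>\<^bsub>A\<^esub>,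
     add = add A, smult = (\<lambda>c x. cnj c \<odot>\<^bsub>A\<^esub> x) \<rparr>"

text \<open>Dual numbers: \<open>a \<mapsto> (f a, D a)\<close> is a homomorphism into \<open>dual_alg B\<close> iff \<open>f\<close> is one and
  \<open>D\<close> is an \<open>f\<close>-derivation, so derivations come from universal properties.\<close>

definition dual_alg :: "'a calg \<Rightarrow> ('a \<times> 'a) calg" where
  "dual_alg A = \<lparr> carrier = carrier A \<times> carrier A,
     mult = (\<lambda>x y. (fst x \<otimes>\<^bsub>A\<^esub> fst y, (snd x \<otimes>\<^bsub>A\<^esub> fst y) \<oplus>\<^bsub>A\<^esub> (fst x \<otimes>\<^bsub>A\<^esub> snd y))),
     one = (\<one>\<^bsub>A\<^esub>, \<zero>\<^bsub>A\<^esub>), zero = (\<zero>\<^bsub>A\<^esub>, \<zero>\<^bsub>A\<^esub>),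
     add = (\<lambda>x y. (fst x \<oplus>\<^bsub>A\<^esub> fst y, snd x \<oplus>\<^bsub>A\<^esub> snd y)),
     smult = (\<lambda>c x. (c \<odot>\<^bsub>A\<^esub> fst x, c \<odot>\<^bsub>A\<^esub> snd x)) \<rparr>"

definition lin_op :: "(('x \<Rightarrow> complex) \<Rightarrow> 'x \<Rightarrow> complex) \<Rightarrow> bool" where
  "lin_op T \<longleftrightarrow> (\<forall>F G c. T (\<lambda>x. F x + c * G x) = (\<lambda>x. T F x + c * T G x))"

definition op_alg :: "(('x \<Rightarrow> complex) \<Rightarrow> 'x \<Rightarrow> complex) calg" where
  "op_alg = \<lparr> carrier = {T. lin_op T}, mult = (\<lambda>S T F. S (T F)), one = (\<lambda>F. F), zero = (\<lambda>F x. 0),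
     add = (\<lambda>S T F x. S F x + T F x), smult = (\<lambda>c T F x. c * T F x) \<rparr>"

lemma
  assumes "lin_op T"
  shows lin_op_add: "T (\<lambda>x. F x + G x) = (\<lambda>x. T F x + T G x)"
    and lin_op_scale: "T (\<lambda>x. c * G x) = (\<lambda>x. c * T G x)"
proof -
  have a: "T (\<lambda>x. F x + c * G x) = (\<lambda>x. T F x + c * T G x)" for F G c
    using assms by (auto simp: lin_op_def)
  show "T (\<lambda>x. F x + G x) = (\<lambda>x. T F x + T G x)" using a[of F 1 G] by simp
  have z: "T (\<lambda>x. 0) = (\<lambda>x. 0)"
    using a[of "\<lambda>x. 0" "-1" "\<lambda>x. 0"] by simp
  show "T (\<lambda>x. c * G x) = (\<lambda>x. c * T G x)" using a[of "\<lambda>x. 0" c G] z by simp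
qed

lemma calgebra_op_alg: "calgebra (op_alg :: (('x \<Rightarrow> complex) \<Rightarrow> 'x \<Rightarrow> complex) calg)"
proof -
  let ?A = "op_alg :: (('x \<Rightarrow> complex) \<Rightarrow> 'x \<Rightarrow> complex) calg"
  have add: "abelian_group ?A"
  proof (rule abelian_groupI)
    show "\<exists>y\<in>carrier ?A. y \<oplus>\<^bsub>?A\<^esub> x = \<zero>\<^bsub>?A\<^esub>" if "x \<in> carrier ?A" for x
      by (rule bexI[of _ "\<lambda>F t. - x F t"])
        (use that in \<open>auto simp: op_alg_def lin_op_def algebra_simps\<close>)
  qed (auto simp: op_alg_def lin_op_def algebra_simps)
  have mult: "monoid ?A"
    by (rule monoidI) (auto simp: op_alg_def lin_op_def algebra_simps)
  have ring: "ring ?A"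
    by (rule ringI[OF add mult]) (auto simp: op_alg_def lin_op_add algebra_simps)
  interpret ring ?A by fact
  show ?thesis
    by unfold_locales (auto simp: op_alg_def lin_op_scale, auto simp: lin_op_def algebra_simps)
qed

context calgebra
begin

lemma calgebra_cop_alg: "calgebra (cop_alg A)"
proof -
  have add: "abelian_group (cop_alg A)"
  proof (rule abelian_groupI)
    show "\<exists>y\<in>carrier (cop_alg A). y \<oplus>\<^bsub>cop_alg A\<^esub> x = \<zero>\<^bsub>cop_alg A\<^esub>"
      if "x \<in> carrier (cop_alg A)" for x
      by (rule bexI[of _ "\<ominus> x"]) (use that in \<open>auto simp: cop_alg_def l_neg\<close>)
  qed (auto simp: cop_alg_def a_ac)
  have mult: "monoid (cop_alg A)"
    by (rule monoidI) (auto simp: cop_alg_def m_assoc)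
  have ring: "ring (cop_alg A)"
    by (rule ringI[OF add mult]) (auto simp: cop_alg_def l_distr r_distr)
  then interpret cop: ring "cop_alg A" .
  show ?thesis
    by unfold_locales
      (auto simp: cop_alg_def smult_l_distr smult_r_distr smult_smult smult_mult_l smult_mult_r)
qed

lemma Units_cop_alg [simp]: "Units (cop_alg A) = Units A"
  by (auto simp: Units_def cop_alg_def)

lemma calgebra_dual_alg: "calgebra (dual_alg A)"
proof -
  have add: "abelian_group (dual_alg A)"
  proof (rule abelian_groupI)
    show "\<exists>y\<in>carrier (dual_alg A). y \<oplus>\<^bsub>dual_alg A\<^esub> x = \<zero>\<^bsub>dual_alg A\<^esub>"
      if "x \<in> carrier (dual_alg A)" for x
      by (rule bexI[of _ "(\<ominus> fst x, \<ominus> snd x)"]) (use that in \<open>auto simp: dual_alg_def l_neg\<close>)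
  qed (auto simp: dual_alg_def a_ac)
  have mult: "monoid (dual_alg A)"
    by (rule monoidI) (auto simp: dual_alg_def m_assoc l_distr r_distr a_assoc)
  have ring: "ring (dual_alg A)"
    by (rule ringI[OF add mult]) (auto simp: dual_alg_def l_distr r_distr a_ac)
  then interpret dual: ring "dual_alg A" .
  show ?thesis
    by unfold_locales
      (auto simp: dual_alg_def smult_l_distr smult_r_distr smult_smult smult_mult_l smult_mult_r)
qed

lemma Units_dual_alg:
  assumes a: "a \<in> Units A" and b: "b \<in> carrier A"
  shows "(a, b) \<in> Units (dual_alg A)"
proof -
  let ?c = "\<ominus> (inv a \<otimes> b \<otimes> inv a)"
  note [simp] = Units_closed[OF a]
  have "a \<otimes> (inv a \<otimes> b \<otimes> inv a) = b \<otimes> inv a"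
    using a b by (simp add: m_assoc[symmetric])
  moreover have "(inv a \<otimes> b \<otimes> inv a) \<otimes> a = inv a \<otimes> b"
    using a b by (simp add: m_assoc)
  ultimately have "b \<otimes> inv a \<oplus> a \<otimes> ?c = \<zero>" "?c \<otimes> a \<oplus> inv a \<otimes> b = \<zero>"
    using a b by (simp_all add: r_minus l_minus r_neg l_neg)
  then show ?thesis
    using a b unfolding Units_def[of "dual_alg A"]
    by (intro CollectI conjI bexI[of _ "(inv a, ?c)"]) (simp_all add: dual_alg_def)
qed

lemma unit_l_cancel: "x \<in> Units A \<Longrightarrow> a \<in> carrier A \<Longrightarrow> b \<in> carrier A \<Longrightarrow> x \<otimes> a = x \<otimes> b \<Longrightarrow> a = b"
  using Units_l_cancel by blast

lemma unit_r_cancel: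
  assumes "x \<in> Units A" "a \<in> carrier A" "b \<in> carrier A" "a \<otimes> x = b \<otimes> x"
  shows "a = b"
proof -
  note [simp] = Units_closed[OF assms(1)]
  have "a = (a \<otimes> x) \<otimes> inv x" using assms(1,2) by (simp add: m_assoc)
  also have "\<dots> = (b \<otimes> x) \<otimes> inv x" by (simp only: assms(4))
  also have "\<dots> = b" using assms(1,3) by (simp add: m_assoc)
  finally show ?thesis .
qed

section \<open>Subalgebras\<close>

lemma gen_subalg_subset: "H \<subseteq> carrier A \<Longrightarrow> gen_subalg A H \<subseteq> carrier A"
  unfolding gen_subalg_def by (rule generate_ring_incl) auto

lemma gen_subalg_incl: "h \<in> H \<Longrightarrow> h \<in> gen_subalg A H"
  unfolding gen_subalg_def by (intro generate_ring.incl) auto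

lemma gen_subalg_scalar: "c \<odot> \<one> \<in> gen_subalg A H"
  unfolding gen_subalg_def by (intro generate_ring.incl) auto

lemma gen_subalg_one: "\<one> \<in> gen_subalg A H"
  unfolding gen_subalg_def by (intro generate_ring.one)

lemma gen_subalg_zero: "\<zero> \<in> gen_subalg A H"
  using gen_subalg_scalar[of 0] by simp

lemma gen_subalg_add: "a \<in> gen_subalg A H \<Longrightarrow> b \<in> gen_subalg A H \<Longrightarrow> a \<oplus> b \<in> gen_subalg A H"
  unfolding gen_subalg_def by (intro generate_ring.eng_add)

lemma gen_subalg_mult: "a \<in> gen_subalg A H \<Longrightarrow> b \<in> gen_subalg A H \<Longrightarrow> a \<otimes> b \<in> gen_subalg A H"
  unfolding gen_subalg_def by (intro generate_ring.eng_mult)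

lemma gen_subalg_smult:
  "H \<subseteq> carrier A \<Longrightarrow> a \<in> gen_subalg A H \<Longrightarrow> c \<odot> a \<in> gen_subalg A H"
  using gen_subalg_mult[OF gen_subalg_scalar] gen_subalg_subset[of H]
  by (metis smult_one_mult subsetD)

lemma gen_subalg_minus:
  "H \<subseteq> carrier A \<Longrightarrow> a \<in> gen_subalg A H \<Longrightarrow> \<ominus> a \<in> gen_subalg A H"
  unfolding gen_subalg_def by (intro generate_ring.a_inv)

lemma gen_subalg_induct [consumes 2, case_names gen scal add mult]:
  assumes x: "x \<in> gen_subalg A H" and H: "H \<subseteq> carrier A"
    and gen: "\<And>h. h \<in> H \<Longrightarrow> P h"
    and scal: "\<And>c. P (c \<odot> \<one>)"
    and add: "\<And>a b. a \<in> gen_subalg A H \<Longrightarrow> b \<in> gen_subalg A H \<Longrightarrow> P a \<Longrightarrow> P b \<Longrightarrow> P (a \<oplus> b)"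
    and mult: "\<And>a b. a \<in> gen_subalg A H \<Longrightarrow> b \<in> gen_subalg A H \<Longrightarrow> P a \<Longrightarrow> P b \<Longrightarrow> P (a \<otimes> b)"
  shows "P x"
proof -
  let ?G = "generate_ring A (H \<union> {c \<odot> \<one> |c. True})"
  have "x \<in> ?G" using x by (simp add: gen_subalg_def)
  then show ?thesis
  proof (induction rule: generate_ring.induct)
    case one
    then show ?case using scal[of 1] by simp
  next
    case (incl h)
    then show ?case using gen scal by auto
  next
    case (a_inv h)
    then have h: "h \<in> gen_subalg A H" by (simp add: gen_subalg_def)
    then have "h \<in> carrier A" using gen_subalg_subset[OF H] by auto
    then have "\<ominus> h = ((- 1) \<odot> \<one>) \<otimes> h" by (simp only: smult_one_mult smult_minus_1)
    then show ?case using mult[OF gen_subalg_scalar h scal a_inv.IH] by simp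
  next
    case (eng_add a b)
    then show ?case using add by (simp add: gen_subalg_def)
  next
    case (eng_mult a b)
    then show ?case using mult by (simp add: gen_subalg_def)
  qed
qed

lemma gen_subalg_commute:
  assumes H: "H \<subseteq> carrier A" and c: "\<And>h k. h \<in> H \<Longrightarrow> k \<in> H \<Longrightarrow> h \<otimes> k = k \<otimes> h"
    and ab: "a \<in> gen_subalg A H" "b \<in> gen_subalg A H"
  shows "a \<otimes> b = b \<otimes> a"
proof -
  note sub = subsetD[OF gen_subalg_subset[OF H]]
  have 1: "a \<otimes> k = k \<otimes> a" if k: "k \<in> H" for k
    using ab(1) H
  proof (induction rule: gen_subalg_induct)
    case (mult a b)
    have kc: "k \<in> carrier A" using k H by auto
    have "a \<otimes> b \<otimes> k = a \<otimes> (k \<otimes> b)" using mult sub kc by (simp add: m_assoc)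
    also have "\<dots> = k \<otimes> (a \<otimes> b)" using mult sub kc by (simp add: m_assoc[symmetric])
    finally show ?case .
  qed (use H k c sub in \<open>auto simp: smult_mult_l smult_mult_r l_distr r_distr subsetD\<close>)
  show ?thesis
    using ab(2) H
  proof (induction rule: gen_subalg_induct)
    case (mult b d)
    have ac: "a \<in> carrier A" using ab sub by auto
    have "a \<otimes> (b \<otimes> d) = (b \<otimes> a) \<otimes> d" using mult sub ac by (simp add: m_assoc[symmetric])
    also have "\<dots> = b \<otimes> d \<otimes> a" using mult sub ac by (simp add: m_assoc)
    finally show ?case .
  qed (use H 1 sub[OF ab(1)] sub in \<open>auto simp: smult_mult_l smult_mult_r l_distr r_distr subsetD\<close>)
qed

lemma fun_hom_unique:
  assumes H: "H \<subseteq> carrier A"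
    and f: "fun_hom A (gen_subalg A H) f" and g: "fun_hom A (gen_subalg A H) g"
    and eq: "\<And>h. h \<in> H \<Longrightarrow> f h = g h" and x: "x \<in> gen_subalg A H"
  shows "f x = g x"
  using x H
proof (induction rule: gen_subalg_induct)
  case (scal c)
  then show ?case using f g gen_subalg_one[of H] by (simp add: fun_hom_def)
qed (use f g eq in \<open>simp_all add: fun_hom_def\<close>)

end

section \<open>The algebra of the catenoid\<close>

lemma calgebra_C: "calgebra (C_alg hbar)"
  unfolding C_alg_def by (rule calgebra_pres_alg)

lemma C_gen_closed [simp]: "C_gen hbar g \<in> carrier (C_alg hbar)"
  by (simp add: C_gen_def C_alg_def)

lemma C_rel:
  assumes "(s, t) \<in> C_rels hbar"
  shows "tev (C_alg hbar) (C_gen hbar) s = tev (C_alg hbar) (C_gen hbar) t"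
proof -
  have e: "tev (C_alg hbar) (C_gen hbar) s = pres_class UNIV (C_rels hbar) s" for s
    by (induction s) (simp_all add: C_alg_def C_gen_def pres_ops pres_class_Scal terms_over_def)
  show ?thesis unfolding e using assms
    by (subst pres_class_eq_iff) (auto simp: terms_over_def intro: pres_cong.relation)
qed

lemma C_induct [consumes 1, case_names gen scal add mult]:
  assumes "x \<in> carrier (C_alg hbar)"
    and "\<And>g. P (C_gen hbar g)"
    and "\<And>c. P (c \<odot>\<^bsub>C_alg hbar\<^esub> \<one>\<^bsub>C_alg hbar\<^esub>)"
    and "\<And>a b. a \<in> carrier (C_alg hbar) \<Longrightarrow> b \<in> carrier (C_alg hbar) \<Longrightarrow> P a \<Longrightarrow> P b \<Longrightarrow>
      P (a \<oplus>\<^bsub>C_alg hbar\<^esub> b)"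
    and "\<And>a b. a \<in> carrier (C_alg hbar) \<Longrightarrow> b \<in> carrier (C_alg hbar) \<Longrightarrow> P a \<Longrightarrow> P b \<Longrightarrow>
      P (a \<otimes>\<^bsub>C_alg hbar\<^esub> b)"
  shows "P x"
  using assms unfolding C_alg_def C_gen_def by (rule pres_induct)

lemma C_universal:
  assumes B: "calgebra B" and u: "u \<in> carrier B" and r: "r \<in> Units B" and w: "w \<in> Units B"
    and ru: "r \<otimes>\<^bsub>B\<^esub> u = u \<otimes>\<^bsub>B\<^esub> r"
    and wr: "w \<otimes>\<^bsub>B\<^esub> r = of_real (exp hbar) \<odot>\<^bsub>B\<^esub> (r \<otimes>\<^bsub>B\<^esub> w)"
    and wu: "w \<otimes>\<^bsub>B\<^esub> u = (u \<otimes>\<^bsub>B\<^esub> w) \<oplus>\<^bsub>B\<^esub> (of_real hbar \<odot>\<^bsub>B\<^esub> w)"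
  obtains F where "calg_hom (C_alg hbar) B F" "F (C_gen hbar gU) = u"
    "F (C_gen hbar gR) = r" "F (C_gen hbar gRi) = inv\<^bsub>B\<^esub> r"
    "F (C_gen hbar gW) = w" "F (C_gen hbar gWi) = inv\<^bsub>B\<^esub> w"
proof -
  interpret B: calgebra B by fact
  define ri wi where "ri = inv\<^bsub>B\<^esub> r" and "wi = inv\<^bsub>B\<^esub> w"
  define e f :: complex where "e = of_real (exp hbar)" and "f = of_real (exp (- hbar))"
  have ef: "e * f = 1" "f * e = 1"
    by (simp_all add: e_def f_def flip: of_real_mult exp_add)
  have cl [simp]: "u \<in> carrier B" "r \<in> carrier B" "w \<in> carrier B" "ri \<in> carrier B" "wi \<in> carrier B"
    using u r w by (simp_all add: ri_def wi_def B.Units_closed)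
  have i [simp]: "r \<otimes>\<^bsub>B\<^esub> ri = \<one>\<^bsub>B\<^esub>" "ri \<otimes>\<^bsub>B\<^esub> r = \<one>\<^bsub>B\<^esub>"
    "w \<otimes>\<^bsub>B\<^esub> wi = \<one>\<^bsub>B\<^esub>" "wi \<otimes>\<^bsub>B\<^esub> w = \<one>\<^bsub>B\<^esub>"
    using r w by (auto simp: ri_def wi_def)
  have i2: "x \<otimes>\<^bsub>B\<^esub> r \<otimes>\<^bsub>B\<^esub> ri = x" "x \<otimes>\<^bsub>B\<^esub> ri \<otimes>\<^bsub>B\<^esub> r = x"
    "x \<otimes>\<^bsub>B\<^esub> w \<otimes>\<^bsub>B\<^esub> wi = x" "x \<otimes>\<^bsub>B\<^esub> wi \<otimes>\<^bsub>B\<^esub> w = x" if "x \<in> carrier B" for x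
    using that by (simp_all add: B.m_assoc)
  have ass: "\<And>x y z. \<lbrakk>x \<in> carrier B; y \<in> carrier B; z \<in> carrier B\<rbrakk> \<Longrightarrow>
      x \<otimes>\<^bsub>B\<^esub> (y \<otimes>\<^bsub>B\<^esub> z) = x \<otimes>\<^bsub>B\<^esub> y \<otimes>\<^bsub>B\<^esub> z"
    by (simp add: B.m_assoc)
  have wr': "w \<otimes>\<^bsub>B\<^esub> r = e \<odot>\<^bsub>B\<^esub> (r \<otimes>\<^bsub>B\<^esub> w)" using wr by (simp add: e_def)
  have riu: "ri \<otimes>\<^bsub>B\<^esub> u = u \<otimes>\<^bsub>B\<^esub> ri"
    by (rule B.unit_l_cancel[OF r]) (simp_all add: ass ru i2)
  have wri: "w \<otimes>\<^bsub>B\<^esub> ri = f \<odot>\<^bsub>B\<^esub> (ri \<otimes>\<^bsub>B\<^esub> w)"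
  proof (rule B.unit_r_cancel[OF r])
    have "f \<odot>\<^bsub>B\<^esub> (ri \<otimes>\<^bsub>B\<^esub> w) \<otimes>\<^bsub>B\<^esub> r = f \<odot>\<^bsub>B\<^esub> (ri \<otimes>\<^bsub>B\<^esub> (w \<otimes>\<^bsub>B\<^esub> r))"
      by (simp add: B.smult_mult_l B.m_assoc)
    also have "\<dots> = w"
      by (simp add: wr' B.smult_mult_r B.smult_smult ef ass)
    finally show "w \<otimes>\<^bsub>B\<^esub> ri \<otimes>\<^bsub>B\<^esub> r = f \<odot>\<^bsub>B\<^esub> (ri \<otimes>\<^bsub>B\<^esub> w) \<otimes>\<^bsub>B\<^esub> r" by (simp add: i2)
  qed simp_all
  have wir: "wi \<otimes>\<^bsub>B\<^esub> r = f \<odot>\<^bsub>B\<^esub> (r \<otimes>\<^bsub>B\<^esub> wi)"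
    by (rule B.unit_l_cancel[OF w]) (simp_all add: ass B.smult_mult_r B.smult_mult_l B.smult_smult wr' ef i2)
  have wiri: "wi \<otimes>\<^bsub>B\<^esub> ri = e \<odot>\<^bsub>B\<^esub> (ri \<otimes>\<^bsub>B\<^esub> wi)"
    by (rule B.unit_l_cancel[OF w]) (simp_all add: ass B.smult_mult_r B.smult_mult_l B.smult_smult wri ef i2)
  have wiu: "wi \<otimes>\<^bsub>B\<^esub> u = (u \<otimes>\<^bsub>B\<^esub> wi) \<oplus>\<^bsub>B\<^esub> ((- of_real hbar) \<odot>\<^bsub>B\<^esub> wi)"
  proof (rule B.unit_l_cancel[OF w])
    have "w \<otimes>\<^bsub>B\<^esub> (u \<otimes>\<^bsub>B\<^esub> wi \<oplus>\<^bsub>B\<^esub> (- of_real hbar) \<odot>\<^bsub>B\<^esub> wi) =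
        (w \<otimes>\<^bsub>B\<^esub> u) \<otimes>\<^bsub>B\<^esub> wi \<oplus>\<^bsub>B\<^esub> (- of_real hbar) \<odot>\<^bsub>B\<^esub> \<one>\<^bsub>B\<^esub>"
      by (simp add: B.r_distr B.smult_mult_r ass)
    also have "\<dots> = u \<oplus>\<^bsub>B\<^esub> (of_real hbar \<odot>\<^bsub>B\<^esub> \<one>\<^bsub>B\<^esub> \<oplus>\<^bsub>B\<^esub> (- of_real hbar) \<odot>\<^bsub>B\<^esub> \<one>\<^bsub>B\<^esub>)"
      by (simp add: wu B.l_distr B.smult_mult_l i2 B.a_assoc)
    also have "\<dots> = u" by (simp flip: B.smult_l_distr)
    finally show "w \<otimes>\<^bsub>B\<^esub> (wi \<otimes>\<^bsub>B\<^esub> u) = w \<otimes>\<^bsub>B\<^esub> (u \<otimes>\<^bsub>B\<^esub> wi \<oplus>\<^bsub>B\<^esub> (- of_real hbar) \<odot>\<^bsub>B\<^esub> wi)"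
      by (simp add: ass)
  qed simp_all
  define k where "k g = (case g of gU \<Rightarrow> u | gR \<Rightarrow> r | gRi \<Rightarrow> ri | gW \<Rightarrow> w | gWi \<Rightarrow> wi)" for g
  have k: "k g \<in> carrier B" for g by (cases g) (simp_all add: k_def)
  have rel: "tev B k s = tev B k t" if "(s, t) \<in> C_rels hbar" for s t
    using that
    by (cases rule: C_rels.cases)
      (simp_all add: k_def ru riu wu wiu wr' wri wir wiri B.smult_one_mult flip: e_def f_def)
  obtain F where F: "calg_hom (pres_alg UNIV (C_rels hbar)) B F"
    "\<And>g. g \<in> UNIV \<Longrightarrow> F (pres_class UNIV (C_rels hbar) (Gen g)) = k g"
    by (rule pres_universal[where B = B and f = k and G = UNIV and Q = "C_rels hbar"])
      (simp_all only: B k rel)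
  show ?thesis
    by (rule that[of F]) (use F in \<open>auto simp: C_alg_def C_gen_def k_def ri_def wi_def\<close>)
qed

section \<open>The representation by multiplication and shift operators\<close>

text \<open>\<open>W\<close> shifts \<open>u\<close> by \<open>hbar\<close>; the integer coordinate records the degree in \<open>W\<close>, which
  keeps the powers of \<open>W\<close> independent even if \<open>hbar = 0\<close>.\<close>

type_synonym oper = "(real \<times> int \<Rightarrow> complex) \<Rightarrow> real \<times> int \<Rightarrow> complex"

definition mulop :: "(real \<Rightarrow> complex) \<Rightarrow> oper" where
  "mulop f = (\<lambda>F x. f (fst x) * F x)"

definition shiftop :: "real \<Rightarrow> int \<Rightarrow> oper" where
  "shiftop hbar k = (\<lambda>F x. F (fst x + of_int k * hbar, snd x + k))"

definition symb :: "oper \<Rightarrow> real \<Rightarrow> complex" where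
  "symb T = (\<lambda>u. T (\<lambda>x. 1) (u, 0))"

lemma symb_mulop [simp]: "symb (mulop f) = f"
  by (simp add: symb_def mulop_def)

interpretation Op: calgebra "op_alg :: oper calg"
  by (rule calgebra_op_alg)

lemma mulop_closed [simp]: "mulop f \<in> carrier op_alg"
  by (simp add: op_alg_def lin_op_def mulop_def algebra_simps)

lemma shiftop_closed [simp]: "shiftop hbar k \<in> carrier op_alg"
  by (simp add: op_alg_def lin_op_def shiftop_def)

lemma mulop_ops:
  shows mulop_one: "\<one>\<^bsub>op_alg\<^esub> = mulop (\<lambda>u. 1)"
    and mulop_add: "mulop f \<oplus>\<^bsub>op_alg\<^esub> mulop g = mulop (\<lambda>u. f u + g u)"
    and mulop_mult: "mulop f \<otimes>\<^bsub>op_alg\<^esub> mulop g = mulop (\<lambda>u. f u * g u)"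
    and mulop_smult: "c \<odot>\<^bsub>op_alg\<^esub> mulop f = mulop (\<lambda>u. c * f u)"
  by (simp_all add: op_alg_def mulop_def algebra_simps)

lemma shiftop_0: "shiftop hbar 0 = \<one>\<^bsub>op_alg\<^esub>"
  by (simp add: op_alg_def shiftop_def)

lemma shiftop_mult: "shiftop hbar j \<otimes>\<^bsub>op_alg\<^esub> shiftop hbar k = shiftop hbar (j + k)"
  by (simp add: op_alg_def shiftop_def algebra_simps)

lemma mulop_Units:
  assumes "\<And>u. f u \<noteq> 0"
  shows "mulop f \<in> Units op_alg" "inv\<^bsub>op_alg\<^esub> (mulop f) = mulop (\<lambda>u. 1 / f u)"
proof -
  have e: "mulop f \<otimes>\<^bsub>op_alg\<^esub> mulop (\<lambda>u. 1 / f u) = \<one>\<^bsub>op_alg\<^esub>"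
    "mulop (\<lambda>u. 1 / f u) \<otimes>\<^bsub>op_alg\<^esub> mulop f = \<one>\<^bsub>op_alg\<^esub>"
    using assms by (simp_all add: mulop_ops)
  show "mulop f \<in> Units op_alg" unfolding Units_def
    by (intro CollectI conjI bexI[of _ "mulop (\<lambda>u. 1 / f u)"] e mulop_closed)
  show "inv\<^bsub>op_alg\<^esub> (mulop f) = mulop (\<lambda>u. 1 / f u)"
    by (rule Op.inv_char[OF mulop_closed mulop_closed e])
qed

lemma shiftop_Units:
  shows "shiftop hbar k \<in> Units op_alg" "inv\<^bsub>op_alg\<^esub> (shiftop hbar k) = shiftop hbar (- k)"
proof -
  have e: "shiftop hbar k \<otimes>\<^bsub>op_alg\<^esub> shiftop hbar (- k) = \<one>\<^bsub>op_alg\<^esub>"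
    "shiftop hbar (- k) \<otimes>\<^bsub>op_alg\<^esub> shiftop hbar k = \<one>\<^bsub>op_alg\<^esub>"
    by (simp_all add: shiftop_mult shiftop_0)
  show "shiftop hbar k \<in> Units op_alg" unfolding Units_def
    by (intro CollectI conjI bexI[of _ "shiftop hbar (- k)"] e shiftop_closed)
  show "inv\<^bsub>op_alg\<^esub> (shiftop hbar k) = shiftop hbar (- k)"
    by (rule Op.inv_char[OF shiftop_closed shiftop_closed e])
qed

lemma rep_gen_subalg:
  assumes A: "calgebra A" and H: "H \<subseteq> carrier A" and r: "calg_hom A op_alg r"
    and gen: "\<forall>h\<in>H. r h = mulop (symb (r h))"
  shows "a \<in> gen_subalg A H \<Longrightarrow> r a = mulop (symb (r a))"
    and "fun_hom A (gen_subalg A H) (\<lambda>a. symb (r a))"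
proof -
  interpret A: calgebra A by fact
  note sub = subsetD[OF A.gen_subalg_subset[OF H]]
  have 1: "r a = mulop (symb (r a))" if "a \<in> gen_subalg A H" for a
  proof -
    have "\<exists>f. r a = mulop f"
      using that H
    proof (induction rule: A.gen_subalg_induct)
      case (gen h)
      then show ?case using assms(4) by blast
    next
      case (scal c)
      then show ?case
        by (auto simp: calg_hom_smult[OF r] calg_hom_one[OF r] mulop_ops)
    next
      case (add a b)
      then show ?case by (auto simp: calg_hom_add[OF r] sub mulop_ops)
    next
      case (mult a b)
      then show ?case by (auto simp: calg_hom_mult[OF r] sub mulop_ops)
    qed
    then show ?thesis by auto
  qed
  then show "a \<in> gen_subalg A H \<Longrightarrow> r a = mulop (symb (r a))" .
  have 2: "symb (r (a \<oplus>\<^bsub>A\<^esub> b)) = (\<lambda>u. symb (r a) u + symb (r b) u)"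
    "symb (r (a \<otimes>\<^bsub>A\<^esub> b)) = (\<lambda>u. symb (r a) u * symb (r b) u)"
    "symb (r (c \<odot>\<^bsub>A\<^esub> a)) = (\<lambda>u. c * symb (r a) u)"
    if ab: "a \<in> gen_subalg A H" "b \<in> gen_subalg A H" for a b c
  proof -
    obtain f g where "r a = mulop f" "r b = mulop g" using 1[OF ab(1)] 1[OF ab(2)] by blast
    then show "symb (r (a \<oplus>\<^bsub>A\<^esub> b)) = (\<lambda>u. symb (r a) u + symb (r b) u)"
      "symb (r (a \<otimes>\<^bsub>A\<^esub> b)) = (\<lambda>u. symb (r a) u * symb (r b) u)"
      "symb (r (c \<odot>\<^bsub>A\<^esub> a)) = (\<lambda>u. c * symb (r a) u)"
      using ab sub by (simp_all add: calg_hom_add[OF r] calg_hom_mult[OF r] calg_hom_smult[OF r] mulop_ops)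
  qed
  show "fun_hom A (gen_subalg A H) (\<lambda>a. symb (r a))"
    unfolding fun_hom_def by (simp add: 2 calg_hom_one[OF r] mulop_ops)
qed

locale catenoid =
  fixes hbar :: real
begin

abbreviation "C \<equiv> C_alg hbar"
abbreviation "L \<equiv> L_alg hbar"
abbreviation "Z \<equiv> Z_alg hbar"
abbreviation "Zp \<equiv> Z_plus hbar"
abbreviation "emb \<equiv> L_emb hbar"
abbreviation "Fp \<equiv> F_plus hbar"

sublocale C: calgebra C by (rule calgebra_C)
sublocale L: calgebra L unfolding L_alg_def by (rule calgebra_loc_alg)

lemma C_rep:
  obtains r where "calg_hom C op_alg r" "r (C_gen hbar gU) = mulop (\<lambda>u. of_real u)"
    "r (C_gen hbar gR) = mulop (\<lambda>u. of_real (exp u))"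
    "r (C_gen hbar gRi) = mulop (\<lambda>u. of_real (exp (- u)))"
    "r (C_gen hbar gW) = shiftop hbar 1"
proof -
  obtain r where r: "calg_hom C op_alg r" "r (C_gen hbar gU) = mulop (\<lambda>u. of_real u)"
    "r (C_gen hbar gR) = mulop (\<lambda>u. of_real (exp u))"
    "r (C_gen hbar gRi) = inv\<^bsub>op_alg\<^esub> (mulop (\<lambda>u. of_real (exp u)))"
    "r (C_gen hbar gW) = shiftop hbar 1"
  proof (rule C_universal[of "op_alg :: oper calg" "mulop (\<lambda>u. of_real u)" "mulop (\<lambda>u. of_real (exp u))"
        "shiftop hbar 1" hbar])
    show "shiftop hbar 1 \<otimes>\<^bsub>op_alg\<^esub> mulop (\<lambda>u. of_real (exp u)) =
        of_real (exp hbar) \<odot>\<^bsub>op_alg\<^esub> (mulop (\<lambda>u. of_real (exp u)) \<otimes>\<^bsub>op_alg\<^esub> shiftop hbar 1)"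
      "shiftop hbar 1 \<otimes>\<^bsub>op_alg\<^esub> mulop (\<lambda>u. of_real u) =
        (mulop (\<lambda>u. of_real u) \<otimes>\<^bsub>op_alg\<^esub> shiftop hbar 1) \<oplus>\<^bsub>op_alg\<^esub> (of_real hbar \<odot>\<^bsub>op_alg\<^esub> shiftop hbar 1)"
      by (simp_all add: op_alg_def shiftop_def mulop_def exp_add algebra_simps)
  qed (simp_all add: Op.calgebra_axioms mulop_Units shiftop_Units mulop_ops mult.commute)
  show ?thesis
    by (rule that[OF r(1-3) _ r(5)]) (simp add: r(4) mulop_Units(2) exp_minus inverse_eq_divide)
qed

definition "Zgens = {C_gen hbar gU, C_gen hbar gR, C_gen hbar gRi}"

lemma Z_eq: "Z = gen_subalg C Zgens"
  by (simp add: Z_alg_def Zgens_def)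

lemma Zgens_subset: "Zgens \<subseteq> carrier C"
  by (simp add: Zgens_def)

lemma Z_closed: "p \<in> Z \<Longrightarrow> p \<in> carrier C"
  unfolding Z_eq using C.gen_subalg_subset[OF Zgens_subset] by (rule subsetD)

lemma phi_Z_unique:
  assumes "fun_hom C Z f" "f (C_gen hbar gU) = (\<lambda>u. of_real u)"
    "f (C_gen hbar gR) = (\<lambda>u. of_real (exp u))" "f (C_gen hbar gRi) = (\<lambda>u. of_real (exp (- u)))"
  shows "fun_hom C Z (phi_Z hbar)" "phi_Z hbar (C_gen hbar gU) = (\<lambda>u. of_real u)"
    "phi_Z hbar (C_gen hbar gR) = (\<lambda>u. of_real (exp u))"
    "phi_Z hbar (C_gen hbar gRi) = (\<lambda>u. of_real (exp (- u)))"
    "p \<in> Z \<Longrightarrow> phi_Z hbar p = f p"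
proof -
  have "fun_hom C Z (phi_Z hbar) \<and> phi_Z hbar (C_gen hbar gU) = (\<lambda>u. of_real u) \<and>
    phi_Z hbar (C_gen hbar gR) = (\<lambda>u. of_real (exp u)) \<and>
    phi_Z hbar (C_gen hbar gRi) = (\<lambda>u. of_real (exp (- u)))"
    unfolding phi_Z_def by (rule someI[of _ f]) (intro conjI assms)
  then show 1: "fun_hom C Z (phi_Z hbar)" "phi_Z hbar (C_gen hbar gU) = (\<lambda>u. of_real u)"
    "phi_Z hbar (C_gen hbar gR) = (\<lambda>u. of_real (exp u))"
    "phi_Z hbar (C_gen hbar gRi) = (\<lambda>u. of_real (exp (- u)))" by simp_all
  show "phi_Z hbar p = f p" if "p \<in> Z"
  proof (rule C.fun_hom_unique[OF Zgens_subset])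
    show "phi_Z hbar h = f h" if "h \<in> Zgens" for h
      using that assms 1 by (auto simp: Zgens_def)
  qed (use 1 assms that in \<open>simp_all add: Z_eq\<close>)
qed

lemma C_rep_phi_Z:
  obtains r where "calg_hom C op_alg r" "r (C_gen hbar gW) = shiftop hbar 1"
    "\<And>p. p \<in> Z \<Longrightarrow> r p = mulop (phi_Z hbar p)"
    "fun_hom C Z (phi_Z hbar)" "phi_Z hbar (C_gen hbar gU) = (\<lambda>u. of_real u)"
    "phi_Z hbar (C_gen hbar gR) = (\<lambda>u. of_real (exp u))"
    "phi_Z hbar (C_gen hbar gRi) = (\<lambda>u. of_real (exp (- u)))"
proof -
  obtain r where r: "calg_hom C op_alg r" "r (C_gen hbar gU) = mulop (\<lambda>u. of_real u)"
    "r (C_gen hbar gR) = mulop (\<lambda>u. of_real (exp u))"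
    "r (C_gen hbar gRi) = mulop (\<lambda>u. of_real (exp (- u)))"
    "r (C_gen hbar gW) = shiftop hbar 1"
    by (rule C_rep)
  have gen: "\<forall>h\<in>Zgens. r h = mulop (symb (r h))"
    using r by (auto simp: Zgens_def)
  note rep = rep_gen_subalg[OF C.calgebra_axioms Zgens_subset r(1) gen, folded Z_eq]
  note u = phi_Z_unique[OF rep(2), unfolded r(2-4) symb_mulop, OF refl refl refl]
  show ?thesis
  proof (rule that[OF r(1,5) _ u(1-4)])
    show "r p = mulop (phi_Z hbar p)" if "p \<in> Z" for p
      using rep(1)[OF that] u(5)[OF that] by simp
  qed
qed

lemma fun_hom_phi_Z: "fun_hom C Z (phi_Z hbar)"
  and phi_Z_U: "phi_Z hbar (C_gen hbar gU) = (\<lambda>u. of_real u)"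
  and phi_Z_R: "phi_Z hbar (C_gen hbar gR) = (\<lambda>u. of_real (exp u))"
  and phi_Z_Ri: "phi_Z hbar (C_gen hbar gRi) = (\<lambda>u. of_real (exp (- u)))"
  by (rule C_rep_phi_Z, assumption)+

lemma Z_ops:
  shows Z_one: "\<one>\<^bsub>C\<^esub> \<in> Z" and Z_scalar: "c \<odot>\<^bsub>C\<^esub> \<one>\<^bsub>C\<^esub> \<in> Z"
    and Z_add: "a \<in> Z \<Longrightarrow> b \<in> Z \<Longrightarrow> a \<oplus>\<^bsub>C\<^esub> b \<in> Z"
    and Z_mult: "a \<in> Z \<Longrightarrow> b \<in> Z \<Longrightarrow> a \<otimes>\<^bsub>C\<^esub> b \<in> Z"
    and Z_gen: "C_gen hbar gU \<in> Z" "C_gen hbar gR \<in> Z" "C_gen hbar gRi \<in> Z"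
  unfolding Z_eq
  by (simp_all add: C.gen_subalg_one C.gen_subalg_scalar C.gen_subalg_add C.gen_subalg_mult
      C.gen_subalg_incl Zgens_def)

lemma phi_Z_ops:
  shows phi_Z_one: "phi_Z hbar \<one>\<^bsub>C\<^esub> = (\<lambda>u. 1)"
    and phi_Z_add: "a \<in> Z \<Longrightarrow> b \<in> Z \<Longrightarrow> phi_Z hbar (a \<oplus>\<^bsub>C\<^esub> b) = (\<lambda>u. phi_Z hbar a u + phi_Z hbar b u)"
    and phi_Z_mult: "a \<in> Z \<Longrightarrow> b \<in> Z \<Longrightarrow> phi_Z hbar (a \<otimes>\<^bsub>C\<^esub> b) = (\<lambda>u. phi_Z hbar a u * phi_Z hbar b u)"
    and phi_Z_smult: "a \<in> Z \<Longrightarrow> phi_Z hbar (c \<odot>\<^bsub>C\<^esub> a) = (\<lambda>u. c * phi_Z hbar a u)"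
  using fun_hom_phi_Z unfolding fun_hom_def by simp_all

lemma R_Ri: "C_gen hbar gR \<otimes>\<^bsub>C\<^esub> C_gen hbar gRi = \<one>\<^bsub>C\<^esub>"
  and Ri_R: "C_gen hbar gRi \<otimes>\<^bsub>C\<^esub> C_gen hbar gR = \<one>\<^bsub>C\<^esub>"
  and W_Wi: "C_gen hbar gW \<otimes>\<^bsub>C\<^esub> C_gen hbar gWi = \<one>\<^bsub>C\<^esub>"
  and Wi_W: "C_gen hbar gWi \<otimes>\<^bsub>C\<^esub> C_gen hbar gW = \<one>\<^bsub>C\<^esub>"
  using C_rel[OF C_rels.intros(3), of hbar] C_rel[OF C_rels.intros(4), of hbar]
    C_rel[OF C_rels.intros(1), of hbar] C_rel[OF C_rels.intros(2), of hbar]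
  by simp_all

lemma R_U: "C_gen hbar gR \<otimes>\<^bsub>C\<^esub> C_gen hbar gU = C_gen hbar gU \<otimes>\<^bsub>C\<^esub> C_gen hbar gR"
  and Ri_U: "C_gen hbar gRi \<otimes>\<^bsub>C\<^esub> C_gen hbar gU = C_gen hbar gU \<otimes>\<^bsub>C\<^esub> C_gen hbar gRi"
  and W_R: "C_gen hbar gW \<otimes>\<^bsub>C\<^esub> C_gen hbar gR =
    of_real (exp hbar) \<odot>\<^bsub>C\<^esub> (C_gen hbar gR \<otimes>\<^bsub>C\<^esub> C_gen hbar gW)"
  and W_U: "C_gen hbar gW \<otimes>\<^bsub>C\<^esub> C_gen hbar gU =
    (C_gen hbar gU \<otimes>\<^bsub>C\<^esub> C_gen hbar gW) \<oplus>\<^bsub>C\<^esub> (of_real hbar \<odot>\<^bsub>C\<^esub> C_gen hbar gW)"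
  using C_rel[OF C_rels.intros(5), of hbar] C_rel[OF C_rels.intros(6), of hbar]
    C_rel[OF C_rels.intros(7), of hbar] C_rel[OF C_rels.intros(11), of hbar]
  by (simp_all add: C.smult_one_mult)

lemma Z_commute: "a \<in> Z \<Longrightarrow> b \<in> Z \<Longrightarrow> a \<otimes>\<^bsub>C\<^esub> b = b \<otimes>\<^bsub>C\<^esub> a"
  unfolding Z_eq
  by (rule C.gen_subalg_commute[OF Zgens_subset]) (auto simp: Zgens_def R_U Ri_U R_Ri Ri_R)

lemma Zp_iff: "p \<in> Zp \<longleftrightarrow> p \<in> Z \<and> (\<forall>u. phi_Z hbar p u \<noteq> 0)"
  by (simp add: Z_plus_def)

lemma Zp_subset: "Zp \<subseteq> carrier C"
  using Z_closed by (auto simp: Zp_iff)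

lemma Zp_one: "\<one>\<^bsub>C\<^esub> \<in> Zp" and Zp_mult: "p \<in> Zp \<Longrightarrow> q \<in> Zp \<Longrightarrow> p \<otimes>\<^bsub>C\<^esub> q \<in> Zp"
  by (simp_all add: Zp_iff Z_ops phi_Z_ops)

lemma hom_emb: "calg_hom C L emb"
  unfolding L_alg_def L_emb_def by (rule calg_hom_loc_emb[OF C.calgebra_axioms])

lemma emb_Units: "p \<in> Zp \<Longrightarrow> emb p \<in> Units L"
  unfolding L_alg_def L_emb_def by (rule loc_emb_Units[OF Zp_subset])

lemma emb_closed [simp]: "a \<in> carrier C \<Longrightarrow> emb a \<in> carrier L"
  by (rule calg_hom_closed[OF hom_emb])

lemma L_universal:
  assumes "calgebra B" "calg_hom C B f" "\<And>p. p \<in> Zp \<Longrightarrow> f p \<in> Units B"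
  obtains F where "calg_hom L B F" "\<And>a. a \<in> carrier C \<Longrightarrow> F (emb a) = f a"
  unfolding L_alg_def L_emb_def
  by (rule loc_universal[OF C.calgebra_axioms assms(1,2) Zp_subset assms(3)])
    (assumption, rule that[unfolded L_alg_def L_emb_def])

definition "Fgens = emb ` Z \<union> {inv\<^bsub>L\<^esub> (emb p) | p. p \<in> Zp}"

lemma Fp_eq: "Fp = gen_subalg L Fgens"
  by (simp add: F_plus_def Fgens_def)

lemma Fgens_subset: "Fgens \<subseteq> carrier L"
  using Z_closed emb_Units by (auto simp: Fgens_def)

lemma Fp_closed: "p \<in> Fp \<Longrightarrow> p \<in> carrier L"
  unfolding Fp_eq using L.gen_subalg_subset[OF Fgens_subset] by (rule subsetD)

lemma
  shows Fp_one: "\<one>\<^bsub>L\<^esub> \<in> Fp" and Fp_zero: "\<zero>\<^bsub>L\<^esub> \<in> Fp"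
    and Fp_add: "a \<in> Fp \<Longrightarrow> b \<in> Fp \<Longrightarrow> a \<oplus>\<^bsub>L\<^esub> b \<in> Fp"
    and Fp_mult: "a \<in> Fp \<Longrightarrow> b \<in> Fp \<Longrightarrow> a \<otimes>\<^bsub>L\<^esub> b \<in> Fp"
    and Fp_smult: "a \<in> Fp \<Longrightarrow> c \<odot>\<^bsub>L\<^esub> a \<in> Fp"
    and Fp_minus: "a \<in> Fp \<Longrightarrow> \<ominus>\<^bsub>L\<^esub> a \<in> Fp"
    and Fp_emb: "p \<in> Z \<Longrightarrow> emb p \<in> Fp"
    and Fp_inv_emb: "q \<in> Zp \<Longrightarrow> inv\<^bsub>L\<^esub> (emb q) \<in> Fp"
  unfolding Fp_eq
  by (simp_all add: L.gen_subalg_one L.gen_subalg_zero L.gen_subalg_add L.gen_subalg_mult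
      L.gen_subalg_smult L.gen_subalg_minus Fgens_subset)
    (rule L.gen_subalg_incl, auto simp: Fgens_def)+

lemma L_rep:
  obtains r where "calg_hom L op_alg r" "r (L_W hbar) = shiftop hbar 1"
    "\<And>a. a \<in> Fp \<Longrightarrow> r a = mulop (phi hbar a)"
    "fun_hom L Fp (phi hbar)" "\<And>p. p \<in> Z \<Longrightarrow> phi hbar (emb p) = phi_Z hbar p"
proof -
  obtain r0 where r0: "calg_hom C op_alg r0" "r0 (C_gen hbar gW) = shiftop hbar 1"
    "\<And>p. p \<in> Z \<Longrightarrow> r0 p = mulop (phi_Z hbar p)"
    by (rule C_rep_phi_Z) (rule that)
  have units: "r0 p \<in> Units op_alg" if "p \<in> Zp" for p
    using that r0(3)[of p] mulop_Units(1)[of "phi_Z hbar p"] by (simp add: Zp_iff)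
  obtain r where r: "calg_hom L op_alg r" "\<And>a. a \<in> carrier C \<Longrightarrow> r (emb a) = r0 a"
    by (rule L_universal[OF Op.calgebra_axioms r0(1) units]) (assumption, rule that)
  have rZ: "r (emb p) = mulop (phi_Z hbar p)" if "p \<in> Z" for p
    using that r(2) r0(3) Z_closed by simp
  have rZp: "r (inv\<^bsub>L\<^esub> (emb p)) = mulop (\<lambda>u. 1 / phi_Z hbar p u)" if "p \<in> Zp" for p
  proof -
    have "r (inv\<^bsub>L\<^esub> (emb p)) = inv\<^bsub>op_alg\<^esub> (r (emb p))"
      by (rule calg_hom_Units(2)[OF L.calgebra_axioms Op.calgebra_axioms r(1) emb_Units[OF that]])
    then show ?thesis using that rZ[of p] mulop_Units(2)[of "phi_Z hbar p"] by (simp add: Zp_iff)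
  qed
  have gen: "\<forall>h\<in>Fgens. r h = mulop (symb (r h))"
    using rZ rZp by (auto simp: Fgens_def)
  note rep = rep_gen_subalg[OF L.calgebra_axioms Fgens_subset r(1) gen, folded Fp_eq]
  have "fun_hom L Fp (phi hbar) \<and> (\<forall>p\<in>Z. phi hbar (emb p) = phi_Z hbar p) \<and>
     (\<forall>p\<in>Zp. phi hbar (inv\<^bsub>L\<^esub> (emb p)) = (\<lambda>u. 1 / phi_Z hbar p u))"
    unfolding phi_def
    by (rule someI[of _ "\<lambda>a. symb (r a)"]) (simp add: rep(2) rZ rZp)
  then have phi: "fun_hom L Fp (phi hbar)" "\<And>p. p \<in> Z \<Longrightarrow> phi hbar (emb p) = phi_Z hbar p"
    "\<And>p. p \<in> Zp \<Longrightarrow> phi hbar (inv\<^bsub>L\<^esub> (emb p)) = (\<lambda>u. 1 / phi_Z hbar p u)" by simp_all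
  have eq: "phi hbar a = symb (r a)" if "a \<in> Fp" for a
  proof (rule L.fun_hom_unique[OF Fgens_subset])
    show "phi hbar h = symb (r h)" if "h \<in> Fgens" for h
      using that by (auto simp: Fgens_def phi rZ rZp)
  qed (use phi(1) rep(2) that in \<open>simp_all add: Fp_eq\<close>)
  show ?thesis
  proof (rule that[OF r(1) _ _ phi(1,2)])
    show "r (L_W hbar) = shiftop hbar 1" by (simp add: L_W_def r(2) r0(2))
    show "r a = mulop (phi hbar a)" if "a \<in> Fp" for a
      using rep(1)[OF that] eq[OF that] by simp
  qed
qed

lemma fun_hom_phi: "fun_hom L Fp (phi hbar)"
  and phi_emb: "p \<in> Z \<Longrightarrow> phi hbar (emb p) = phi_Z hbar p"
  by (rule L_rep, simp)+

lemma
  shows phi_one: "phi hbar \<one>\<^bsub>L\<^esub> = (\<lambda>u. 1)"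
    and phi_add: "a \<in> Fp \<Longrightarrow> b \<in> Fp \<Longrightarrow> phi hbar (a \<oplus>\<^bsub>L\<^esub> b) = (\<lambda>u. phi hbar a u + phi hbar b u)"
    and phi_mult: "a \<in> Fp \<Longrightarrow> b \<in> Fp \<Longrightarrow> phi hbar (a \<otimes>\<^bsub>L\<^esub> b) = (\<lambda>u. phi hbar a u * phi hbar b u)"
    and phi_smult: "a \<in> Fp \<Longrightarrow> phi hbar (c \<odot>\<^bsub>L\<^esub> a) = (\<lambda>u. c * phi hbar a u)"
  using fun_hom_phi unfolding fun_hom_def by simp_all

lemma phi_zero: "phi hbar \<zero>\<^bsub>L\<^esub> = (\<lambda>u. 0)"
  using phi_smult[OF Fp_one, of 0] by simp

lemma phi_Units_nonzero:
  assumes S: "S \<in> Fp" "S \<in> Units L"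
  shows "phi hbar S u \<noteq> 0"
proof -
  obtain r where r: "calg_hom L op_alg r" "\<And>a. a \<in> Fp \<Longrightarrow> r a = mulop (phi hbar a)"
    by (rule L_rep) (rule that)
  have "r S \<otimes>\<^bsub>op_alg\<^esub> r (inv\<^bsub>L\<^esub> S) = \<one>\<^bsub>op_alg\<^esub>"
    using calg_hom_mult[OF r(1), of S "inv\<^bsub>L\<^esub> S"] S Fp_closed[OF S(1)] by (simp add: calg_hom_one[OF r(1)])
  then have "(r S \<otimes>\<^bsub>op_alg\<^esub> r (inv\<^bsub>L\<^esub> S)) (\<lambda>x. 1) (u, 0) = 1" by (simp add: op_alg_def)
  then have "phi hbar S u * r (inv\<^bsub>L\<^esub> S) (\<lambda>x. 1) (u, 0) = 1"
    by (simp add: r(2)[OF S(1)] op_alg_def mulop_def)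
  then show ?thesis by auto
qed

lemma clear_denominator:
  assumes "a \<in> Fp"
  shows "\<exists>p\<in>Z. \<exists>q\<in>Zp. a \<otimes>\<^bsub>L\<^esub> emb q = emb p"
  using assms[unfolded Fp_eq] Fgens_subset
proof (induction rule: L.gen_subalg_induct)
  case (gen h)
  show ?case
  proof (cases "h \<in> emb ` Z")
    case True
    then obtain p where "p \<in> Z" "h = emb p" by auto
    then show ?thesis
      by (intro bexI[of _ p] bexI[of _ "\<one>\<^bsub>C\<^esub>"])
        (simp_all add: Zp_one calg_hom_one[OF hom_emb] Z_closed)
  next
    case False
    then obtain q where "q \<in> Zp" "h = inv\<^bsub>L\<^esub> (emb q)" using gen by (auto simp: Fgens_def)
    then show ?thesis
      by (intro bexI[of _ "\<one>\<^bsub>C\<^esub>"] bexI[of _ q])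
        (simp_all add: Z_one emb_Units calg_hom_one[OF hom_emb])
  qed
next
  case (scal c)
  show ?case
    by (intro bexI[of _ "c \<odot>\<^bsub>C\<^esub> \<one>\<^bsub>C\<^esub>"] bexI[of _ "\<one>\<^bsub>C\<^esub>"])
      (simp_all add: Z_scalar Zp_one calg_hom_one[OF hom_emb] calg_hom_smult[OF hom_emb])
next
  case (add a b)
  obtain p q p' q' where pq: "p \<in> Z" "q \<in> Zp" "a \<otimes>\<^bsub>L\<^esub> emb q = emb p"
    "p' \<in> Z" "q' \<in> Zp" "b \<otimes>\<^bsub>L\<^esub> emb q' = emb p'" using add.IH by blast
  have Zq: "q \<in> Z" "q' \<in> Z" using pq by (auto simp: Zp_iff)
  have cl: "a \<in> carrier L" "b \<in> carrier L"
    using add.hyps Fp_closed unfolding Fp_eq by auto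
  note cc = Z_closed[OF pq(1)] Z_closed[OF pq(4)] Z_closed[OF Zq(1)] Z_closed[OF Zq(2)]
  note ec = cc[THEN emb_closed]
  have c: "emb q \<otimes>\<^bsub>L\<^esub> emb q' = emb q' \<otimes>\<^bsub>L\<^esub> emb q"
    using Z_commute[OF Zq] by (simp add: cc flip: calg_hom_mult[OF hom_emb])
  have "(a \<oplus>\<^bsub>L\<^esub> b) \<otimes>\<^bsub>L\<^esub> emb (q \<otimes>\<^bsub>C\<^esub> q') =
      (a \<otimes>\<^bsub>L\<^esub> emb q) \<otimes>\<^bsub>L\<^esub> emb q' \<oplus>\<^bsub>L\<^esub> b \<otimes>\<^bsub>L\<^esub> (emb q \<otimes>\<^bsub>L\<^esub> emb q')"
    by (simp add: calg_hom_mult[OF hom_emb] cc ec cl L.l_distr L.m_assoc)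
  also have "b \<otimes>\<^bsub>L\<^esub> (emb q \<otimes>\<^bsub>L\<^esub> emb q') = (b \<otimes>\<^bsub>L\<^esub> emb q') \<otimes>\<^bsub>L\<^esub> emb q"
    unfolding c by (simp add: cl ec L.m_assoc)
  also have "(a \<otimes>\<^bsub>L\<^esub> emb q) \<otimes>\<^bsub>L\<^esub> emb q' \<oplus>\<^bsub>L\<^esub> (b \<otimes>\<^bsub>L\<^esub> emb q') \<otimes>\<^bsub>L\<^esub> emb q =
      emb ((p \<otimes>\<^bsub>C\<^esub> q') \<oplus>\<^bsub>C\<^esub> (p' \<otimes>\<^bsub>C\<^esub> q))"
    by (simp add: pq cc calg_hom_mult[OF hom_emb] calg_hom_add[OF hom_emb])
  finally show ?case
    by (intro bexI[of _ "(p \<otimes>\<^bsub>C\<^esub> q') \<oplus>\<^bsub>C\<^esub> (p' \<otimes>\<^bsub>C\<^esub> q)"] bexI[of _ "q \<otimes>\<^bsub>C\<^esub> q'"] Z_add Z_mult Zp_mult pq Zq)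
next
  case (mult a b)
  obtain p q p' q' where pq: "p \<in> Z" "q \<in> Zp" "a \<otimes>\<^bsub>L\<^esub> emb q = emb p"
    "p' \<in> Z" "q' \<in> Zp" "b \<otimes>\<^bsub>L\<^esub> emb q' = emb p'" using mult.IH by blast
  have Zq: "q \<in> Z" "q' \<in> Z" using pq by (auto simp: Zp_iff)
  have cl: "a \<in> carrier L" "b \<in> carrier L"
    using mult.hyps Fp_closed unfolding Fp_eq by auto
  note cc = Z_closed[OF pq(1)] Z_closed[OF pq(4)] Z_closed[OF Zq(1)] Z_closed[OF Zq(2)]
  note ec = cc[THEN emb_closed]
  have c: "emb p' \<otimes>\<^bsub>L\<^esub> emb q = emb q \<otimes>\<^bsub>L\<^esub> emb p'"
    using Z_commute[OF pq(4) Zq(1)] by (simp add: cc flip: calg_hom_mult[OF hom_emb])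
  have "(a \<otimes>\<^bsub>L\<^esub> b) \<otimes>\<^bsub>L\<^esub> emb (q' \<otimes>\<^bsub>C\<^esub> q) = a \<otimes>\<^bsub>L\<^esub> ((b \<otimes>\<^bsub>L\<^esub> emb q') \<otimes>\<^bsub>L\<^esub> emb q)"
    by (simp add: calg_hom_mult[OF hom_emb] cc ec cl L.m_assoc)
  also have "\<dots> = a \<otimes>\<^bsub>L\<^esub> (emb q \<otimes>\<^bsub>L\<^esub> emb p')" by (simp only: pq c)
  also have "\<dots> = (a \<otimes>\<^bsub>L\<^esub> emb q) \<otimes>\<^bsub>L\<^esub> emb p'" by (simp add: cl ec L.m_assoc)
  also have "\<dots> = emb (p \<otimes>\<^bsub>C\<^esub> p')" by (simp add: pq cc calg_hom_mult[OF hom_emb])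
  finally show ?case
    by (intro bexI[of _ "p \<otimes>\<^bsub>C\<^esub> p'"] bexI[of _ "q' \<otimes>\<^bsub>C\<^esub> q"] Z_mult Zp_mult pq)
qed

lemma inv_Fp:
  assumes S: "S \<in> Fp" "S \<in> Units L"
  shows "inv\<^bsub>L\<^esub> S \<in> Fp"
proof -
  obtain p q where pq: "p \<in> Z" "q \<in> Zp" "S \<otimes>\<^bsub>L\<^esub> emb q = emb p"
    using clear_denominator[OF S(1)] by blast
  have q: "q \<in> Z" using pq by (simp add: Zp_iff)
  have "phi_Z hbar p u \<noteq> 0" for u
  proof -
    have "phi_Z hbar p u = phi hbar S u * phi_Z hbar q u"
      using phi_mult[OF S(1) Fp_emb[OF q]] pq(3) by (simp add: phi_emb pq q)
    then show ?thesis using phi_Units_nonzero[OF S] pq(2) by (simp add: Zp_iff)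
  qed
  then have p: "p \<in> Zp" using pq(1) by (simp add: Zp_iff)
  have cl: "S \<in> carrier L" "emb q \<in> carrier L" "inv\<^bsub>L\<^esub> (emb p) \<in> carrier L"
    using Fp_closed S q p Fp_emb Fp_inv_emb by auto
  have "S \<otimes>\<^bsub>L\<^esub> (emb q \<otimes>\<^bsub>L\<^esub> inv\<^bsub>L\<^esub> (emb p)) = \<one>\<^bsub>L\<^esub>"
    using cl by (simp add: pq(3) emb_Units[OF p] flip: L.m_assoc)
  also have "\<one>\<^bsub>L\<^esub> = S \<otimes>\<^bsub>L\<^esub> inv\<^bsub>L\<^esub> S" using S by simp
  finally have "emb q \<otimes>\<^bsub>L\<^esub> inv\<^bsub>L\<^esub> (emb p) = inv\<^bsub>L\<^esub> S"
    by (rule L.unit_l_cancel[OF S(2), rotated 2]) (use cl S in simp_all)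
  then show ?thesis using Fp_mult[OF Fp_emb[OF q] Fp_inv_emb[OF p]] by simp
qed

lemma phi_inv:
  assumes S: "S \<in> Fp" "S \<in> Units L"
  shows "phi hbar (inv\<^bsub>L\<^esub> S) = (\<lambda>u. inverse (phi hbar S u))"
proof
  fix u
  have "phi hbar S u * phi hbar (inv\<^bsub>L\<^esub> S) u = phi hbar (S \<otimes>\<^bsub>L\<^esub> inv\<^bsub>L\<^esub> S) u"
    by (simp add: phi_mult[OF S(1) inv_Fp[OF S]])
  also have "\<dots> = 1" using S by (simp add: phi_one)
  finally show "phi hbar (inv\<^bsub>L\<^esub> S) u = inverse (phi hbar S u)"
    by (simp add: inverse_unique)
qed

lemma emb_gen_Units:
  shows "L_R hbar \<in> Units L" "inv\<^bsub>L\<^esub> (L_R hbar) = L_Ri hbar"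
    "L_W hbar \<in> Units L" "inv\<^bsub>L\<^esub> (L_W hbar) = L_Wi hbar"
proof -
  have 1: "L_R hbar \<otimes>\<^bsub>L\<^esub> L_Ri hbar = \<one>\<^bsub>L\<^esub>" "L_Ri hbar \<otimes>\<^bsub>L\<^esub> L_R hbar = \<one>\<^bsub>L\<^esub>"
    "L_W hbar \<otimes>\<^bsub>L\<^esub> L_Wi hbar = \<one>\<^bsub>L\<^esub>" "L_Wi hbar \<otimes>\<^bsub>L\<^esub> L_W hbar = \<one>\<^bsub>L\<^esub>"
    unfolding L_R_def L_Ri_def L_W_def L_Wi_def
    by (simp_all add: R_Ri Ri_R W_Wi Wi_W calg_hom_one[OF hom_emb] flip: calg_hom_mult[OF hom_emb])
  have cl: "L_R hbar \<in> carrier L" "L_Ri hbar \<in> carrier L" "L_W hbar \<in> carrier L" "L_Wi hbar \<in> carrier L"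
    unfolding L_R_def L_Ri_def L_W_def L_Wi_def by simp_all
  show "L_R hbar \<in> Units L" unfolding Units_def
    by (intro CollectI conjI bexI[of _ "L_Ri hbar"] 1 cl)
  show "L_W hbar \<in> Units L" unfolding Units_def
    by (intro CollectI conjI bexI[of _ "L_Wi hbar"] 1 cl)
  show "inv\<^bsub>L\<^esub> (L_R hbar) = L_Ri hbar" by (rule L.inv_char[OF cl(1,2) 1(1,2)])
  show "inv\<^bsub>L\<^esub> (L_W hbar) = L_Wi hbar" by (rule L.inv_char[OF cl(3,4) 1(3,4)])
qed

lemma W_expansion_exists:
  assumes "K \<in> Fp"
  shows "W_expansion hbar K (\<lambda>k. if k = 0 then K else \<zero>\<^bsub>L\<^esub>)"
proof (cases "K = \<zero>\<^bsub>L\<^esub>")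
  case True
  then show ?thesis using Fp_zero by (auto simp: W_expansion_def)
next
  case False
  then have "{k. (if k = (0::int) then K else \<zero>\<^bsub>L\<^esub>) \<noteq> \<zero>\<^bsub>L\<^esub>} = {0}" by auto
  then show ?thesis using assms Fp_zero Fp_closed[OF assms] by (simp add: W_expansion_def)
qed

lemma W_pow_closed: "L_W hbar [^]\<^bsub>L\<^esub> (k::int) \<in> carrier L"
proof -
  have "L_W hbar [^]\<^bsub>L\<^esub> n \<in> Units L" for n :: nat
    by (rule L.Units_pow_closed[OF emb_gen_Units(3)])
  then show ?thesis
    unfolding int_pow_def2 by (simp only: L.Units_inv_closed L.Units_closed split: if_split) simp
qed

lemma phi_W_coeff_0:
  assumes K: "K \<in> Fp"
  shows "phi hbar (W_coeff hbar K 0) = phi hbar K"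
proof
  fix u
  define c where "c = W_coeff hbar K"
  have c: "W_expansion hbar K c"
    unfolding c_def W_coeff_def by (rule someI[where P = "W_expansion hbar K", OF W_expansion_exists[OF K]])
  let ?A = "{k. c k \<noteq> \<zero>\<^bsub>L\<^esub>}"
  have cF: "c k \<in> Fp" and fin: "finite ?A" for k using c by (auto simp: W_expansion_def)
  obtain r where r: "calg_hom L op_alg r" "r (L_W hbar) = shiftop hbar 1"
    "\<And>a. a \<in> Fp \<Longrightarrow> r a = mulop (phi hbar a)"
    by (rule L_rep) (rule that)
  have pow_nat: "r (L_W hbar [^]\<^bsub>L\<^esub> n) = shiftop hbar (int n)" for n :: nat
  proof (induction n)
    case 0
    then show ?case by (simp add: calg_hom_one[OF r(1)] shiftop_0)
  next
    case (Suc n)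
    then show ?case using emb_gen_Units(3)
      by (simp add: calg_hom_mult[OF r(1)] L.Units_closed r(2) shiftop_mult add.commute)
  qed
  have pow: "r (L_W hbar [^]\<^bsub>L\<^esub> k) = shiftop hbar k" for k :: int
  proof (cases "k < 0")
    case True
    have "L_W hbar [^]\<^bsub>L\<^esub> nat (- k) \<in> Units L" using emb_gen_Units(3) by (rule L.Units_pow_closed)
    then have "r (inv\<^bsub>L\<^esub> (L_W hbar [^]\<^bsub>L\<^esub> nat (- k))) = shiftop hbar (- int (nat (- k)))"
      by (simp only: calg_hom_Units(2)[OF L.calgebra_axioms Op.calgebra_axioms r(1)] pow_nat shiftop_Units)
    then show ?thesis using True unfolding int_pow_def2 by (simp only: if_True) simp
  next
    case False
    have "r (L_W hbar [^]\<^bsub>L\<^esub> nat k) = shiftop hbar (int (nat k))" by (rule pow_nat)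
    then show ?thesis using False unfolding int_pow_def2 by (simp only: if_False) simp
  qed
  define F :: "real \<times> int \<Rightarrow> complex" where "F x = (if snd x = 0 then 1 else 0)" for x
  have sum: "r (finsum L (\<lambda>k. c k \<otimes>\<^bsub>L\<^esub> L_W hbar [^]\<^bsub>L\<^esub> k) B) F (u, 0) =
      (\<Sum>k\<in>B. if k = 0 then phi hbar (c k) u else 0)" if "finite B" for B
    using that
  proof (induction B)
    case empty
    then show ?case
      using calg_hom_zero[OF L.calgebra_axioms Op.calgebra_axioms r(1)] by (simp add: op_alg_def)
  next
    case (insert k B)
    have cl: "c k \<otimes>\<^bsub>L\<^esub> L_W hbar [^]\<^bsub>L\<^esub> k \<in> carrier L" for k
      using Fp_closed[OF cF] W_pow_closed by simp
    have trm: "r (c k \<otimes>\<^bsub>L\<^esub> L_W hbar [^]\<^bsub>L\<^esub> k) F (u, 0) = (if k = 0 then phi hbar (c k) u else 0)"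
      using Fp_closed[OF cF] W_pow_closed
      by (simp add: calg_hom_mult[OF r(1)] r(3)[OF cF] pow)
        (simp add: op_alg_def mulop_def shiftop_def F_def)
    have ins: "finsum L (\<lambda>k. c k \<otimes>\<^bsub>L\<^esub> L_W hbar [^]\<^bsub>L\<^esub> k) (insert k B) =
        (c k \<otimes>\<^bsub>L\<^esub> L_W hbar [^]\<^bsub>L\<^esub> k) \<oplus>\<^bsub>L\<^esub> finsum L (\<lambda>k. c k \<otimes>\<^bsub>L\<^esub> L_W hbar [^]\<^bsub>L\<^esub> k) B"
      by (rule L.finsum_insert) (use insert cl in auto)
    have fc: "finsum L (\<lambda>k. c k \<otimes>\<^bsub>L\<^esub> L_W hbar [^]\<^bsub>L\<^esub> k) B \<in> carrier L"
      by (rule L.finsum_closed) (use cl in auto)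
    have "r (finsum L (\<lambda>k. c k \<otimes>\<^bsub>L\<^esub> L_W hbar [^]\<^bsub>L\<^esub> k) (insert k B)) F (u, 0) =
        r (c k \<otimes>\<^bsub>L\<^esub> L_W hbar [^]\<^bsub>L\<^esub> k) F (u, 0) +
        r (finsum L (\<lambda>k. c k \<otimes>\<^bsub>L\<^esub> L_W hbar [^]\<^bsub>L\<^esub> k) B) F (u, 0)"
      by (simp only: ins calg_hom_add[OF r(1) cl fc]) (simp add: op_alg_def)
    then show ?case by (simp only: trm insert.IH sum.insert[OF insert.hyps])
  qed
  have "phi hbar K u = r K F (u, 0)" by (simp add: r(3)[OF K] mulop_def F_def)
  also have "\<dots> = (\<Sum>k\<in>?A. if k = 0 then phi hbar (c k) u else 0)"
    using c sum[OF fin] by (simp add: W_expansion_def)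
  also have "\<dots> = phi hbar (c 0) u"
    using fin by (auto simp: phi_zero)
  finally show "phi hbar (W_coeff hbar K 0) u = phi hbar K u" by (simp add: c_def)
qed

end

section \<open>Existence of the involution and of the derivations\<close>

lemma calg_hom_cop_swap:
  assumes "calg_hom A (cop_alg A) f"
  shows "calg_hom (cop_alg A) A f"
proof -
  have sm: "f (cnj c \<odot>\<^bsub>A\<^esub> a) = c \<odot>\<^bsub>A\<^esub> f a" if "a \<in> carrier A" for c a
    using assms that by (simp add: calg_hom_def cop_alg_def)
  show ?thesis using assms by (simp add: calg_hom_def cop_alg_def sm)
qed

lemma inv_cop_alg [simp]: "inv\<^bsub>cop_alg A\<^esub> a = inv\<^bsub>A\<^esub> a"
  by (simp add: m_inv_def cop_alg_def conj_commute)

context calgebra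
begin

lemma involution_one:
  assumes "involution A st"
  shows "st \<one> = \<one>"
proof -
  note st = assms[unfolded involution_def]
  have 1: "st \<one> \<in> carrier A" "st (st \<one>) = \<one>" using st by simp_all
  have "st (a \<otimes> b) = st b \<otimes> st a" if "a \<in> carrier A" "b \<in> carrier A" for a b
    using st that by simp
  from this[OF 1(1) one_closed] show ?thesis using 1 by simp
qed

lemma derivationD:
  assumes "derivation A D"
  shows derivation_closed: "a \<in> carrier A \<Longrightarrow> D a \<in> carrier A"
    and derivation_add: "a \<in> carrier A \<Longrightarrow> b \<in> carrier A \<Longrightarrow> D (a \<oplus> b) = D a \<oplus> D b"
    and derivation_mult: "a \<in> carrier A \<Longrightarrow> b \<in> carrier A \<Longrightarrow> D (a \<otimes> b) = (D a \<otimes> b) \<oplus> (a \<otimes> D b)"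
    and derivation_smult: "a \<in> carrier A \<Longrightarrow> D (c \<odot> a) = c \<odot> D a"
  using assms unfolding derivation_def by simp_all

lemma derivation_one:
  assumes "derivation A D"
  shows "D \<one> = \<zero>"
proof -
  have cl: "D \<one> \<in> carrier A" by (rule derivation_closed[OF assms one_closed])
  have "D (\<one> \<otimes> \<one>) = (D \<one> \<otimes> \<one>) \<oplus> (\<one> \<otimes> D \<one>)"
    by (rule derivation_mult[OF assms one_closed one_closed])
  then have "D \<one> = D \<one> \<oplus> D \<one>" using cl by simp
  then show ?thesis using cl add.l_cancel_one' by simp
qed

lemma derivation_inv:
  assumes D: "derivation A D" and a: "a \<in> Units A"
  shows "D (inv a) = \<ominus> (inv a \<otimes> D a \<otimes> inv a)"
proof -
  have cl: "a \<in> carrier A" "inv a \<in> carrier A" using a by (simp_all add: Units_closed)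
  note Dcl = derivation_closed[OF D cl(1)] derivation_closed[OF D cl(2)]
  have "D (inv a \<otimes> a) = (D (inv a) \<otimes> a) \<oplus> (inv a \<otimes> D a)"
    by (rule derivation_mult[OF D cl(2,1)])
  then have "(D (inv a) \<otimes> a) \<oplus> (inv a \<otimes> D a) = \<zero>"
    using a by (simp add: derivation_one[OF D])
  then have "D (inv a) \<otimes> a = \<ominus> (inv a \<otimes> D a)"
    using cl Dcl by (simp add: minus_equality)
  then have "(D (inv a) \<otimes> a) \<otimes> inv a = \<ominus> (inv a \<otimes> D a) \<otimes> inv a" by simp
  then show ?thesis using a cl Dcl by (simp add: m_assoc l_minus)
qed

lemma calg_hom_dual_fst: "calg_hom (dual_alg A) A fst"
  by (auto simp: calg_hom_def dual_alg_def)

lemma derivation_snd: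
  assumes d: "calg_hom A (dual_alg A) d" and fst: "\<And>a. a \<in> carrier A \<Longrightarrow> fst (d a) = a"
  shows "derivation A (\<lambda>a. snd (d a))"
proof -
  have "snd (d a) \<in> carrier A" if "a \<in> carrier A" for a
    using calg_hom_closed[OF d that] by (auto simp: dual_alg_def)
  moreover have "snd (d (a \<oplus> b)) = snd (d a) \<oplus> snd (d b)"
    "snd (d (a \<otimes> b)) = snd (d a) \<otimes> b \<oplus> a \<otimes> snd (d b)"
    if ab: "a \<in> carrier A" "b \<in> carrier A" for a b
    using calg_hom_add[OF d ab] calg_hom_mult[OF d ab] fst[OF ab(1)] fst[OF ab(2)]
    by (simp_all add: dual_alg_def)
  moreover have "snd (d (c \<odot> a)) = c \<odot> snd (d a)" if "a \<in> carrier A" for a c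
    using calg_hom_smult[OF d that] by (simp add: dual_alg_def)
  ultimately show ?thesis unfolding derivation_def by simp
qed

lemma calg_hom_id: "calg_hom A A (\<lambda>a. a)"
  by (simp add: calg_hom_def)

end

context catenoid
begin

lemma L_gen_closed [simp]:
  "L_U hbar \<in> carrier L" "L_R hbar \<in> carrier L" "L_Ri hbar \<in> carrier L"
  "L_W hbar \<in> carrier L" "L_Wi hbar \<in> carrier L"
  by (simp_all add: L_U_def L_R_def L_Ri_def L_W_def L_Wi_def)

lemma L_induct [consumes 1, case_names U R W scal add mult inv]:
  assumes x: "x \<in> carrier L" and U: "P (L_U hbar)" and R: "P (L_R hbar)" and W: "P (L_W hbar)"
    and scal: "\<And>c. P (c \<odot>\<^bsub>L\<^esub> \<one>\<^bsub>L\<^esub>)"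
    and add: "\<And>a b. a \<in> carrier L \<Longrightarrow> b \<in> carrier L \<Longrightarrow> P a \<Longrightarrow> P b \<Longrightarrow> P (a \<oplus>\<^bsub>L\<^esub> b)"
    and mult: "\<And>a b. a \<in> carrier L \<Longrightarrow> b \<in> carrier L \<Longrightarrow> P a \<Longrightarrow> P b \<Longrightarrow> P (a \<otimes>\<^bsub>L\<^esub> b)"
    and inv: "\<And>a. a \<in> Units L \<Longrightarrow> P a \<Longrightarrow> P (inv\<^bsub>L\<^esub> a)"
  shows "P x"
proof -
  have e: "P (emb a)" if "a \<in> carrier C" for a
    using that
  proof (induction rule: C_induct)
    case (gen g)
    show ?case
    proof (cases g)
      case gU
      then show ?thesis using U by (simp add: L_U_def)
    next
      case gR
      then show ?thesis using R by (simp add: L_R_def)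
    next
      case gRi
      then show ?thesis using inv[OF emb_gen_Units(1) R] emb_gen_Units(2) by (simp add: L_Ri_def)
    next
      case gW
      then show ?thesis using W by (simp add: L_W_def)
    next
      case gWi
      then show ?thesis using inv[OF emb_gen_Units(3) W] emb_gen_Units(4) by (simp add: L_Wi_def)
    qed
  next
    case (scal c)
    then show ?case
      using assms(5)[of c] by (simp add: calg_hom_smult[OF hom_emb] calg_hom_one[OF hom_emb])
  next
    case (add a b)
    then show ?case using assms(6)[of "emb a" "emb b"] by (simp add: calg_hom_add[OF hom_emb])
  next
    case (mult a b)
    then show ?case using assms(7)[of "emb a" "emb b"] by (simp add: calg_hom_mult[OF hom_emb])
  qed
  have i: "P (inv\<^bsub>L\<^esub> (emb p))" if "p \<in> Zp" for p
    by (rule inv[OF emb_Units[OF that] e[OF subsetD[OF Zp_subset that]]])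
  show ?thesis
    by (rule loc_induct[of x C Zp P, folded L_alg_def L_emb_def, OF x Zp_subset C.calgebra_axioms])
      (use e i add mult in \<open>simp_all add: L_alg_def L_emb_def\<close>)
qed

lemma hom_unique:
  assumes B: "calgebra B" and f: "calg_hom L B f" and g: "calg_hom L B g"
    and eq: "f (L_U hbar) = g (L_U hbar)" "f (L_R hbar) = g (L_R hbar)" "f (L_W hbar) = g (L_W hbar)"
    and x: "x \<in> carrier L"
  shows "f x = g x"
  using x
proof (induction rule: L_induct)
  case (inv a)
  then show ?case
    using calg_hom_Units(2)[OF L.calgebra_axioms B f inv(1)]
      calg_hom_Units(2)[OF L.calgebra_axioms B g inv(1)] by simp
qed (use eq in \<open>simp_all add: calg_homD[OF f] calg_homD[OF g]\<close>)

lemma derivation_unique: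
  assumes f: "derivation L f" and g: "derivation L g"
    and eq: "f (L_U hbar) = g (L_U hbar)" "f (L_R hbar) = g (L_R hbar)" "f (L_W hbar) = g (L_W hbar)"
    and x: "x \<in> carrier L"
  shows "f x = g x"
  using x
proof (induction rule: L_induct)
  case (inv a)
  then show ?case
    using L.derivation_inv[OF f inv(1)] L.derivation_inv[OF g inv(1)] by simp
next
  case (scal c)
  then show ?case
    by (simp add: L.derivation_smult[OF f] L.derivation_smult[OF g] L.derivation_one[OF f] L.derivation_one[OF g])
qed (use eq in \<open>simp_all add: L.derivationD[OF f] L.derivationD[OF g]\<close>)

lemma L_rels:
  shows L_R_U: "L_R hbar \<otimes>\<^bsub>L\<^esub> L_U hbar = L_U hbar \<otimes>\<^bsub>L\<^esub> L_R hbar"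
    and L_W_R: "L_W hbar \<otimes>\<^bsub>L\<^esub> L_R hbar = of_real (exp hbar) \<odot>\<^bsub>L\<^esub> (L_R hbar \<otimes>\<^bsub>L\<^esub> L_W hbar)"
    and L_W_U: "L_W hbar \<otimes>\<^bsub>L\<^esub> L_U hbar =
      (L_U hbar \<otimes>\<^bsub>L\<^esub> L_W hbar) \<oplus>\<^bsub>L\<^esub> (of_real hbar \<odot>\<^bsub>L\<^esub> L_W hbar)"
  using arg_cong[OF R_U, of emb] arg_cong[OF W_R, of emb] arg_cong[OF W_U, of emb]
  by (simp_all add: L_U_def L_R_def L_W_def calg_homD[OF hom_emb])

lemma W_Wi_inv [simp]:
  "L_W hbar \<otimes>\<^bsub>L\<^esub> L_Wi hbar = \<one>\<^bsub>L\<^esub>" "L_Wi hbar \<otimes>\<^bsub>L\<^esub> L_W hbar = \<one>\<^bsub>L\<^esub>"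
  using emb_gen_Units(3) L.Units_r_inv[OF emb_gen_Units(3)] L.Units_l_inv[OF emb_gen_Units(3)]
  by (simp_all add: emb_gen_Units(4))

lemma L_Wi_Units: "L_Wi hbar \<in> Units L" "inv\<^bsub>L\<^esub> (L_Wi hbar) = L_W hbar"
  using L.Units_inv_Units[OF emb_gen_Units(3)] L.Units_inv_inv[OF emb_gen_Units(3)]
  by (simp_all add: emb_gen_Units(4))

lemma cop_hom:
  obtains s where "calg_hom L (cop_alg L) s" "s (L_U hbar) = L_U hbar" "s (L_R hbar) = L_R hbar"
    "s (L_W hbar) = L_Wi hbar"
proof -
  let ?B = "cop_alg L"
  have R_Wi: "L_R hbar \<otimes>\<^bsub>L\<^esub> L_Wi hbar = of_real (exp hbar) \<odot>\<^bsub>L\<^esub> (L_Wi hbar \<otimes>\<^bsub>L\<^esub> L_R hbar)"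
  proof -
    have "L_R hbar \<otimes>\<^bsub>L\<^esub> L_Wi hbar = L_Wi hbar \<otimes>\<^bsub>L\<^esub> (L_W hbar \<otimes>\<^bsub>L\<^esub> L_R hbar) \<otimes>\<^bsub>L\<^esub> L_Wi hbar"
      by (simp flip: L.m_assoc)
    also have "\<dots> = of_real (exp hbar) \<odot>\<^bsub>L\<^esub> (L_Wi hbar \<otimes>\<^bsub>L\<^esub> L_R hbar)"
      unfolding L_W_R by (simp add: L.smult_mult_l L.smult_mult_r L.m_assoc)
    finally show ?thesis .
  qed
  have U_Wi: "L_U hbar \<otimes>\<^bsub>L\<^esub> L_Wi hbar =
      (L_Wi hbar \<otimes>\<^bsub>L\<^esub> L_U hbar) \<oplus>\<^bsub>L\<^esub> (of_real hbar \<odot>\<^bsub>L\<^esub> L_Wi hbar)"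
  proof -
    have "L_U hbar \<otimes>\<^bsub>L\<^esub> L_Wi hbar = L_Wi hbar \<otimes>\<^bsub>L\<^esub> (L_W hbar \<otimes>\<^bsub>L\<^esub> L_U hbar) \<otimes>\<^bsub>L\<^esub> L_Wi hbar"
      by (simp flip: L.m_assoc)
    also have "\<dots> = (L_Wi hbar \<otimes>\<^bsub>L\<^esub> L_U hbar) \<oplus>\<^bsub>L\<^esub> (of_real hbar \<odot>\<^bsub>L\<^esub> L_Wi hbar)"
      unfolding L_W_U by (simp add: L.l_distr L.r_distr L.smult_mult_l L.smult_mult_r L.m_assoc)
    finally show ?thesis .
  qed
  obtain s0 where s0: "calg_hom C ?B s0" "s0 (C_gen hbar gU) = L_U hbar"
    "s0 (C_gen hbar gR) = L_R hbar" "s0 (C_gen hbar gRi) = inv\<^bsub>?B\<^esub> (L_R hbar)"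
    "s0 (C_gen hbar gW) = L_Wi hbar"
  proof (rule C_universal[of ?B "L_U hbar" "L_R hbar" "L_Wi hbar" hbar])
    show "calgebra ?B" by (rule L.calgebra_cop_alg)
    show "L_U hbar \<in> carrier ?B" by (simp add: cop_alg_def)
    show "L_R hbar \<in> Units ?B" "L_Wi hbar \<in> Units ?B"
      using emb_gen_Units L_Wi_Units by simp_all
    show "L_R hbar \<otimes>\<^bsub>?B\<^esub> L_U hbar = L_U hbar \<otimes>\<^bsub>?B\<^esub> L_R hbar"
      using L_R_U by (simp add: cop_alg_def)
    show "L_Wi hbar \<otimes>\<^bsub>?B\<^esub> L_R hbar = of_real (exp hbar) \<odot>\<^bsub>?B\<^esub> (L_R hbar \<otimes>\<^bsub>?B\<^esub> L_Wi hbar)"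
      using R_Wi by (simp add: cop_alg_def)
    show "L_Wi hbar \<otimes>\<^bsub>?B\<^esub> L_U hbar =
      (L_U hbar \<otimes>\<^bsub>?B\<^esub> L_Wi hbar) \<oplus>\<^bsub>?B\<^esub> (of_real hbar \<odot>\<^bsub>?B\<^esub> L_Wi hbar)"
      using U_Wi by (simp add: cop_alg_def)
  qed
  have Z: "\<exists>q\<in>Z. s0 p = emb q \<and> phi_Z hbar q = (\<lambda>u. cnj (phi_Z hbar p u))" if "p \<in> Z" for p
    using that[unfolded Z_eq] Zgens_subset
  proof (induction rule: C.gen_subalg_induct)
    case (gen h)
    then show ?case
      using s0 emb_gen_Units(2) Z_gen
      by (intro bexI[of _ h])
        (auto simp: Zgens_def L_U_def L_R_def L_Ri_def phi_Z_U phi_Z_R phi_Z_Ri)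
  next
    case (scal c)
    then show ?case
      by (intro bexI[of _ "cnj c \<odot>\<^bsub>C\<^esub> \<one>\<^bsub>C\<^esub>"])
        (simp_all add: Z_ops phi_Z_ops calg_homD[OF s0(1)] calg_homD[OF hom_emb], simp add: cop_alg_def)
  next
    case (add a b)
    obtain a' b' where ab: "a' \<in> Z" "s0 a = emb a'" "phi_Z hbar a' = (\<lambda>u. cnj (phi_Z hbar a u))"
      "b' \<in> Z" "s0 b = emb b'" "phi_Z hbar b' = (\<lambda>u. cnj (phi_Z hbar b u))"
      using add.IH by (elim bexE conjE)
    have Z: "a \<in> Z" "b \<in> Z" using add.hyps by (simp_all add: Z_eq)
    have "s0 (a \<oplus>\<^bsub>C\<^esub> b) = emb (a' \<oplus>\<^bsub>C\<^esub> b')"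
      using ab Z by (simp add: calg_hom_add[OF s0(1)] calg_hom_add[OF hom_emb] Z_closed)
        (simp add: cop_alg_def)
    then show ?case using ab Z
      by (intro bexI[of _ "a' \<oplus>\<^bsub>C\<^esub> b'"]) (simp_all add: Z_ops phi_Z_ops)
  next
    case (mult a b)
    obtain a' b' where ab: "a' \<in> Z" "s0 a = emb a'" "phi_Z hbar a' = (\<lambda>u. cnj (phi_Z hbar a u))"
      "b' \<in> Z" "s0 b = emb b'" "phi_Z hbar b' = (\<lambda>u. cnj (phi_Z hbar b u))"
      using mult.IH by (elim bexE conjE)
    have Z: "a \<in> Z" "b \<in> Z" using mult.hyps by (simp_all add: Z_eq)
    have "s0 (a \<otimes>\<^bsub>C\<^esub> b) = emb (b' \<otimes>\<^bsub>C\<^esub> a')"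
      using ab Z by (simp add: calg_hom_mult[OF s0(1)] calg_hom_mult[OF hom_emb] Z_closed)
        (simp add: cop_alg_def)
    then show ?case using ab Z
      by (intro bexI[of _ "b' \<otimes>\<^bsub>C\<^esub> a'"]) (simp_all add: Z_ops phi_Z_ops mult.commute)
  qed
  have Zp: "s0 p \<in> Units ?B" if "p \<in> Zp" for p
  proof -
    have "p \<in> Z" using that by (simp add: Zp_iff)
    from Z[OF this] obtain q where q: "q \<in> Z" "s0 p = emb q" "phi_Z hbar q = (\<lambda>u. cnj (phi_Z hbar p u))"
      by (elim bexE conjE)
    then have "q \<in> Zp" using that by (simp add: Zp_iff)
    then show ?thesis using q emb_Units by simp
  qed
  obtain s where s: "calg_hom L ?B s" "\<And>a. a \<in> carrier C \<Longrightarrow> s (emb a) = s0 a"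
    by (rule L_universal[OF L.calgebra_cop_alg s0(1) Zp]) (assumption, rule that)
  show ?thesis
  proof (rule that[OF s(1)])
    show "s (L_U hbar) = L_U hbar" using s(2)[of "C_gen hbar gU"] by (simp add: s0(2)) (simp add: L_U_def)
    show "s (L_R hbar) = L_R hbar" using s(2)[of "C_gen hbar gR"] by (simp add: s0(3)) (simp add: L_R_def)
    show "s (L_W hbar) = L_Wi hbar" using s(2)[of "C_gen hbar gW"] by (simp add: s0(5)) (simp add: L_W_def)
  qed
qed

lemma star_exists:
  "\<exists>st. involution L st \<and> st (L_U hbar) = L_U hbar \<and> st (L_R hbar) = L_R hbar \<and>
     st (L_W hbar) = L_Wi hbar"
proof -
  obtain s where s: "calg_hom L (cop_alg L) s" "s (L_U hbar) = L_U hbar" "s (L_R hbar) = L_R hbar"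
    "s (L_W hbar) = L_Wi hbar" by (rule cop_hom)
  have Wi: "s (L_Wi hbar) = L_W hbar"
    using calg_hom_Units(2)[OF L.calgebra_axioms L.calgebra_cop_alg s(1) emb_gen_Units(3)]
    by (simp add: s(4) emb_gen_Units(4) L_Wi_Units)
  have ss: "s (s a) = a" if "a \<in> carrier L" for a
    by (rule hom_unique[OF L.calgebra_axioms calg_hom_comp[OF s(1) calg_hom_cop_swap[OF s(1)]]
          L.calg_hom_id _ _ _ that]) (simp_all add: s Wi)
  have "involution L s"
    using s(1) ss unfolding involution_def calg_hom_def by (simp add: cop_alg_def)
  then show ?thesis using s by auto
qed

lemma star:
  shows star_involution: "involution L (star hbar)"
    and star_U: "star hbar (L_U hbar) = L_U hbar"
    and star_R: "star hbar (L_R hbar) = L_R hbar"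
    and star_W: "star hbar (L_W hbar) = L_Wi hbar"
  using someI_ex[OF star_exists] unfolding star_def by simp_all

lemma
  shows star_closed: "a \<in> carrier L \<Longrightarrow> star hbar a \<in> carrier L"
    and star_star: "a \<in> carrier L \<Longrightarrow> star hbar (star hbar a) = a"
    and star_add: "a \<in> carrier L \<Longrightarrow> b \<in> carrier L \<Longrightarrow> star hbar (a \<oplus>\<^bsub>L\<^esub> b) = star hbar a \<oplus>\<^bsub>L\<^esub> star hbar b"
    and star_mult: "a \<in> carrier L \<Longrightarrow> b \<in> carrier L \<Longrightarrow> star hbar (a \<otimes>\<^bsub>L\<^esub> b) = star hbar b \<otimes>\<^bsub>L\<^esub> star hbar a"
    and star_smult: "a \<in> carrier L \<Longrightarrow> star hbar (c \<odot>\<^bsub>L\<^esub> a) = cnj c \<odot>\<^bsub>L\<^esub> star hbar a"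
  using star_involution unfolding involution_def by simp_all

lemma star_one: "star hbar \<one>\<^bsub>L\<^esub> = \<one>\<^bsub>L\<^esub>"
  by (rule L.involution_one[OF star_involution])

lemma star_zero: "star hbar \<zero>\<^bsub>L\<^esub> = \<zero>\<^bsub>L\<^esub>"
  using star_smult[OF L.one_closed, of 0] by (simp add: star_one)

lemma hermitian_derivation_exists:
  assumes cl: "xU \<in> carrier L" "xR \<in> carrier L" "xW \<in> carrier L"
    and ru: "(xR \<otimes>\<^bsub>L\<^esub> L_U hbar) \<oplus>\<^bsub>L\<^esub> (L_R hbar \<otimes>\<^bsub>L\<^esub> xU) = (xU \<otimes>\<^bsub>L\<^esub> L_R hbar) \<oplus>\<^bsub>L\<^esub> (L_U hbar \<otimes>\<^bsub>L\<^esub> xR)"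
    and wr: "(xW \<otimes>\<^bsub>L\<^esub> L_R hbar) \<oplus>\<^bsub>L\<^esub> (L_W hbar \<otimes>\<^bsub>L\<^esub> xR) =
      of_real (exp hbar) \<odot>\<^bsub>L\<^esub> ((xR \<otimes>\<^bsub>L\<^esub> L_W hbar) \<oplus>\<^bsub>L\<^esub> (L_R hbar \<otimes>\<^bsub>L\<^esub> xW))"
    and wu: "(xW \<otimes>\<^bsub>L\<^esub> L_U hbar) \<oplus>\<^bsub>L\<^esub> (L_W hbar \<otimes>\<^bsub>L\<^esub> xU) =
      ((xU \<otimes>\<^bsub>L\<^esub> L_W hbar) \<oplus>\<^bsub>L\<^esub> (L_U hbar \<otimes>\<^bsub>L\<^esub> xW)) \<oplus>\<^bsub>L\<^esub> (of_real hbar \<odot>\<^bsub>L\<^esub> xW)"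
    and herm: "star hbar xU = xU" "star hbar xR = xR"
      "star hbar (\<ominus>\<^bsub>L\<^esub> (L_Wi hbar \<otimes>\<^bsub>L\<^esub> xW \<otimes>\<^bsub>L\<^esub> L_Wi hbar)) = xW"
  shows "\<exists>D. hermitian_derivation hbar D \<and> D (L_U hbar) = xU \<and> D (L_R hbar) = xR \<and> D (L_W hbar) = xW"
proof -
  let ?B = "dual_alg L"
  obtain d0 where d0: "calg_hom C ?B d0" "d0 (C_gen hbar gU) = (L_U hbar, xU)"
    "d0 (C_gen hbar gR) = (L_R hbar, xR)" "d0 (C_gen hbar gW) = (L_W hbar, xW)"
  proof (rule C_universal[of ?B "(L_U hbar, xU)" "(L_R hbar, xR)" "(L_W hbar, xW)" hbar])
    show "calgebra ?B" by (rule L.calgebra_dual_alg)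
    show "(L_U hbar, xU) \<in> carrier ?B" using cl by (simp add: dual_alg_def)
    show "(L_R hbar, xR) \<in> Units ?B" "(L_W hbar, xW) \<in> Units ?B"
      using emb_gen_Units cl by (simp_all add: L.Units_dual_alg)
  qed (use cl ru wr wu L_rels in \<open>simp_all add: dual_alg_def\<close>)
  have fst_hom: "calg_hom C L (\<lambda>a. fst (d0 a))"
    by (rule calg_hom_comp[OF d0(1) L.calg_hom_dual_fst])
  have e: "fst (d0 a) = emb a" if "a \<in> carrier C" for a
    using that
  proof (induction rule: C_induct)
    case (gen g)
    note i = calg_hom_Units(2)[OF C.calgebra_axioms L.calgebra_axioms fst_hom]
    have R: "C_gen hbar gR \<in> Units C" "inv\<^bsub>C\<^esub> (C_gen hbar gR) = C_gen hbar gRi"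
      and W: "C_gen hbar gW \<in> Units C" "inv\<^bsub>C\<^esub> (C_gen hbar gW) = C_gen hbar gWi"
      using C.inv_char[OF _ _ R_Ri Ri_R] C.inv_char[OF _ _ W_Wi Wi_W]
      unfolding Units_def
      by (simp_all, intro bexI[of _ "C_gen hbar gRi"] conjI R_Ri Ri_R C_gen_closed,
          intro bexI[of _ "C_gen hbar gWi"] conjI W_Wi Wi_W C_gen_closed)
    show ?case
      using d0 i[OF R(1)] i[OF W(1)] emb_gen_Units
      by (cases g) (simp_all add: R W L_U_def L_R_def L_Ri_def L_W_def L_Wi_def)
  qed (simp_all add: calg_homD[OF fst_hom] calg_homD[OF hom_emb])
  have Zp: "d0 p \<in> Units ?B" if "p \<in> Zp" for p
  proof -
    have p: "p \<in> carrier C" using Zp_subset that by (rule subsetD)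
    then have "snd (d0 p) \<in> carrier L" using calg_hom_closed[OF d0(1) p] by (auto simp: dual_alg_def)
    then have "(emb p, snd (d0 p)) \<in> Units ?B" using emb_Units[OF that] by (simp add: L.Units_dual_alg)
    then show ?thesis using e[OF p] by (metis prod.collapse)
  qed
  obtain d where d: "calg_hom L ?B d" "\<And>a. a \<in> carrier C \<Longrightarrow> d (emb a) = d0 a"
    by (rule L_universal[OF L.calgebra_dual_alg d0(1) Zp]) (assumption, rule that)
  have dv: "d (L_U hbar) = (L_U hbar, xU)" "d (L_R hbar) = (L_R hbar, xR)" "d (L_W hbar) = (L_W hbar, xW)"
    using d(2)[of "C_gen hbar gU"] d(2)[of "C_gen hbar gR"] d(2)[of "C_gen hbar gW"] d0
    by (simp_all add: L_U_def L_R_def L_W_def)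
  have fst: "fst (d a) = a" if "a \<in> carrier L" for a
    by (rule hom_unique[OF L.calgebra_axioms calg_hom_comp[OF d(1) L.calg_hom_dual_fst]
          L.calg_hom_id _ _ _ that]) (simp_all add: dv)
  define D where "D a = snd (d a)" for a
  have D: "derivation L D"
    unfolding D_def[abs_def] by (rule L.derivation_snd[OF d(1) fst])
  have Dv: "D (L_U hbar) = xU" "D (L_R hbar) = xR" "D (L_W hbar) = xW"
    by (simp_all add: D_def dv)
  define E where "E a = star hbar (D (star hbar a))" for a
  note cls = star_closed L.derivation_closed[OF D]
  have E: "derivation L E"
    unfolding derivation_def E_def
    by (auto simp: cls star_add star_mult star_smult star_star L.derivationD[OF D] L.a_comm)
  have "D (L_Wi hbar) = \<ominus>\<^bsub>L\<^esub> (L_Wi hbar \<otimes>\<^bsub>L\<^esub> xW \<otimes>\<^bsub>L\<^esub> L_Wi hbar)"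
    using L.derivation_inv[OF D emb_gen_Units(3)] by (simp only: emb_gen_Units(4) Dv)
  then have Ev: "E (L_U hbar) = xU" "E (L_R hbar) = xR" "E (L_W hbar) = xW"
    by (simp_all only: E_def star_U star_R star_W Dv herm)
  have DE: "D a = E a" if "a \<in> carrier L" for a
    by (rule derivation_unique[OF D E _ _ _ that]) (simp_all only: Dv Ev)
  have "D (star hbar a) = star hbar (D a)" if "a \<in> carrier L" for a
    using DE[OF star_closed[OF that]] that by (simp add: E_def star_star)
  then show ?thesis unfolding hermitian_derivation_def using D Dv by auto
qed

lemma du_exists:
  "\<exists>D. hermitian_derivation hbar D \<and> D (L_U hbar) = \<one>\<^bsub>L\<^esub> \<and> D (L_R hbar) = L_R hbar \<and>
     D (L_W hbar) = \<zero>\<^bsub>L\<^esub>"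
  by (rule hermitian_derivation_exists)
    (simp_all add: L_R_U L_W_R star_one star_R star_zero L.a_comm)

lemma dv_exists:
  "\<exists>D. hermitian_derivation hbar D \<and> D (L_U hbar) = \<zero>\<^bsub>L\<^esub> \<and> D (L_R hbar) = \<zero>\<^bsub>L\<^esub> \<and>
     D (L_W hbar) = \<i> \<odot>\<^bsub>L\<^esub> L_W hbar"
proof (rule hermitian_derivation_exists)
  have "\<ominus>\<^bsub>L\<^esub> (L_Wi hbar \<otimes>\<^bsub>L\<^esub> (\<i> \<odot>\<^bsub>L\<^esub> L_W hbar) \<otimes>\<^bsub>L\<^esub> L_Wi hbar) = (- \<i>) \<odot>\<^bsub>L\<^esub> L_Wi hbar"
    by (simp add: L.smult_mult_l L.smult_mult_r L.smult_uminus)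
  moreover have "star hbar (L_Wi hbar) = L_W hbar"
    using star_star[of "L_W hbar"] by (simp add: star_W)
  ultimately show "star hbar (\<ominus>\<^bsub>L\<^esub> (L_Wi hbar \<otimes>\<^bsub>L\<^esub> (\<i> \<odot>\<^bsub>L\<^esub> L_W hbar) \<otimes>\<^bsub>L\<^esub> L_Wi hbar)) =
      \<i> \<odot>\<^bsub>L\<^esub> L_W hbar"
    by (simp add: star_smult)
qed (simp_all add: L_W_R L_W_U star_zero L.smult_mult_l L.smult_mult_r L.smult_smult L.smult_r_distr mult.commute)

lemma du:
  shows du_derivation: "derivation L (du hbar)"
    and du_U: "du hbar (L_U hbar) = \<one>\<^bsub>L\<^esub>" and du_R: "du hbar (L_R hbar) = L_R hbar"
  using someI_ex[OF du_exists] unfolding du_def hermitian_derivation_def by simp_all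

lemma dv:
  shows dv_derivation: "derivation L (dv hbar)"
    and dv_U: "dv hbar (L_U hbar) = \<zero>\<^bsub>L\<^esub>" and dv_R: "dv hbar (L_R hbar) = \<zero>\<^bsub>L\<^esub>"
  using someI_ex[OF dv_exists] unfolding dv_def hermitian_derivation_def by simp_all

end

section \<open>Curvature of conformal metrics\<close>

lemma (in calgebra) smult_uminus_sum:
  assumes "a \<in> carrier A"
  shows "(1/2) \<odot> (\<ominus> ((1/4) \<odot> a) \<ominus> ((1/4) \<odot> a)) = (- 1/4) \<odot> a"
proof -
  have "\<ominus> ((1/4) \<odot> a) \<ominus> ((1/4) \<odot> a) = ((- (1/4)) + (- (1/4))) \<odot> a"
    unfolding smult_l_distr[OF assms] minus_eq using assms by (simp only: smult_uminus)
  then show ?thesis using assms by (simp add: smult_smult)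
qed

context catenoid
begin

lemma Fp_induct [consumes 1, case_names U R scal add mult inv]:
  assumes x: "x \<in> Fp" and U: "P (L_U hbar)" and R: "P (L_R hbar)"
    and scal: "\<And>c. P (c \<odot>\<^bsub>L\<^esub> \<one>\<^bsub>L\<^esub>)"
    and add: "\<And>a b. a \<in> Fp \<Longrightarrow> b \<in> Fp \<Longrightarrow> P a \<Longrightarrow> P b \<Longrightarrow> P (a \<oplus>\<^bsub>L\<^esub> b)"
    and mult: "\<And>a b. a \<in> Fp \<Longrightarrow> b \<in> Fp \<Longrightarrow> P a \<Longrightarrow> P b \<Longrightarrow> P (a \<otimes>\<^bsub>L\<^esub> b)"
    and inv: "\<And>a. a \<in> Fp \<Longrightarrow> a \<in> Units L \<Longrightarrow> P a \<Longrightarrow> P (inv\<^bsub>L\<^esub> a)"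
  shows "P x"
proof -
  have e: "P (emb p)" if "p \<in> Z" for p
    using that[unfolded Z_eq] Zgens_subset
  proof (induction rule: C.gen_subalg_induct)
    case (gen h)
    have "L_R hbar \<in> Fp" using Fp_emb[OF Z_gen(2)] by (simp add: L_R_def)
    from inv[OF this emb_gen_Units(1) R] have "P (L_Ri hbar)" by (simp add: emb_gen_Units(2))
    then show ?case using gen U R by (auto simp: Zgens_def L_U_def L_R_def L_Ri_def)
  next
    case (scal c)
    then show ?case
      using assms(4)[of c] by (simp add: calg_hom_smult[OF hom_emb] calg_hom_one[OF hom_emb])
  next
    case (add a b)
    then show ?case using assms(5)[of "emb a" "emb b"]
      by (simp add: calg_hom_add[OF hom_emb] Z_closed Fp_emb flip: Z_eq)
  next
    case (mult a b)
    then show ?case using assms(6)[of "emb a" "emb b"]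
      by (simp add: calg_hom_mult[OF hom_emb] Z_closed Fp_emb flip: Z_eq)
  qed
  show ?thesis
    using x[unfolded Fp_eq] Fgens_subset
  proof (induction rule: L.gen_subalg_induct)
    case (gen h)
    show ?case
    proof (cases "h \<in> emb ` Z")
      case True
      then show ?thesis using e by auto
    next
      case False
      then obtain q where q: "q \<in> Zp" "h = inv\<^bsub>L\<^esub> (emb q)" using gen by (auto simp: Fgens_def)
      then have "q \<in> Z" by (simp add: Zp_iff)
      then show ?thesis using inv[OF Fp_emb emb_Units e, of q] q by simp
    qed
  qed (use scal add mult in \<open>simp_all flip: Fp_eq\<close>)
qed

lemma dv_Fp: "a \<in> Fp \<Longrightarrow> dv hbar a = \<zero>\<^bsub>L\<^esub>"
proof (induction rule: Fp_induct)
  case (scal c)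
  then show ?case by (simp add: L.derivation_smult[OF dv_derivation] L.derivation_one[OF dv_derivation])
next
  case (inv a)
  then show ?case by (simp add: L.derivation_inv[OF dv_derivation])
qed (simp_all add: dv_U dv_R Fp_closed L.derivationD[OF dv_derivation])

lemma phi_minus: "a \<in> Fp \<Longrightarrow> phi hbar (\<ominus>\<^bsub>L\<^esub> a) = (\<lambda>u. - phi hbar a u)"
  using phi_smult[of a "-1"] by (simp add: L.smult_minus_1 Fp_closed)

lemma phi_L_U: "phi hbar (L_U hbar) = (\<lambda>u. of_real u)"
  and phi_L_R: "phi hbar (L_R hbar) = (\<lambda>u. of_real (exp u))"
  and phi_L_Ri: "phi hbar (L_Ri hbar) = (\<lambda>u. of_real (exp (- u)))"
  by (simp_all add: L_U_def L_R_def L_Ri_def phi_emb Z_gen phi_Z_U phi_Z_R phi_Z_Ri)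

lemma L_gen_Fp: "L_U hbar \<in> Fp" "L_R hbar \<in> Fp" "L_Ri hbar \<in> Fp"
  by (simp_all add: L_U_def L_R_def L_Ri_def Fp_emb Z_gen)

lemma du_Fp_phi:
  "a \<in> Fp \<Longrightarrow> du hbar a \<in> Fp \<and>
    (\<forall>u. (phi hbar a has_vector_derivative phi hbar (du hbar a) u) (at u))"
proof (induction rule: Fp_induct)
  case U
  have "((\<lambda>u. complex_of_real u) has_vector_derivative complex_of_real 1) (at u)" for u
    by (rule has_vector_derivative_of_real) (rule DERIV_ident)
  then show ?case by (simp add: du_U Fp_one phi_one phi_L_U)
next
  case R
  have "((\<lambda>u. complex_of_real (exp u)) has_vector_derivative complex_of_real (exp u)) (at u)" for u
    by (rule has_vector_derivative_of_real) (rule DERIV_exp)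
  then show ?case by (simp add: du_R L_gen_Fp phi_L_R)
next
  case (scal c)
  have "du hbar (c \<odot>\<^bsub>L\<^esub> \<one>\<^bsub>L\<^esub>) = \<zero>\<^bsub>L\<^esub>"
    by (simp add: L.derivation_smult[OF du_derivation] L.derivation_one[OF du_derivation])
  then show ?case by (simp add: Fp_zero phi_zero phi_smult Fp_one phi_one)
next
  case (add a b)
  then show ?case
    by (simp add: L.derivation_add[OF du_derivation] Fp_closed Fp_add phi_add has_vector_derivative_add)
next
  case (mult a b)
  have "((\<lambda>u. phi hbar a u * phi hbar b u) has_vector_derivative
      phi hbar a u * phi hbar (du hbar b) u + phi hbar (du hbar a) u * phi hbar b u) (at u)" for u
    using mult by (intro has_vector_derivative_mult) simp_all
  with mult show ?case
    by (simp add: L.derivation_mult[OF du_derivation] Fp_closed Fp_add Fp_mult phi_add phi_mult add.commute)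
next
  case (inv a)
  have i: "inv\<^bsub>L\<^esub> a \<in> Fp" by (rule inv_Fp[OF inv(1,2)])
  have "((\<lambda>u. inverse (phi hbar a u)) has_vector_derivative
      - (inverse (phi hbar a u) * phi hbar (du hbar a) u * inverse (phi hbar a u))) (at u)" for u
  proof -
    have "(phi hbar a has_derivative (\<lambda>h. h *\<^sub>R phi hbar (du hbar a) u)) (at u)"
      using inv by (simp add: has_vector_derivative_def)
    from Deriv.has_derivative_inverse[OF phi_Units_nonzero[OF inv(1,2)] this] show ?thesis
      unfolding has_vector_derivative_def by (simp add: scaleR_conv_of_real mult_ac)
  qed
  with inv i show ?case
    by (simp add: L.derivation_inv[OF du_derivation] Fp_minus Fp_mult phi_minus phi_mult phi_inv)
qed

lemmas du_Fp = du_Fp_phi[THEN conjunct1]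
lemmas phi_du = du_Fp_phi[THEN conjunct2, rule_format]

lemma ddu_phi: "a \<in> Fp \<Longrightarrow> ddu (phi hbar a) = phi hbar (du hbar a)"
  unfolding ddu_def by (intro ext vector_derivative_at phi_du)

lemma del_Fp: "a \<in> Fp \<Longrightarrow> del hbar a = (1/2) \<odot>\<^bsub>L\<^esub> du hbar a"
  and delbar_Fp: "a \<in> Fp \<Longrightarrow> delbar hbar a = (1/2) \<odot>\<^bsub>L\<^esub> du hbar a"
  using Fp_closed[OF du_Fp] by (simp_all add: del_def delbar_def dv_Fp L.minus_eq)

lemma gauss_curvature_conformal:
  assumes S: "S \<in> Fp" "S \<in> Units L" and h: "conformal_metric hbar S h"
  shows "gauss_curvature hbar h =
    (- 1/4) \<odot>\<^bsub>L\<^esub> (du hbar (inv\<^bsub>L\<^esub> S \<otimes>\<^bsub>L\<^esub> du hbar S) \<otimes>\<^bsub>L\<^esub> inv\<^bsub>L\<^esub> S)"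
proof -
  let ?X = "inv\<^bsub>L\<^esub> S \<otimes>\<^bsub>L\<^esub> du hbar S"
  let ?Y = "du hbar ?X \<otimes>\<^bsub>L\<^esub> inv\<^bsub>L\<^esub> S"
  have hS: "h (Phi hbar) (Phi hbar) = S" "h (Phi_bar hbar) (Phi_bar hbar) = S"
    using h by (simp_all add: conformal_metric_def)
  have i: "inv\<^bsub>L\<^esub> S \<in> Fp" by (rule inv_Fp[OF S])
  have X: "?X \<in> Fp" by (rule Fp_mult[OF i du_Fp[OF S(1)]])
  note cl = Fp_closed[OF i] Fp_closed[OF X] Fp_closed[OF du_Fp[OF X]] Fp_closed[OF du_Fp[OF S(1)]]
  have half: "inv\<^bsub>L\<^esub> S \<otimes>\<^bsub>L\<^esub> ((1/2) \<odot>\<^bsub>L\<^esub> du hbar S) = (1/2) \<odot>\<^bsub>L\<^esub> ?X"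
    by (rule L.smult_mult_r) (rule cl)+
  have "du hbar ((1/2) \<odot>\<^bsub>L\<^esub> ?X) = (1/2) \<odot>\<^bsub>L\<^esub> du hbar ?X"
    by (rule L.derivation_smult[OF du_derivation cl(2)])
  then have d: "del hbar ((1/2) \<odot>\<^bsub>L\<^esub> ?X) \<otimes>\<^bsub>L\<^esub> inv\<^bsub>L\<^esub> S = (1/4) \<odot>\<^bsub>L\<^esub> ?Y"
    "delbar hbar ((1/2) \<odot>\<^bsub>L\<^esub> ?X) \<otimes>\<^bsub>L\<^esub> inv\<^bsub>L\<^esub> S = (1/4) \<odot>\<^bsub>L\<^esub> ?Y"
    using cl by (simp_all add: del_Fp delbar_Fp X Fp_smult L.smult_smult L.smult_mult_l)
  have "scalar_curvature hbar h = \<ominus>\<^bsub>L\<^esub> ((1/4) \<odot>\<^bsub>L\<^esub> ?Y) \<ominus>\<^bsub>L\<^esub> ((1/4) \<odot>\<^bsub>L\<^esub> ?Y)"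
    unfolding scalar_curvature_def Let_def hS del_Fp[OF S(1)] delbar_Fp[OF S(1)] half d ..
  moreover have "?Y \<in> carrier L" using cl by simp
  ultimately show ?thesis by (simp only: gauss_curvature_def L.smult_uminus_sum)
qed

lemma phi_log_derivative:
  assumes S: "S \<in> Fp" "S \<in> Units L"
  shows "phi hbar (inv\<^bsub>L\<^esub> S \<otimes>\<^bsub>L\<^esub> du hbar S) = (\<lambda>u. inverse (phi hbar S u) * ddu (phi hbar S) u)"
  by (simp add: phi_mult[OF inv_Fp[OF S] du_Fp[OF S(1)]] phi_inv[OF S] ddu_phi[OF S(1)])

lemma log_derivative_has_derivative:
  assumes S: "S \<in> Fp" "S \<in> Units L"
  defines "g \<equiv> \<lambda>u. inverse (phi hbar S u) * ddu (phi hbar S) u"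
  shows "(g has_vector_derivative ddu g u) (at u)"
proof -
  have X: "inv\<^bsub>L\<^esub> S \<otimes>\<^bsub>L\<^esub> du hbar S \<in> Fp" by (rule Fp_mult[OF inv_Fp[OF S] du_Fp[OF S(1)]])
  have g: "phi hbar (inv\<^bsub>L\<^esub> S \<otimes>\<^bsub>L\<^esub> du hbar S) = g"
    unfolding g_def by (rule phi_log_derivative[OF S])
  show ?thesis using phi_du[OF X, of u] ddu_phi[OF X] unfolding g by simp
qed

lemma tau_integrand_conformal:
  assumes S: "S \<in> Fp" "S \<in> Units L" and h: "conformal_metric hbar S h"
  defines "g \<equiv> \<lambda>u. inverse (phi hbar S u) * ddu (phi hbar S) u"
  shows "tau_integrand hbar h (gauss_curvature hbar h) = (\<lambda>u. (- 1/4) * ddu g u)"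
proof
  fix u
  let ?X = "inv\<^bsub>L\<^esub> S \<otimes>\<^bsub>L\<^esub> du hbar S"
  have i: "inv\<^bsub>L\<^esub> S \<in> Fp" by (rule inv_Fp[OF S])
  have X: "?X \<in> Fp" by (rule Fp_mult[OF i du_Fp[OF S(1)]])
  have Y: "du hbar ?X \<otimes>\<^bsub>L\<^esub> inv\<^bsub>L\<^esub> S \<in> Fp" by (rule Fp_mult[OF du_Fp[OF X] i])
  have g: "phi hbar (du hbar ?X) = ddu g"
    using ddu_phi[OF X] unfolding g_def phi_log_derivative[OF S] by simp
  have hS: "h (Phi hbar) (Phi hbar) = S" using h by (simp add: conformal_metric_def)
  note K = gauss_curvature_conformal[OF S h]
  have "gauss_curvature hbar h \<in> Fp" unfolding K by (rule Fp_smult[OF Y])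
  from phi_W_coeff_0[OF this] have
    "phi hbar (W_coeff hbar (gauss_curvature hbar h) 0) u = (- 1/4) * (ddu g u * inverse (phi hbar S u))"
    unfolding K phi_smult[OF Y] phi_mult[OF du_Fp[OF X] i] g phi_inv[OF S] by simp
  then show "tau_integrand hbar h (gauss_curvature hbar h) u = (- 1/4) * ddu g u"
    using phi_Units_nonzero[OF S, of u] by (simp add: tau_integrand_def hS)
qed

end

section \<open>Integrals of derivatives over the real line\<close>

lemma ball_subset_cbox_iff:
  fixes a b B :: real
  assumes "B > 0"
  shows "ball 0 B \<subseteq> cbox a b \<longleftrightarrow> a \<le> - B \<and> B \<le> b"
  using assms by (simp add: ball_eq_greaterThanLessThan greaterThanLessThan_subseteq_atLeastAtMost_iff)

lemma has_integral_derivative_cbox: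
  fixes g :: "real \<Rightarrow> 'a::banach"
  assumes "\<And>u. (g has_vector_derivative g' u) (at u)" "a \<le> b"
  shows "(g' has_integral (g b - g a)) (cbox a b)"
  unfolding cbox_interval
  by (rule fundamental_theorem_of_calculus[OF assms(2)])
    (rule has_vector_derivative_at_within, rule assms(1))

lemma limits_of_integrable_derivative:
  fixes g :: "real \<Rightarrow> 'a::banach"
  assumes g: "\<And>u. (g has_vector_derivative g' u) (at u)" and I: "(g' has_integral I) UNIV"
  obtains p m where "(g \<longlongrightarrow> p) at_top" "(g \<longlongrightarrow> m) at_bot" "I = p - m"
proof -
  have B: "\<exists>B>0. \<forall>a b. a \<le> - B \<longrightarrow> B \<le> b \<longrightarrow> norm (g b - g a - I) < e" if "e > 0" for e
  proof -
    from iffD1[OF has_integral' I, THEN spec, THEN mp, OF \<open>e > 0\<close>]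
    obtain B where B: "B > 0" "\<forall>a b. ball 0 B \<subseteq> cbox a b \<longrightarrow>
        (\<exists>z. ((\<lambda>x. if x \<in> UNIV then g' x else 0) has_integral z) (cbox a b) \<and> norm (z - I) < e)"
      by (elim exE conjE)
    have "norm (g b - g a - I) < e" if "a \<le> - B" "B \<le> b" for a b
    proof -
      have "ball 0 B \<subseteq> cbox a b" unfolding ball_subset_cbox_iff[OF B(1)] using that by simp
      from B(2)[rule_format, OF this]
      obtain z where z: "(g' has_integral z) (cbox a b)" "norm (z - I) < e"
        unfolding if_P[OF UNIV_I] by (elim exE conjE)
      have "z = g b - g a"
        using has_integral_unique[OF z(1) has_integral_derivative_cbox[OF g]] that B(1) by simp
      then show ?thesis using z by simp
    qed
    then show ?thesis using B(1) by blast
  qed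
  have cau: "\<exists>B>0. \<forall>x y. B \<le> x \<longrightarrow> B \<le> y \<longrightarrow> norm (g x - g y) < e" if "e > 0" for e
  proof -
    obtain B where B: "B > 0" "\<And>a b. a \<le> - B \<Longrightarrow> B \<le> b \<Longrightarrow> norm (g b - g a - I) < e / 2"
      using B[of "e / 2"] \<open>e > 0\<close> by auto
    have "norm (g x - g y) < e" if "B \<le> x" "B \<le> y" for x y
      using norm_triangle_ineq4[of "g x - g (- B) - I" "g y - g (- B) - I"]
        B(2)[of "- B" x] B(2)[of "- B" y] that by simp
    then show ?thesis using B(1) by blast
  qed
  have "Cauchy (\<lambda>n. g (real n))"
  proof (rule metric_CauchyI)
    fix e :: real assume "e > 0"
    then obtain B where B: "B > 0" "\<And>x y. B \<le> x \<Longrightarrow> B \<le> y \<Longrightarrow> norm (g x - g y) < e"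
      using cau by blast
    obtain N where N: "B \<le> real N" using real_arch_simple by blast
    have "dist (g (real m)) (g (real n)) < e" if "m \<ge> N" "n \<ge> N" for m n
      using B(2)[of "real m" "real n"] N that by (simp add: dist_norm)
    then show "\<exists>M. \<forall>m\<ge>M. \<forall>n\<ge>M. dist (g (real m)) (g (real n)) < e" by blast
  qed
  then obtain p where p: "(\<lambda>n. g (real n)) \<longlonglongrightarrow> p"
    using Cauchy_convergent_iff convergent_def by blast
  have top: "(g \<longlongrightarrow> p) at_top"
    unfolding tendsto_iff
  proof (intro allI impI)
    fix e :: real assume e: "e > 0"
    then obtain B where B: "B > 0" "\<And>x y. B \<le> x \<Longrightarrow> B \<le> y \<Longrightarrow> norm (g x - g y) < e / 2"
      using cau[of "e / 2"] by auto
    have le: "norm (g x - p) \<le> e / 2" if "B \<le> x" for x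
    proof (rule Lim_bounded)
      show "(\<lambda>n. norm (g x - g (real n))) \<longlonglongrightarrow> norm (g x - p)"
        by (intro tendsto_intros p)
      show "\<forall>n\<ge>nat \<lceil>B\<rceil>. norm (g x - g (real n)) \<le> e / 2"
        using B(2)[OF that] by (auto intro!: less_imp_le simp: nat_le_iff ceiling_le_iff)
    qed
    show "\<forall>\<^sub>F x in at_top. dist (g x) p < e"
      unfolding eventually_at_top_linorder
      by (rule exI[of _ B]) (use le e in \<open>force simp: dist_norm\<close>)
  qed
  have "(g \<longlongrightarrow> p - I) at_bot"
    unfolding tendsto_iff
  proof (intro allI impI)
    fix e :: real assume e: "e > 0"
    then obtain B where B: "B > 0" "\<And>a b. a \<le> - B \<Longrightarrow> B \<le> b \<Longrightarrow> norm (g b - g a - I) < e / 2"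
      using B[of "e / 2"] by auto
    have le: "norm (p - g a - I) \<le> e / 2" if "a \<le> - B" for a
    proof (rule tendsto_upperbound)
      show "((\<lambda>b. norm (g b - g a - I)) \<longlongrightarrow> norm (p - g a - I)) at_top"
        by (intro tendsto_intros top)
      show "\<forall>\<^sub>F b in at_top. norm (g b - g a - I) \<le> e / 2"
        unfolding eventually_at_top_linorder using B(2)[OF that] less_imp_le by blast
    qed simp
    have "dist (g a) (p - I) < e" if "a \<le> - B" for a
    proof -
      have "dist (g a) (p - I) = norm (p - g a - I)"
        by (simp add: dist_norm norm_minus_commute algebra_simps)
      then show ?thesis using le[OF that] e by simp
    qed
    then show "\<forall>\<^sub>F a in at_bot. dist (g a) (p - I) < e"
      unfolding eventually_at_bot_linorder by blast
  qed
  then show ?thesis using that[OF top] by simp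
qed

lemma integrable_derivative_of_limits:
  fixes g :: "real \<Rightarrow> 'a::banach"
  assumes g: "\<And>u. (g has_vector_derivative g' u) (at u)"
    and lim: "(g \<longlongrightarrow> p) at_top" "(g \<longlongrightarrow> m) at_bot"
  shows "g' integrable_on UNIV"
proof -
  have "(g' has_integral (p - m)) UNIV"
  proof (rule iffD2[OF has_integral'], intro allI impI)
    fix e :: real assume e: "e > 0"
    obtain X where X: "\<And>x. X \<le> x \<Longrightarrow> norm (g x - p) < e / 2"
      using lim(1) e unfolding tendsto_iff eventually_at_top_linorder dist_norm
      by (meson half_gt_zero)
    obtain Y where Y: "\<And>y. y \<le> Y \<Longrightarrow> norm (g y - m) < e / 2"
      using lim(2) e unfolding tendsto_iff eventually_at_bot_linorder dist_norm
      by (meson half_gt_zero)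
    define B where "B = max 1 (max X (- Y))"
    have B: "B > 0" "X \<le> B" "- B \<le> Y" unfolding B_def by auto
    have "((\<lambda>x. if x \<in> UNIV then g' x else 0) has_integral (g b - g a)) (cbox a b) \<and>
        norm (g b - g a - (p - m)) < e"
      if "ball 0 B \<subseteq> cbox a b" for a b
    proof -
      have ab: "a \<le> - B" "B \<le> b" using that ball_subset_cbox_iff[OF B(1)] by auto
      have "norm (g b - g a - (p - m)) = norm ((g b - p) - (g a - m))" by (simp add: algebra_simps)
      also have "\<dots> \<le> norm (g b - p) + norm (g a - m)" by (rule norm_triangle_ineq4)
      also have "\<dots> < e" using X[of b] Y[of a] ab B by simp
      finally show ?thesis using has_integral_derivative_cbox[OF g, of a b] ab B by simp
    qed
    then show "\<exists>B>0. \<forall>a b. ball 0 B \<subseteq> cbox a b \<longrightarrow>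
        (\<exists>z. ((\<lambda>x. if x \<in> UNIV then g' x else 0) has_integral z) (cbox a b) \<and> norm (z - (p - m)) < e)"
      using B(1) by blast
  qed
  then show ?thesis by blast
qed

section \<open>The catenoid metric\<close>

context catenoid
begin

lemma tau_conformal:
  assumes S: "S \<in> Fp" "S \<in> Units L" and h: "conformal_metric hbar S h"
  defines "g \<equiv> \<lambda>u. inverse (phi hbar S u) * ddu (phi hbar S) u"
  shows "tau_exists hbar h (gauss_curvature hbar h) \<longleftrightarrow> ddu g integrable_on UNIV" (is ?ex)
    and "ddu g integrable_on UNIV \<Longrightarrow>
      tau hbar h (gauss_curvature hbar h) = - of_real pi * integral UNIV (ddu g)"
    and "ddu g integrable_on UNIV \<Longrightarrow>
      \<exists>p m. (g \<longlongrightarrow> p) at_top \<and> (g \<longlongrightarrow> m) at_bot \<and> integral UNIV (ddu g) = p - m"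
proof -
  have t: "tau_integrand hbar h (gauss_curvature hbar h) = (\<lambda>u. (- 1/4) * ddu g u)"
    using tau_integrand_conformal[OF S h] by (simp only: g_def)
  show ?ex unfolding tau_exists_def t by (rule integrable_on_mult_right_iff) simp
  assume i: "ddu g integrable_on UNIV"
  have "((\<lambda>u. (- 1/4) * ddu g u) has_integral (- 1/4) * integral UNIV (ddu g)) UNIV"
    by (rule has_integral_mult_right[OF integrable_integral[OF i]])
  then have "integral UNIV (\<lambda>u. (- 1/4) * ddu g u) = (- 1/4) * integral UNIV (ddu g)"
    by (rule integral_unique)
  then show "tau hbar h (gauss_curvature hbar h) = - of_real pi * integral UNIV (ddu g)"
    unfolding tau_def t by simp
  have d: "(g has_vector_derivative ddu g u) (at u)" for u
    unfolding g_def by (rule log_derivative_has_derivative[OF S])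
  obtain p m where "(g \<longlongrightarrow> p) at_top" "(g \<longlongrightarrow> m) at_bot" "integral UNIV (ddu g) = p - m"
    by (rule limits_of_integrable_derivative[OF d integrable_integral[OF i]])
  then show "\<exists>p m. (g \<longlongrightarrow> p) at_top \<and> (g \<longlongrightarrow> m) at_bot \<and> integral UNIV (ddu g) = p - m"
    by (intro exI conjI)
qed

lemma cosh_factor_eq:
  "cosh_factor hbar = (1/4) \<odot>\<^bsub>L\<^esub> ((L_R hbar \<oplus>\<^bsub>L\<^esub> L_Ri hbar) \<otimes>\<^bsub>L\<^esub> (L_R hbar \<oplus>\<^bsub>L\<^esub> L_Ri hbar))"
  by (simp add: cosh_factor_def numeral_2_eq_2)

lemma cosh_factor_Fp: "cosh_factor hbar \<in> Fp"
  unfolding cosh_factor_eq by (intro Fp_smult Fp_mult Fp_add L_gen_Fp)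

lemma phi_cosh_factor: "phi hbar (cosh_factor hbar) = (\<lambda>u. of_real ((cosh u)\<^sup>2))"
proof
  fix u
  have "phi hbar (cosh_factor hbar) u =
      (1/4) * ((of_real (exp u) + of_real (exp (- u))) * (of_real (exp u) + of_real (exp (- u))))"
    unfolding cosh_factor_eq
    by (simp only: phi_smult phi_mult phi_add Fp_mult Fp_add L_gen_Fp phi_L_R phi_L_Ri)
  also have "\<dots> = of_real ((1/4) * ((exp u + exp (- u)) * (exp u + exp (- u))))"
    by simp
  also have "(1/4) * ((exp u + exp (- u)) * (exp u + exp (- u))) = (cosh u)\<^sup>2"
    by (simp add: cosh_field_def power2_eq_square)
  finally show "phi hbar (cosh_factor hbar) u = of_real ((cosh u)\<^sup>2)" .
qed

lemma cosh_factor_Units: "cosh_factor hbar \<in> Units L"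
proof -
  let ?s = "C_gen hbar gR \<oplus>\<^bsub>C\<^esub> C_gen hbar gRi"
  let ?p = "((1/4) \<odot>\<^bsub>C\<^esub> \<one>\<^bsub>C\<^esub>) \<otimes>\<^bsub>C\<^esub> (?s \<otimes>\<^bsub>C\<^esub> ?s)"
  have Z: "?p \<in> Z" by (intro Z_ops)
  have e: "emb ?p = cosh_factor hbar"
    unfolding cosh_factor_eq L_R_def L_Ri_def
    by (simp add: calg_homD[OF hom_emb] L.smult_one_mult)
  have "phi_Z hbar ?p = (\<lambda>u. of_real ((cosh u)\<^sup>2))"
    using phi_emb[OF Z] unfolding e phi_cosh_factor by simp
  then have "?p \<in> Zp" unfolding Zp_iff using Z by simp
  from emb_Units[OF this] show ?thesis unfolding e .
qed

lemma cosh_log_derivative: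
  "(\<lambda>u. inverse (phi hbar (cosh_factor hbar) u) * ddu (phi hbar (cosh_factor hbar)) u) =
    (\<lambda>u. of_real (2 * tanh u))"
proof
  fix u :: real
  have "((\<lambda>u. complex_of_real ((cosh u)\<^sup>2)) has_vector_derivative
      complex_of_real (2 * cosh u * sinh u)) (at u)"
    by (rule has_vector_derivative_of_real) (auto intro!: derivative_eq_intros)
  then have "ddu (\<lambda>u. complex_of_real ((cosh u)\<^sup>2)) u = of_real (2 * cosh u * sinh u)"
    unfolding ddu_def by (rule vector_derivative_at)
  moreover have "inverse ((cosh u)\<^sup>2) * (2 * cosh u * sinh u) = 2 * tanh u"
    by (simp add: tanh_def field_simps power2_eq_square)
  ultimately show "inverse (phi hbar (cosh_factor hbar) u) * ddu (phi hbar (cosh_factor hbar)) u =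
      of_real (2 * tanh u)"
    unfolding phi_cosh_factor by (simp only: flip: of_real_mult of_real_inverse)
qed

lemma tau_cosh_factor:
  assumes h: "conformal_metric hbar (cosh_factor hbar) h"
  shows "tau_exists hbar h (gauss_curvature hbar h)"
    and "tau hbar h (gauss_curvature hbar h) = - 4 * of_real pi"
proof -
  define g :: "real \<Rightarrow> complex" where "g = (\<lambda>u. of_real (2 * tanh u))"
  note S = cosh_factor_Fp cosh_factor_Units
  note t = tau_conformal[OF S h, unfolded cosh_log_derivative, folded g_def]
  have d: "(g has_vector_derivative ddu g u) (at u)" for u
    using log_derivative_has_derivative[OF S] unfolding cosh_log_derivative g_def .
  have top: "(g \<longlongrightarrow> of_real (2 * 1)) at_top" and bot: "(g \<longlongrightarrow> of_real (2 * (- 1))) at_bot"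
    unfolding g_def
    by (intro tendsto_of_real tendsto_mult tendsto_const tanh_real_at_top tanh_real_at_bot)+
  have i: "ddu g integrable_on UNIV"
    by (rule integrable_derivative_of_limits[OF d top bot])
  then show "tau_exists hbar h (gauss_curvature hbar h)" by (simp only: t(1))
  from t(3)[OF i] obtain p m where pm: "(g \<longlongrightarrow> p) at_top" "(g \<longlongrightarrow> m) at_bot"
    "integral UNIV (ddu g) = p - m" by (elim exE conjE)
  have "p = of_real (2 * 1)" "m = of_real (2 * (- 1))"
    using tendsto_unique[OF _ pm(1) top] tendsto_unique[OF _ pm(2) bot] by simp_all
  then have "integral UNIV (ddu g) = 4" using pm(3) by simp
  then show "tau hbar h (gauss_curvature hbar h) = - 4 * of_real pi" using t(2)[OF i] by simp
qed

end

theorem mainTheorem4: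
  fixes hbar :: real
  shows "(\<forall>S h. S \<in> F_plus hbar \<and> S \<in> Units (L_alg hbar) \<and> conformal_metric hbar S h \<longrightarrow>
      (let A = L_alg hbar; K = gauss_curvature hbar h; s = phi hbar S;
           g = (\<lambda>u. inverse (s u) * ddu s u)
       in K = (- 1/4) \<odot>\<^bsub>A\<^esub> (du hbar (inv\<^bsub>A\<^esub> S \<otimes>\<^bsub>A\<^esub> du hbar S) \<otimes>\<^bsub>A\<^esub> inv\<^bsub>A\<^esub> S) \<and>
          (tau_exists hbar h K \<longleftrightarrow> ddu g integrable_on UNIV) \<and>
          (tau_exists hbar h K \<longrightarrow>
             tau hbar h K = - of_real pi * integral UNIV (ddu g) \<and>
             (\<exists>g_plus g_minus. (g \<longlongrightarrow> g_plus) at_top \<and> (g \<longlongrightarrow> g_minus) at_bot \<and>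
                tau hbar h K = - of_real pi * (g_plus - g_minus)))))
    \<and> cosh_factor hbar \<in> F_plus hbar
    \<and> cosh_factor hbar \<in> Units (L_alg hbar)
    \<and> phi hbar (cosh_factor hbar) = (\<lambda>u. of_real ((cosh u)\<^sup>2))
    \<and> (\<forall>h. conformal_metric hbar (cosh_factor hbar) h \<longrightarrow>
         tau_exists hbar h (gauss_curvature hbar h) \<and>
         tau hbar h (gauss_curvature hbar h) = - 4 * of_real pi)"
proof -
  interpret catenoid hbar .
  have main: "let A = L_alg hbar; K = gauss_curvature hbar h; s = phi hbar S;
           g = (\<lambda>u. inverse (s u) * ddu s u)
       in K = (- 1/4) \<odot>\<^bsub>A\<^esub> (du hbar (inv\<^bsub>A\<^esub> S \<otimes>\<^bsub>A\<^esub> du hbar S) \<otimes>\<^bsub>A\<^esub> inv\<^bsub>A\<^esub> S) \<and>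
          (tau_exists hbar h K \<longleftrightarrow> ddu g integrable_on UNIV) \<and>
          (tau_exists hbar h K \<longrightarrow>
             tau hbar h K = - of_real pi * integral UNIV (ddu g) \<and>
             (\<exists>g_plus g_minus. (g \<longlongrightarrow> g_plus) at_top \<and> (g \<longlongrightarrow> g_minus) at_bot \<and>
                tau hbar h K = - of_real pi * (g_plus - g_minus)))"
    if "S \<in> F_plus hbar \<and> S \<in> Units (L_alg hbar) \<and> conformal_metric hbar S h" for S h
  proof -
    from that have S: "S \<in> Fp" "S \<in> Units L" and h: "conformal_metric hbar S h" by simp_all
    note t = tau_conformal[OF S h]
    show ?thesis
      unfolding Let_def t(1)
    proof (intro conjI impI refl)
      assume i: "ddu (\<lambda>u. inverse (phi hbar S u) * ddu (phi hbar S) u) integrable_on UNIV"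
      show "tau hbar h (gauss_curvature hbar h) =
          - of_real pi * integral UNIV (ddu (\<lambda>u. inverse (phi hbar S u) * ddu (phi hbar S) u))"
        by (rule t(2)[OF i])
      from t(3)[OF i] show "\<exists>g_plus g_minus.
          ((\<lambda>u. inverse (phi hbar S u) * ddu (phi hbar S) u) \<longlongrightarrow> g_plus) at_top \<and>
          ((\<lambda>u. inverse (phi hbar S u) * ddu (phi hbar S) u) \<longlongrightarrow> g_minus) at_bot \<and>
          tau hbar h (gauss_curvature hbar h) = - of_real pi * (g_plus - g_minus)"
        unfolding t(2)[OF i] by (elim exE conjE, intro exI conjI) (assumption | simp)+
    qed (rule gauss_curvature_conformal[OF S h])
  qed
  show ?thesis
    by (intro conjI allI impI;
        (erule main tau_cosh_factor | rule cosh_factor_Fp cosh_factor_Units phi_cosh_factor))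
qed

end
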